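(* Let $T\colon[0,1]\to[0,1]$ be a piecewise expanding map: there is a finite partition of $[0,1]$ into intervals $C_1,\dots,C_n$ such that $(0,1)\subset T(C_j)$ for each $j$, $T|_{C_j}$ is smooth for each $j$, and $3\le|T'|\le D$ for some constant $D\ge3$. Let $\mu$ be a Gibbs measure to a H\"older continuous potential with zero pressure. Let $(M_k)_{k\ge1}$ be a monotonically decreasing sequence in $[0,1]$ such that $M_k\le C(\log k)^{-2}$ for all $k\ge2$, for some constant $C>0$. For each $k$ let $B(x,r_k(x))$ be the open ball around $x$ with $\mu(B(x,r_k(x)))=M_k$, and let $\Phi(n)=\sum_{k=1}^{n}\mu(B(x,r_k(x)))=\sum_{k=1}^nM_k$. Then for all $\varepsilon>0$, \[ \sum_{k=1}^{n}\mathbf{1}_{B(x,r_k(x))}(T^kx)=\Phi(n)+O\bigl(\Phi(n)^{1/2}(\log\Phi(n))^{3/2+\varepsilon}\bigr)\qquad(n\to\infty) \] for $\mu$-a.e. $x$.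
   Context: $B(x,r)$ is the open ball (relative to $[0,1]$) of radius $r$ around $x$, $\mathbf{1}_E$ is the indicator function of $E$, and $r_k(x)=\inf\{r\ge0:\mu(B(x,r))\ge M_k\}$. Cylinder sets are $C_{j_1,\dots,j_n}=\bigcap_{m=1}^{n}T^{-m+1}(C_{j_m})$. A Gibbs measure to a H\"older continuous potential $\phi\colon[0,1]\to\mathbb{R}$ of zero pressure is a $T$-invariant Borel probability measure $\mu$ for which there is a constant $C>0$ such that for all $n>0$, all cylinders and all $x\in C_{j_1,\dots,j_n}$, \[ C^{-1}\le\frac{\mu(C_{j_1,\dots,j_n})}{\exp(-S_n\phi(x))}\le C,\qquad S_n\phi=\phi+\phi\circ T+\dots+\phi\circ T^{n-1} \] (this is the paper's sign convention; zero pressure means that no normalising factor depending on the pressure appears). The implied constant in $O(\cdot)$ may depend on $x$ and $\varepsilon$. Convention: if $\Phi(n)$ stays bounded, the conclusion is read as saying that the difference of the two sums is bounded in $n$ for $\mu$-a.e. $x$. *)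

theory Defs
  imports "HOL-Probability.Probability" "HOL-Library.Landau_Symbols"
begin

text \<open>
  Smoothness on a set, with derivatives taken relative to the set, hence one-sided at those
  endpoints of an interval that belong to it. On a nondegenerate interval the functions
  \<open>F k\<close> are the uniquely determined \<open>k\<close>-th derivatives of \<open>f\<close>.
\<close>
definition smooth_on :: "real set \<Rightarrow> (real \<Rightarrow> real) \<Rightarrow> bool" where
  "smooth_on S f \<longleftrightarrow>
     (\<exists>F :: nat \<Rightarrow> real \<Rightarrow> real.
        (\<forall>x\<in>S. F 0 x = f x) \<and>
        (\<forall>k. \<forall>x\<in>S. (F k has_real_derivative F (Suc k) x) (at x within S)))"

text \<open>
  The unit interval is the set \<open>{0..1}\<close>; values of \<open>T\<close> outside it are irrelevant. The members
  of the partition are \<open>C j\<close> for \<open>j < N\<close>. The condition \<open>{0<..<1} \<subseteq> T ` C j\<close> forces each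
  \<open>C j\<close> to be a nondegenerate interval, so that the derivative \<open>d\<close> is unique.
\<close>
definition piecewise_expanding :: "(real \<Rightarrow> real) \<Rightarrow> nat \<Rightarrow> (nat \<Rightarrow> real set) \<Rightarrow> bool" where
  "piecewise_expanding T N C \<longleftrightarrow>
     T \<in> {0..1} \<rightarrow> {0..1} \<and>
     (\<forall>j<N. is_interval (C j)) \<and>
     disjoint_family_on C {..<N} \<and>
     (\<Union>j<N. C j) = {0..1} \<and>
     (\<forall>j<N. {0<..<1} \<subseteq> T ` C j) \<and>
     (\<forall>j<N. smooth_on (C j) T) \<and>
     (\<exists>D\<ge>3. \<forall>j<N. \<forall>x\<in>C j. \<exists>d.
        (T has_real_derivative d) (at x within C j) \<and> 3 \<le> \<bar>d\<bar> \<and> \<bar>d\<bar> \<le> D)"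

definition holder_continuous_on :: "real set \<Rightarrow> (real \<Rightarrow> real) \<Rightarrow> bool" where
  "holder_continuous_on S f \<longleftrightarrow>
     (\<exists>\<alpha> K. 0 < \<alpha> \<and> \<alpha> \<le> 1 \<and> 0 \<le> K \<and>
        (\<forall>x\<in>S. \<forall>y\<in>S. \<bar>f x - f y\<bar> \<le> K * \<bar>x - y\<bar> powr \<alpha>))"

definition cylinder :: "(real \<Rightarrow> real) \<Rightarrow> (nat \<Rightarrow> real set) \<Rightarrow> nat list \<Rightarrow> real set" where
  "cylinder T C js = {x \<in> {0..1}. \<forall>m < length js. (T ^^ m) x \<in> C (js ! m)}"

definition birkhoff_sum :: "(real \<Rightarrow> real) \<Rightarrow> (real \<Rightarrow> real) \<Rightarrow> nat \<Rightarrow> real \<Rightarrow> real" where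
  "birkhoff_sum T \<phi> n x = (\<Sum>i<n. \<phi> ((T ^^ i) x))"

definition invariant_measure :: "(real \<Rightarrow> real) \<Rightarrow> real measure \<Rightarrow> bool" where
  "invariant_measure T \<mu> \<longleftrightarrow> T \<in> measurable \<mu> \<mu> \<and> distr \<mu> \<mu> T = \<mu>"

text \<open>
  Note the sign convention \<open>exp (- S\<^sub>n \<phi>)\<close>. There is no factor involving the pressure of \<open>\<phi>\<close>, so
  that the pressure is normalised to be zero.
\<close>
definition gibbs_measure ::
  "(real \<Rightarrow> real) \<Rightarrow> nat \<Rightarrow> (nat \<Rightarrow> real set) \<Rightarrow> (real \<Rightarrow> real) \<Rightarrow> real measure \<Rightarrow> bool" where
  "gibbs_measure T N C \<phi> \<mu> \<longleftrightarrow>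
     prob_space \<mu> \<and>
     sets \<mu> = sets (restrict_space borel {0..1}) \<and>
     invariant_measure T \<mu> \<and>
     (\<exists>K>0. \<forall>js. js \<noteq> [] \<and> set js \<subseteq> {..<N} \<longrightarrow>
        (\<forall>x\<in>cylinder T C js.
           inverse K \<le> measure \<mu> (cylinder T C js) / exp (- birkhoff_sum T \<phi> (length js) x) \<and>
           measure \<mu> (cylinder T C js) / exp (- birkhoff_sum T \<phi> (length js) x) \<le> K))"

definition unit_ball :: "real \<Rightarrow> real \<Rightarrow> real set" where
  "unit_ball x r = ball x r \<inter> {0..1}"

definition radius :: "real measure \<Rightarrow> real \<Rightarrow> real \<Rightarrow> real" where
  "radius \<mu> m x = Inf {r. 0 \<le> r \<and> m \<le> measure \<mu> (unit_ball x r)}"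

end

theory Submission
  imports Defs "HOL-Library.Stream"
begin

text \<open>
  Let \<open>A k\<close> be the set of points that return at time \<open>k\<close> to their own ball of measure \<open>M k\<close>. The
  counting sum is a sum of indicators of the \<open>A k\<close>, and the proof is a second moment argument: the
  \<open>A k\<close> have measure exponentially close to \<open>M k\<close> (\<open>ret_probability\<close>), and their correlations are
  so small (\<open>double_ret_probability\<close>) that the variance of the sum over any block of times is
  bounded by a constant times the sum over that block of \<open>M k + k \<sigma> ^ k\<close> with some \<open>\<sigma> < 1\<close>
  (\<open>quasi_independent_variance\<close>). The added terms are summable, so a law of Gal and Koksma
  (\<open>Gal_Koksma\<close>) turns this into the stated error term.

  Both probability estimates use the same mechanism. On a cylinder of level \<open>n\<close> all the balls in
  question are sandwiched between two fixed intervals whose measures differ by \<open>O(\<rho> ^ n)\<close>, because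
  the radius is a 1-Lipschitz function of the centre and short intervals have Hoelder small
  measure. So a return becomes the visit of a fixed interval at time \<open>k\<close>, which is nearly
  independent of the cylinder when \<open>k - n\<close> is large. For two returns at times \<open>j < k\<close> the cylinder
  level \<open>j / 2\<close> fixes the ball for time \<open>j\<close>, and the finer level \<open>j + (k - j) / 2\<close> fixes the ball
  for time \<open>k\<close> and, up to cylinders straddling an endpoint, already decides the visit at time \<open>j\<close>.

  The near independence is psi-mixing with an exponential rate (\<open>psi_mixing\<close>). The defining
  inequalities of a Gibbs measure only determine it up to a bounded factor, so it is obtained in
  two steps for the measures \<open>p u\<close> of the cylinders coded by words \<open>u\<close>. The transfer operator of
  the potential contracts a cone of positive functions; this gives an eigenfunction and an
  invariant family \<open>q\<close> that is comparable with \<open>p\<close> and for which mixing can be read off the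
  contraction. Then \<open>p = q\<close> (\<open>p_eq_q\<close>), since an invariant density that is bounded with
  respect to a quasi-Bernoulli measure is constant.
\<close>

section \<open>The transfer operator of a Hoelder potential on the full shift\<close>

definition words :: "nat \<Rightarrow> nat \<Rightarrow> nat list set" where
  "words N n = {u. set u \<subseteq> {..<N} \<and> length u = n}"

lemma finite_words [simp, intro]: "finite (words N n)"
  unfolding words_def by (rule finite_lists_length_eq) simp

lemma words_0 [simp]: "words N 0 = {[]}"
  by (auto simp: words_def)

lemma words_append: "u \<in> words N m \<Longrightarrow> v \<in> words N n \<Longrightarrow> u @ v \<in> words N (m + n)"
  by (auto simp: words_def)

lemma sum_words_append:
  "(\<Sum>w\<in>words N (m + n). f w) = (\<Sum>u\<in>words N m. \<Sum>v\<in>words N n. f (u @ v))"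
proof -
  have "(\<Sum>w\<in>words N (m + n). f w) = (\<Sum>(u, v)\<in>words N m \<times> words N n. f (u @ v))"
    by (rule sum.reindex_bij_witness[where i = "\<lambda>(u, v). u @ v" and j = "\<lambda>w. (take m w, drop m w)"])
      (auto simp: words_def dest: in_set_takeD in_set_dropD)
  then show ?thesis by (simp add: sum.cartesian_product)
qed

lemma sum_words_1: "(\<Sum>w\<in>words N (Suc 0). f w) = (\<Sum>i<N. f [i])"
  by (rule sum.reindex_bij_witness[where i = "\<lambda>i. [i]" and j = hd])
    (auto simp: words_def length_Suc_conv)

lemma sum_words_snoc:
  "(\<Sum>w\<in>words N (Suc n). f w) = (\<Sum>u\<in>words N n. \<Sum>i<N. f (u @ [i]))"
  using sum_words_append[where m=n and n="Suc 0" and f=f and N=N] by (simp add: sum_words_1)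

lemma sum_words_Cons:
  "(\<Sum>w\<in>words N (Suc n). f w) = (\<Sum>i<N. \<Sum>u\<in>words N n. f (i # u))"
  using sum_words_append[where m="Suc 0" and n=n and f=f and N=N] by (simp add: sum_words_1)

text \<open>
  One-sided sequences are streams over all natural numbers; only the letters put in front of a
  stream by the operator below are restricted to be less than \<open>N\<close>. This avoids carrying a domain
  predicate for the arguments of functions.
\<close>

locale holder_potential =
  fixes N :: nat and \<psi> :: "nat stream \<Rightarrow> real" and a \<theta> :: real
  assumes N_pos: "0 < N"
    and \<theta>_pos: "0 < \<theta>" and \<theta>_less_1: "\<theta> < 1" and a_nonneg: "0 \<le> a"
    and holder: "stake n z = stake n z' \<Longrightarrow> \<psi> z \<le> \<psi> z' + a * \<theta> ^ n"
begin

text \<open>The exponential of minus the Birkhoff sum of the potential along \<open>u\<close>, with \<open>z\<close> as the future.\<close>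

primrec weight :: "nat list \<Rightarrow> nat stream \<Rightarrow> real" where
  "weight [] z = 1"
| "weight (i # u) z = exp (- \<psi> (i ## (u @- z))) * weight u z"

lemma weight_pos: "weight u z > 0"
  by (induction u) auto

lemma weight_append: "weight (u @ v) z = weight u (v @- z) * weight v z"
  by (induction u) auto

definition L :: "(nat stream \<Rightarrow> real) \<Rightarrow> nat stream \<Rightarrow> real" where
  "L f z = (\<Sum>i<N. exp (- \<psi> (i ## z)) * f (i ## z))"

lemma L_iterate: "(L ^^ n) f z = (\<Sum>u\<in>words N n. weight u z * f (u @- z))"
proof (induction n arbitrary: z)
  case (Suc n)
  have "(L ^^ Suc n) f z = (\<Sum>i<N. exp (- \<psi> (i ## z)) * (L ^^ n) f (i ## z))"
    by (simp add: L_def)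
  also have "\<dots> = (\<Sum>i<N. \<Sum>u\<in>words N n. weight (u @ [i]) z * f ((u @ [i]) @- z))"
    unfolding Suc.IH by (simp add: sum_distrib_left weight_append mult_ac)
  also have "\<dots> = (\<Sum>u\<in>words N (Suc n). weight u z * f (u @- z))"
    by (subst sum.swap) (simp add: sum_words_snoc)
  finally show ?case .
qed simp

lemma L_mono: "(\<And>z. f z \<le> g z) \<Longrightarrow> L f z \<le> L g z"
  unfolding L_def by (intro sum_mono mult_left_mono) auto

lemma L_lincomb: "L (\<lambda>z. c * f z + d * g z) = (\<lambda>z. c * L f z + d * L g z)"
  by (simp add: L_def fun_eq_iff sum.distrib sum_distrib_left algebra_simps)

lemma L_scale: "L (\<lambda>z. c * f z) = (\<lambda>z. c * L f z)"
  using L_lincomb[of c f 0 f] by simp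

lemma L_iterate_mono: "(\<And>z. f z \<le> g z) \<Longrightarrow> (L ^^ n) f z \<le> (L ^^ n) g z"
  unfolding L_iterate by (intro sum_mono mult_left_mono) (auto intro: less_imp_le weight_pos)

lemma L_iterate_scale: "(L ^^ n) (\<lambda>z. c * f z) z = c * (L ^^ n) f z"
  unfolding L_iterate by (simp add: sum_distrib_left mult_ac)

lemma L_iterate_sum:
  "(L ^^ n) (\<lambda>z. \<Sum>i\<in>I. f i z) z = (\<Sum>i\<in>I. (L ^^ n) (f i) z)"
  unfolding L_iterate by (simp add: sum_distrib_left sum.swap[of _ I])

text \<open>
  Positive functions whose logarithm is Hoelder with constant \<open>A\<close> at every scale. Scale zero is
  included, so that any two values of such a function have a ratio of at most \<open>exp A\<close>.
\<close>

definition cone :: "real \<Rightarrow> (nat stream \<Rightarrow> real) set" where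
  "cone A = {f. (\<forall>z. f z > 0) \<and>
     (\<forall>n z z'. stake n z = stake n z' \<longrightarrow> f z \<le> exp (A * \<theta> ^ n) * f z')}"

lemma cone_pos: "f \<in> cone A \<Longrightarrow> f z > 0"
  by (simp add: cone_def)

lemma coneD: "f \<in> cone A \<Longrightarrow> stake n z = stake n z' \<Longrightarrow> f z \<le> exp (A * \<theta> ^ n) * f z'"
  by (simp add: cone_def)

lemma cone_Harnack: "f \<in> cone A \<Longrightarrow> f z \<le> exp A * f z'"
  using coneD[of f A 0 z z'] by simp

lemma cone_mono: "A \<le> B \<Longrightarrow> cone A \<subseteq> cone B"
proof
  fix f assume AB: "A \<le> B" and f: "f \<in> cone A"
  have "f z \<le> exp (B * \<theta> ^ n) * f z'" if "stake n z = stake n z'" for n z z'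
  proof -
    have "f z \<le> exp (A * \<theta> ^ n) * f z'" by (rule coneD[OF f that])
    also have "\<dots> \<le> exp (B * \<theta> ^ n) * f z'"
      using AB \<theta>_pos cone_pos[OF f] by (intro mult_right_mono) (auto intro: less_imp_le)
    finally show ?thesis .
  qed
  with f show "f \<in> cone B" by (simp add: cone_def)
qed

lemma cone_branch:
  assumes f: "f \<in> cone A"
  shows "(\<lambda>z. exp (- \<psi> (i ## z)) * f (i ## z)) \<in> cone (\<theta> * (A + a))"
  unfolding cone_def
proof (safe, goal_cases)
  case 1 show ?case using cone_pos[OF f] by simp
next
  case (2 n z z')
  have eq: "stake (Suc n) (i ## z) = stake (Suc n) (i ## z')" using 2 by simp
  have "exp (- \<psi> (i ## z)) \<le> exp (a * \<theta> ^ Suc n) * exp (- \<psi> (i ## z'))"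
    using holder[OF eq[symmetric]] by (simp add: exp_add[symmetric])
  then have "exp (- \<psi> (i ## z)) * f (i ## z) \<le>
      (exp (a * \<theta> ^ Suc n) * exp (- \<psi> (i ## z'))) * (exp (A * \<theta> ^ Suc n) * f (i ## z'))"
    using coneD[OF f eq] cone_pos[OF f] by (intro mult_mono) (auto intro: less_imp_le)
  also have "\<dots> = exp (\<theta> * (A + a) * \<theta> ^ n) * (exp (- \<psi> (i ## z')) * f (i ## z'))"
    by (simp add: exp_add[symmetric] algebra_simps)
  finally show ?case .
qed

lemma cone_sum:
  assumes "finite I" "I \<noteq> {}" "\<And>i. i \<in> I \<Longrightarrow> f i \<in> cone A"
  shows "(\<lambda>z. \<Sum>i\<in>I. f i z) \<in> cone A"
  unfolding cone_def
proof (safe, goal_cases)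
  case 1 show ?case using assms cone_pos by (intro sum_pos) auto
next
  case 2 then show ?case unfolding sum_distrib_left using assms by (intro sum_mono coneD) auto
qed

text \<open>
  The constant is chosen such that the transfer operator improves it by the fixed amount
  \<open>1 - \<theta>\<close>: \<open>\<theta> * (A + a) = A - (1 - \<theta>)\<close>. The loss \<open>a\<close> comes from the potential and the
  factor \<open>\<theta>\<close> from the letter that is put in front.
\<close>

definition A where "A = a * \<theta> / (1 - \<theta>) + 1"
definition A' where "A' = A - (1 - \<theta>)"

lemma A_contract: "\<theta> * (A + a) = A'"
  using \<theta>_less_1 unfolding A'_def A_def by (simp add: field_simps)

lemma A'_less: "A' < A" and A'_nonneg: "0 \<le> A'" and A_pos: "0 < A"
proof -
  have "0 \<le> a * \<theta> / (1 - \<theta>)" using \<theta>_less_1 \<theta>_pos a_nonneg by simp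
  then show "A' < A" "0 \<le> A'" "0 < A" using \<theta>_less_1 \<theta>_pos unfolding A'_def A_def by auto
qed

lemma branch_cone_A': "f \<in> cone A \<Longrightarrow> (\<lambda>z. exp (- \<psi> (i ## z)) * f (i ## z)) \<in> cone A'"
  using cone_branch[of f A] by (simp add: A_contract)

lemma L_cone_A': "f \<in> cone A \<Longrightarrow> L f \<in> cone A'"
  unfolding L_def[abs_def] using N_pos branch_cone_A' by (intro cone_sum) (auto simp: lessThan_empty_iff)

lemma cone_A'_A: "f \<in> cone A' \<Longrightarrow> f \<in> cone A"
  using cone_mono[of A' A] A'_less by auto

lemma L_iterate_cone: "f \<in> cone A \<Longrightarrow> (L ^^ n) f \<in> cone A"
  by (induction n) (auto intro: L_cone_A' cone_A'_A)

lemma one_in_cone: "(\<lambda>_. 1) \<in> cone A"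
  using A_pos \<theta>_pos by (simp add: cone_def)

text \<open>
  The fraction of a lower multiple that can be subtracted from a function of the smaller cone
  without leaving the larger cone; \<open>t_bound\<close> is the one-variable inequality that governs it.
\<close>

definition t where "t = (A - A') / ((A + A') * exp A)"

lemma t_pos: "0 < t" and t_less_1: "t < 1"
proof -
  show "0 < t" unfolding t_def using A'_less A_pos A'_nonneg by (intro divide_pos_pos mult_pos_pos) auto
  have "A - A' \<le> A + A'" using A'_nonneg by simp
  also have "\<dots> < (A + A') * exp A" using A_pos A'_nonneg by simp
  finally show "t < 1" unfolding t_def using A_pos A'_nonneg by (simp add: divide_less_eq)
qed

lemma t_bound:
  assumes x: "0 \<le> x" "x \<le> 1"
  shows "t * (exp (A * x) - exp (- A' * x)) \<le> exp (A * x) - exp (A' * x)"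
proof -
  have "1 - exp (- (A + A') * x) \<le> (A + A') * x"
    using exp_ge_add_one_self[of "- (A + A') * x"] by linarith
  then have "exp (A * x) * (1 - exp (- (A + A') * x)) \<le> exp A * ((A + A') * x)"
    using x A_pos A'_nonneg mult_left_mono[of x 1 A] mult_nonneg_nonneg[of "A + A'" x]
    by (intro mult_mono) (auto simp del: minus_add_distrib)
  moreover have "exp (A * x) * (1 - exp (- (A + A') * x)) = exp (A * x) - exp (- A' * x)"
    by (simp add: algebra_simps exp_add[symmetric])
  ultimately have 1: "exp (A * x) - exp (- A' * x) \<le> (A + A') * exp A * x" by (simp add: mult_ac)
  have "t * (exp (A * x) - exp (- A' * x)) \<le> t * ((A + A') * exp A * x)"
    using 1 t_pos by (intro mult_left_mono) auto
  also have "\<dots> = (A - A') * x" unfolding t_def using A_pos A'_nonneg by simp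
  also have "\<dots> \<le> exp ((A - A') * x) - 1" using exp_ge_add_one_self[of "(A - A') * x"] by linarith
  also have "\<dots> \<le> exp (A' * x) * (exp ((A - A') * x) - 1)"
    using mult_right_mono[of 1 "exp (A' * x)" "exp ((A - A') * x) - 1"] x A'_nonneg A'_less by simp
  also have "\<dots> = exp (A * x) - exp (A' * x)"
    by (simp add: algebra_simps exp_add[symmetric])
  finally show ?thesis .
qed

text \<open>
  Functions in the image of the operator satisfy the cone inequalities with room to spare, and
  this room absorbs a small multiple of another such function.
\<close>

lemma cone_subtract:
  assumes f: "f \<in> cone A'" and e: "e \<in> cone A'" and s: "0 \<le> s" "\<And>z. s * e z \<le> f z"
  shows "(\<lambda>z. f z - t * s * e z) \<in> cone A"
  unfolding cone_def
proof (safe, goal_cases)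
  case (1 z)
  have "t * (s * e z) \<le> t * f z" using s t_pos by (intro mult_left_mono) auto
  also have "\<dots> < f z" using t_less_1 cone_pos[OF f] by simp
  finally show ?case by (simp add: mult_ac)
next
  case (2 n z z')
  let ?x = "\<theta> ^ n"
  have x: "0 \<le> ?x" "?x \<le> 1" using \<theta>_pos \<theta>_less_1 by (auto simp: power_le_one)
  have "e z' \<le> exp (A' * ?x) * e z" by (rule coneD[OF e 2[symmetric]])
  then have "exp (- A' * ?x) * e z' \<le> e z"
    by (simp add: exp_minus field_simps)
  then have "t * s * (exp (A * ?x) * e z' - e z) \<le> t * s * ((exp (A * ?x) - exp (- A' * ?x)) * e z')"
    using t_pos s by (intro mult_left_mono) (auto simp: algebra_simps)
  also have "\<dots> = (t * (exp (A * ?x) - exp (- A' * ?x))) * (s * e z')" by simp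
  also have "\<dots> \<le> (exp (A * ?x) - exp (A' * ?x)) * f z'"
    using t_bound[OF x] s cone_pos[OF e] A'_less x
    by (intro mult_mono) (auto intro!: mult_right_mono mult_nonneg_nonneg intro: less_imp_le)
  also have "\<dots> \<le> exp (A * ?x) * f z' - f z"
    using coneD[OF f 2] by (simp add: algebra_simps)
  finally show ?case by (simp add: algebra_simps)
qed

text \<open>
  Subtracting \<open>t\<close> times the largest obvious multiple of the reference function costs at least
  the fraction \<open>t * exp (- 4 * A)\<close> of the function, by two Harnack inequalities in each direction.
\<close>

definition \<kappa> where "\<kappa> = 1 - t * exp (- 4 * A)"

lemma \<kappa>_pos: "0 < \<kappa>" and \<kappa>_less_1: "\<kappa> < 1"
proof -
  have "t * exp (- 4 * A) < 1 * 1" using t_pos t_less_1 A_pos by (intro mult_strict_mono) auto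
  then show "0 < \<kappa>" by (simp add: \<kappa>_def)
  show "\<kappa> < 1" using t_pos by (simp add: \<kappa>_def)
qed

lemma contraction_step:
  assumes f: "f \<in> cone A" and e: "e \<in> cone A" and b: "\<And>z. f z \<le> b * e z"
  shows "\<exists>c\<ge>0. (\<lambda>z. L f z - c * L e z) \<in> cone A \<and>
     (\<forall>z. L f z - c * L e z \<le> \<kappa> * b * L e z)"
proof -
  have F: "L f \<in> cone A'" and E: "L e \<in> cone A'" using f e by (auto intro: L_cone_A')
  note FA = cone_A'_A[OF F] and EA = cone_A'_A[OF E]
  note pos = cone_pos[OF F] cone_pos[OF E]
  let ?o = "sconst 0 :: nat stream"
  \<comment> \<open>A lower bound for the ratio of \<open>L f\<close> and \<open>L e\<close> everywhere, from its value at one point.\<close>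
  define s where "s = exp (- 2 * A) * (L f ?o / L e ?o)"
  have s0: "s \<ge> 0" using pos by (auto simp: s_def intro: less_imp_le)
  have s1: "s * L e z \<le> L f z" for z
  proof -
    have "L f ?o * L e z \<le> (exp A * L f z) * (exp A * L e ?o)"
      using pos by (intro mult_mono cone_Harnack FA EA) (auto intro: less_imp_le)
    also have "\<dots> = exp (2 * A) * L f z * L e ?o" by (simp add: exp_add[symmetric])
    finally show ?thesis using pos by (simp add: s_def exp_minus field_simps)
  qed
  have s2: "exp (- 4 * A) * L f z \<le> s * L e z" for z
  proof -
    have "L f z * L e ?o \<le> (exp A * L f ?o) * (exp A * L e z)"
      using pos by (intro mult_mono cone_Harnack FA EA) (auto intro: less_imp_le)
    also have "\<dots> = exp (2 * A) * L f ?o * L e z" by (simp add: exp_add[symmetric])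
    finally have "exp (- 4 * A) * (L f z * L e ?o) \<le> exp (- 4 * A) * (exp (2 * A) * L f ?o * L e z)"
      by (intro mult_left_mono) auto
    also have "\<dots> = exp (- 2 * A) * L f ?o * L e z" by (simp add: exp_add[symmetric] flip: mult.assoc)
    finally show ?thesis using pos by (simp add: s_def field_simps)
  qed
  have "L f z - t * s * L e z \<le> \<kappa> * b * L e z" for z
  proof -
    have "L f z - t * s * L e z \<le> \<kappa> * L f z"
      using mult_left_mono[OF s2[of z], of t] t_pos by (simp add: \<kappa>_def algebra_simps)
    also have "\<dots> \<le> \<kappa> * (b * L e z)"
      using L_mono[of f "\<lambda>z. b * e z" z] b \<kappa>_pos by (intro mult_left_mono) (auto simp: L_scale)
    finally show ?thesis by simp
  qed
  then show ?thesis
    using cone_subtract[OF F E s0 s1] s0 t_pos by (intro exI[of _ "t * s"]) auto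
qed

lemma contraction_iterate:
  assumes f: "f \<in> cone A" and e: "e \<in> cone A" and b: "\<And>z. f z \<le> b * e z"
  shows "\<exists>c\<ge>0. (\<lambda>z. (L ^^ n) f z - c * (L ^^ n) e z) \<in> cone A \<and>
     (\<forall>z. (L ^^ n) f z - c * (L ^^ n) e z \<le> \<kappa> ^ n * b * (L ^^ n) e z)"
proof (induction n)
  case 0 show ?case using f b by (intro exI[of _ 0]) auto
next
  case (Suc n)
  then obtain c where c: "c \<ge> 0" "(\<lambda>z. (L ^^ n) f z - c * (L ^^ n) e z) \<in> cone A"
     "\<And>z. (L ^^ n) f z - c * (L ^^ n) e z \<le> (\<kappa> ^ n * b) * (L ^^ n) e z" by auto
  have lin: "L (\<lambda>z. (L ^^ n) f z - c * (L ^^ n) e z) = (\<lambda>z. (L ^^ Suc n) f z - c * (L ^^ Suc n) e z)"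
    using L_lincomb[of 1 "(L ^^ n) f" "- c" "(L ^^ n) e"] by simp
  from contraction_step[OF c(2) L_iterate_cone[OF e] c(3)]
  obtain d where d: "d \<ge> 0" "(\<lambda>z. (L ^^ Suc n) f z - c * (L ^^ Suc n) e z - d * (L ^^ Suc n) e z) \<in> cone A"
     "\<And>z. (L ^^ Suc n) f z - c * (L ^^ Suc n) e z - d * (L ^^ Suc n) e z \<le> \<kappa> * (\<kappa> ^ n * b) * (L ^^ Suc n) e z"
    unfolding lin by auto
  have "(\<lambda>z. (L ^^ Suc n) f z - (c + d) * (L ^^ Suc n) e z) =
      (\<lambda>z. (L ^^ Suc n) f z - c * (L ^^ Suc n) e z - d * (L ^^ Suc n) e z)"
    by (simp add: algebra_simps)
  then show ?case using c(1) d by (intro exI[of _ "c + d"]) (auto simp: algebra_simps)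
qed

text \<open>
  Iterating the subtraction writes \<open>(L ^^ n) f\<close> as a multiple of \<open>(L ^^ n) e\<close> plus a positive
  remainder of relative size \<open>\<kappa> ^ n\<close>. The multiples form a Cauchy sequence, since the enclosure of
  the ratio at time \<open>n\<close> persists at all later times.
\<close>

lemma exponential_contraction:
  assumes f: "f \<in> cone A" and e: "e \<in> cone A" and b: "\<And>z. f z \<le> b * e z"
  obtains c where "\<And>n z. \<bar>(L ^^ n) f z - c * (L ^^ n) e z\<bar> \<le> \<kappa> ^ n * b * (L ^^ n) e z"
proof -
  have "\<exists>c. (\<forall>z. c * (L ^^ n) e z \<le> (L ^^ n) f z) \<and>
     (\<forall>z. (L ^^ n) f z \<le> (c + \<kappa> ^ n * b) * (L ^^ n) e z)" for n
  proof -
    obtain c where c: "(\<lambda>z. (L ^^ n) f z - c * (L ^^ n) e z) \<in> cone A"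
      "\<And>z. (L ^^ n) f z - c * (L ^^ n) e z \<le> \<kappa> ^ n * b * (L ^^ n) e z"
      using contraction_iterate[OF f e b, of n] by blast
    have "c * (L ^^ n) e z \<le> (L ^^ n) f z" for z using cone_pos[OF c(1), of z] by simp
    moreover have "(L ^^ n) f z \<le> (c + \<kappa> ^ n * b) * (L ^^ n) e z" for z
      using c(2)[of z] by (simp add: distrib_right)
    ultimately show ?thesis by blast
  qed
  then obtain c where c1: "\<And>n z. c n * (L ^^ n) e z \<le> (L ^^ n) f z"
    and c2: "\<And>n z. (L ^^ n) f z \<le> (c n + \<kappa> ^ n * b) * (L ^^ n) e z" by metis
  have epos: "(L ^^ n) e z > 0" for n z by (rule cone_pos[OF L_iterate_cone[OF e]])
  have le1: "c n * (L ^^ (m + n)) e z \<le> (L ^^ (m + n)) f z" for n m z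
    using L_iterate_mono[of "\<lambda>z. c n * (L ^^ n) e z" "(L ^^ n) f" m z] c1[of n]
    by (simp add: L_iterate_scale funpow_add o_def)
  have le2: "(L ^^ (m + n)) f z \<le> (c n + \<kappa> ^ n * b) * (L ^^ (m + n)) e z" for n m z
    using L_iterate_mono[of "(L ^^ n) f" "\<lambda>z. (c n + \<kappa> ^ n * b) * (L ^^ n) e z" m z] c2[of n]
    by (simp add: L_iterate_scale funpow_add o_def)
  have up: "c n \<le> c (m + n) + \<kappa> ^ (m + n) * b" for n m
  proof -
    have "c n * (L ^^ (m + n)) e (sconst 0) \<le> (c (m + n) + \<kappa> ^ (m + n) * b) * (L ^^ (m + n)) e (sconst 0)"
      using le1[of n m] c2[of "m + n"] order_trans by blast
    then show ?thesis by (rule mult_right_le_imp_le) (rule epos)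
  qed
  have dn: "c (m + n) \<le> c n + \<kappa> ^ n * b" for n m
  proof -
    have "c (m + n) * (L ^^ (m + n)) e (sconst 0) \<le> (c n + \<kappa> ^ n * b) * (L ^^ (m + n)) e (sconst 0)"
      using le2[of m n] c1[of "m + n"] order_trans by blast
    then show ?thesis by (rule mult_right_le_imp_le) (rule epos)
  qed
  have k0: "(\<lambda>n. \<kappa> ^ n * b) \<longlonglongrightarrow> 0"
    using \<kappa>_pos \<kappa>_less_1 by (intro tendsto_mult_left_zero LIMSEQ_power_zero) auto
  have "Cauchy c"
  proof (rule metric_CauchyI)
    fix \<epsilon> :: real assume "\<epsilon> > 0"
    then obtain n0 where n0: "\<And>n. n \<ge> n0 \<Longrightarrow> \<bar>\<kappa> ^ n * b\<bar> < \<epsilon> / 2"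
      using LIMSEQ_D[OF k0, of "\<epsilon> / 2"] by auto
    have "\<bar>c n - c n0\<bar> < \<epsilon> / 2" if "n \<ge> n0" for n
    proof -
      have "c n0 \<le> c n + \<kappa> ^ n * b" "c n \<le> c n0 + \<kappa> ^ n0 * b"
        using up[of n0 "n - n0"] dn[of "n - n0" n0] that by auto
      then show ?thesis
        using n0[OF that] n0[OF order_refl] unfolding abs_less_iff by linarith
    qed
    then have "dist (c m) (c n) < \<epsilon>" if "m \<ge> n0" "n \<ge> n0" for m n
      using that by (simp add: dist_real_def) (smt (verit, best) field_sum_of_halves)
    then show "\<exists>M. \<forall>m\<ge>M. \<forall>n\<ge>M. dist (c m) (c n) < \<epsilon>" by blast
  qed
  then obtain l where l: "c \<longlonglongrightarrow> l" using Cauchy_convergent convergent_def by blast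
  have l1: "c n \<le> l" for n
  proof (rule LIMSEQ_le_const)
    show "(\<lambda>m. c (m + n) + \<kappa> ^ (m + n) * b) \<longlonglongrightarrow> l"
      using tendsto_add[OF LIMSEQ_ignore_initial_segment[OF l, of n] LIMSEQ_ignore_initial_segment[OF k0, of n]] by simp
    show "\<exists>N. \<forall>m\<ge>N. c n \<le> c (m + n) + \<kappa> ^ (m + n) * b" using up by blast
  qed
  have l2: "l \<le> c n + \<kappa> ^ n * b" for n
    using dn by (intro LIMSEQ_le_const2[OF LIMSEQ_ignore_initial_segment[OF l, of n]]) auto
  have "\<bar>(L ^^ n) f z - l * (L ^^ n) e z\<bar> \<le> \<kappa> ^ n * b * (L ^^ n) e z" for n z
  proof -
    have "l * (L ^^ n) e z \<le> (c n + \<kappa> ^ n * b) * (L ^^ n) e z"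
      using l2[of n] epos[of n z] by (intro mult_right_mono) auto
    moreover have "c n * (L ^^ n) e z \<le> l * (L ^^ n) e z"
      using l1[of n] epos[of n z] by (intro mult_right_mono) auto
    ultimately show ?thesis
      using c1[of n z] c2[of n z] unfolding abs_le_iff by (simp only: distrib_right) linarith
  qed
  then show ?thesis using that by blast
qed

end

section \<open>The eigenfunction and the invariant state of a Gibbs family\<close>

text \<open>
  A shift-invariant probability on sequences, given by the measures of its cylinders: \<open>p_snoc\<close> is
  additivity, \<open>p_Cons\<close> is invariance, and the last two assumptions are the Gibbs property with
  zero pressure.
\<close>

locale gibbs_shift = holder_potential +
  fixes p :: "nat list \<Rightarrow> real" and K :: real
  assumes p_Nil: "p [] = 1"
    and p_snoc: "set u \<subseteq> {..<N} \<Longrightarrow> (\<Sum>i<N. p (u @ [i])) = p u"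
    and p_Cons: "set u \<subseteq> {..<N} \<Longrightarrow> (\<Sum>i<N. p (i # u)) = p u"
    and p_lower: "set u \<subseteq> {..<N} \<Longrightarrow> weight u z \<le> K * p u"
    and p_upper: "set u \<subseteq> {..<N} \<Longrightarrow> p u \<le> K * weight u z"
begin

lemma K_ge_1: "1 \<le> K"
  using p_upper[of "[]"] by (simp add: p_Nil)

lemma p_pos: "set u \<subseteq> {..<N} \<Longrightarrow> 0 < p u"
  using less_le_trans[OF weight_pos[of u "sconst 0"] p_lower[of u "sconst 0"]] K_ge_1 by (simp add: zero_less_mult_iff)

lemma p_append_right: "set u \<subseteq> {..<N} \<Longrightarrow> (\<Sum>v\<in>words N n. p (u @ v)) = p u"
proof (induction n)
  case (Suc n)
  have "(\<Sum>v\<in>words N (Suc n). p (u @ v)) = (\<Sum>v\<in>words N n. \<Sum>i<N. p ((u @ v) @ [i]))"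
    by (simp add: sum_words_snoc)
  also have "\<dots> = (\<Sum>v\<in>words N n. p (u @ v))"
    using Suc.prems by (intro sum.cong p_snoc) (auto simp: words_def)
  finally show ?case using Suc by simp
qed simp

lemma p_append_left: "set u \<subseteq> {..<N} \<Longrightarrow> (\<Sum>v\<in>words N n. p (v @ u)) = p u"
proof (induction n)
  case (Suc n)
  have "(\<Sum>v\<in>words N (Suc n). p (v @ u)) = (\<Sum>v\<in>words N n. \<Sum>i<N. p (i # (v @ u)))"
    by (subst sum.swap) (simp add: sum_words_Cons)
  also have "\<dots> = (\<Sum>v\<in>words N n. p (v @ u))"
    using Suc.prems by (intro sum.cong p_Cons) (auto simp: words_def)
  finally show ?case using Suc by simp
qed simp

lemma sum_p: "(\<Sum>v\<in>words N n. p v) = 1"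
  using p_append_right[of "[]" n] by (simp add: p_Nil)

lemma quasi_Bernoulli_lower:
  assumes "set u \<subseteq> {..<N}" "set v \<subseteq> {..<N}"
  shows "p u * p v \<le> K ^ 3 * p (u @ v)"
proof -
  let ?o = "sconst 0 :: nat stream"
  have "p u * p v \<le> (K * weight u (v @- ?o)) * (K * weight v ?o)"
    using assms p_pos K_ge_1 by (intro mult_mono p_upper mult_nonneg_nonneg) (auto intro: less_imp_le weight_pos)
  also have "\<dots> = K ^ 2 * weight (u @ v) ?o" by (simp add: weight_append power2_eq_square)
  also have "\<dots> \<le> K ^ 2 * (K * p (u @ v))" using assms by (intro mult_left_mono p_lower) auto
  finally show ?thesis by (simp add: power3_eq_cube power2_eq_square)
qed

text \<open>
  The total weight of all words of length \<open>n\<close> is comparable with the total mass of \<open>p\<close>: this is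
  where zero pressure enters.
\<close>

lemma L_iterate_one_bounds: "1 \<le> K * (L ^^ n) (\<lambda>_. 1) z" "(L ^^ n) (\<lambda>_. 1) z \<le> K"
proof -
  have "1 = (\<Sum>u\<in>words N n. p u)" by (simp add: sum_p)
  also have "\<dots> \<le> (\<Sum>u\<in>words N n. K * weight u z)" by (intro sum_mono p_upper) (auto simp: words_def)
  also have "\<dots> = K * (L ^^ n) (\<lambda>_. 1) z" by (simp add: L_iterate sum_distrib_left)
  finally show "1 \<le> K * (L ^^ n) (\<lambda>_. 1) z" .
  have "(L ^^ n) (\<lambda>_. 1) z \<le> (\<Sum>u\<in>words N n. K * p u)"
    unfolding L_iterate mult_1_right by (intro sum_mono p_lower) (auto simp: words_def)
  also have "\<dots> = K" by (simp add: sum_distrib_left[symmetric] sum_p)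
  finally show "(L ^^ n) (\<lambda>_. 1) z \<le> K" .
qed

definition h where "h z = lim (\<lambda>n. (L ^^ n) (\<lambda>_. 1) z)"

text \<open>
  The contraction, applied to \<open>L 1\<close> and \<open>1\<close>, gives some eigenvalue \<open>c\<close> with an exponentially
  small error. It must be one because the iterates of \<open>1\<close> neither grow nor decay.
\<close>

lemma leading_eigenvalue_one:
  obtains b where "\<And>n z. \<bar>(L ^^ Suc n) (\<lambda>_. 1) z - (L ^^ n) (\<lambda>_. 1) z\<bar> \<le> b * \<kappa> ^ n"
proof -
  let ?E = "\<lambda>n. (L ^^ n) (\<lambda>_. 1)"
  have LE: "L (\<lambda>_. 1) \<in> cone A" using L_iterate_cone[OF one_in_cone, of 1] by simp
  have bd: "L (\<lambda>_. 1) z \<le> K * 1" for z using L_iterate_one_bounds(2)[of 1 z] by simp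
  obtain c where c: "\<And>n z. \<bar>(L ^^ n) (L (\<lambda>_. 1)) z - c * ?E n z\<bar> \<le> \<kappa> ^ n * K * ?E n z"
    using exponential_contraction[OF LE one_in_cone bd] by blast
  have diff: "\<bar>?E (Suc n) z - c * ?E n z\<bar> \<le> K\<^sup>2 * \<kappa> ^ n" for n z
  proof -
    have "\<bar>?E (Suc n) z - c * ?E n z\<bar> \<le> \<kappa> ^ n * K * ?E n z"
      using c[of n z] by (simp add: funpow_swap1)
    also have "\<dots> \<le> \<kappa> ^ n * K * K" using L_iterate_one_bounds(2) \<kappa>_pos K_ge_1 by (intro mult_left_mono) auto
    finally show ?thesis by (simp add: power2_eq_square mult_ac)
  qed
  let ?o = "sconst 0 :: nat stream"
  have geo: "(\<Sum>k<n. \<kappa> ^ k) \<le> 1 / (1 - \<kappa>)" for n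
    using \<kappa>_pos \<kappa>_less_1 by (simp add: sum_gp_strict divide_right_mono)
  \<comment> \<open>The iterates stay between two positive constants, so summing the recursion leaves no room
     for an eigenvalue other than one.\<close>
  have "\<bar>1 - c\<bar> * (real n / K) \<le> 2 * K + K\<^sup>2 / (1 - \<kappa>)" for n
  proof -
    have "(\<Sum>k<n. ?E (Suc k) ?o - c * ?E k ?o) = (\<Sum>k<n. ?E (Suc k) ?o - ?E k ?o) + (1 - c) * (\<Sum>k<n. ?E k ?o)"
      by (simp add: sum_distrib_left sum.distrib[symmetric] algebra_simps)
    also have "(\<Sum>k<n. ?E (Suc k) ?o - ?E k ?o) = ?E n ?o - 1"
      using sum_lessThan_telescope[of "\<lambda>k. ?E k ?o" n] by (simp del: funpow.simps(2))
    finally have eq: "(1 - c) * (\<Sum>k<n. ?E k ?o) = (\<Sum>k<n. ?E (Suc k) ?o - c * ?E k ?o) - (?E n ?o - 1)"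
      by linarith
    have "\<bar>\<Sum>k<n. ?E (Suc k) ?o - c * ?E k ?o\<bar> \<le> (\<Sum>k<n. K\<^sup>2 * \<kappa> ^ k)"
      by (rule order_trans[OF sum_abs]) (intro sum_mono diff)
    also have "\<dots> \<le> K\<^sup>2 / (1 - \<kappa>)"
      using mult_left_mono[OF geo[of n], of "K\<^sup>2"] by (simp add: sum_distrib_left)
    finally have 1: "\<bar>\<Sum>k<n. ?E (Suc k) ?o - c * ?E k ?o\<bar> \<le> K\<^sup>2 / (1 - \<kappa>)" .
    have E0: "0 < ?E k ?o" for k by (rule cone_pos[OF L_iterate_cone[OF one_in_cone]])
    have "real n / K = (\<Sum>k<n. 1 / K)" by simp
    also have "\<dots> \<le> (\<Sum>k<n. ?E k ?o)"
      using L_iterate_one_bounds(1) K_ge_1 by (intro sum_mono) (simp add: divide_le_eq mult.commute)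
    finally have "\<bar>1 - c\<bar> * (real n / K) \<le> \<bar>1 - c\<bar> * (\<Sum>k<n. ?E k ?o)" by (intro mult_left_mono) auto
    also have "\<dots> = \<bar>(1 - c) * (\<Sum>k<n. ?E k ?o)\<bar>"
      using E0 by (simp add: abs_mult sum_nonneg less_imp_le)
    also have "\<dots> \<le> K\<^sup>2 / (1 - \<kappa>) + \<bar>?E n ?o - 1\<bar>" unfolding eq using 1 by linarith
    also have "\<bar>?E n ?o - 1\<bar> \<le> 2 * K" using L_iterate_one_bounds(2)[of n ?o] E0[of n] K_ge_1 by linarith
    finally show ?thesis by linarith
  qed
  then have ub: "real n * (\<bar>1 - c\<bar> / K) \<le> 2 * K + K\<^sup>2 / (1 - \<kappa>)" for n by (simp add: mult_ac)
  have "c = 1"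
  proof (rule ccontr)
    assume "c \<noteq> 1"
    then have "0 < \<bar>1 - c\<bar> / K" using K_ge_1 by simp
    from reals_Archimedean3[OF this, rule_format, of "2 * K + K\<^sup>2 / (1 - \<kappa>)"] ub show False
      by (meson not_less)
  qed
  then have "\<bar>?E (Suc n) z - ?E n z\<bar> \<le> K\<^sup>2 * \<kappa> ^ n" for n z using diff[of n z] by simp
  then show ?thesis using that by blast
qed

lemma h_LIMSEQ: "(\<lambda>n. (L ^^ n) (\<lambda>_. 1) z) \<longlonglongrightarrow> h z"
proof -
  obtain b where b: "\<And>n. \<bar>(L ^^ Suc n) (\<lambda>_. 1) z - (L ^^ n) (\<lambda>_. 1) z\<bar> \<le> b * \<kappa> ^ n"
    using leading_eigenvalue_one by metis
  have "summable (\<lambda>n. b * \<kappa> ^ n)" using \<kappa>_pos \<kappa>_less_1 by (intro summable_mult summable_geometric) auto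
  then have "summable (\<lambda>n. (L ^^ Suc n) (\<lambda>_. 1) z - (L ^^ n) (\<lambda>_. 1) z)"
    by (rule summable_comparison_test[rotated]) (use b in auto)
  then have "convergent (\<lambda>n. \<Sum>k<n. (L ^^ Suc k) (\<lambda>_. 1) z - (L ^^ k) (\<lambda>_. 1) z)"
    by (simp add: summable_iff_convergent)
  then have "convergent (\<lambda>n. (L ^^ n) (\<lambda>_. 1) z - 1)"
    by (simp add: sum_lessThan_telescope[of "\<lambda>k. (L ^^ k) (\<lambda>_. 1) z"] del: funpow.simps(2))
  then have "convergent (\<lambda>n. (L ^^ n) (\<lambda>_. 1) z)"
    using convergent_add_const_right_iff[of "\<lambda>n. (L ^^ n) (\<lambda>_. 1) z" "-1"] by simp
  then show ?thesis unfolding h_def by (simp add: convergent_LIMSEQ_iff)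
qed

lemma h_bounds: "1 / K \<le> h z" "h z \<le> K"
proof -
  show "1 / K \<le> h z"
    using L_iterate_one_bounds(1) K_ge_1
    by (intro LIMSEQ_le_const[OF h_LIMSEQ]) (auto simp: divide_le_eq mult.commute)
  show "h z \<le> K" using L_iterate_one_bounds(2) by (intro LIMSEQ_le_const2[OF h_LIMSEQ]) auto
qed

lemma L_h: "L h = h"
proof
  fix z
  have "(\<lambda>n. L ((L ^^ n) (\<lambda>_. 1)) z) \<longlonglongrightarrow> L h z"
    unfolding L_def[of h] L_def[of "(L ^^ _) _"] by (intro tendsto_intros h_LIMSEQ)
  moreover have "(\<lambda>n. L ((L ^^ n) (\<lambda>_. 1)) z) \<longlonglongrightarrow> h z"
    using LIMSEQ_Suc[OF h_LIMSEQ[of z]] by simp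
  ultimately show "L h z = h z" by (rule LIMSEQ_unique)
qed

lemma h_cone: "h \<in> cone A"
  unfolding cone_def
proof (safe, goal_cases)
  case (1 z) show ?case using h_bounds(1)[of z] K_ge_1 by (intro less_le_trans[OF _ h_bounds(1)]) simp
next
  case (2 n z z')
  show ?case
    by (rule LIMSEQ_le[OF h_LIMSEQ tendsto_mult_left[OF h_LIMSEQ]])
      (use coneD[OF L_iterate_cone[OF one_in_cone] 2] in auto)
qed

lemma h_pos: "0 < h z" by (rule cone_pos[OF h_cone])

lemma L_iterate_h: "(L ^^ n) h = h"
  by (induction n) (simp_all add: L_h)

definition state :: "(nat stream \<Rightarrow> real) \<Rightarrow> real" where
  "state f = lim (\<lambda>n. (L ^^ n) f (sconst 0) / h (sconst 0))"

text \<open>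
  The limit functional \<open>state\<close> is integration against the conformal measure, with value one at
  \<open>h\<close>. It is only ever evaluated on functions in the cone, so no measure has to be constructed.
\<close>

lemma state_bound:
  assumes f: "f \<in> cone A" and b: "\<And>z. f z \<le> b * h z"
  shows "(\<lambda>n. (L ^^ n) f z / h z) \<longlonglongrightarrow> state f"
    "\<bar>(L ^^ n) f z - state f * h z\<bar> \<le> \<kappa> ^ n * b * h z"
proof -
  obtain c where c: "\<And>n z. \<bar>(L ^^ n) f z - c * h z\<bar> \<le> \<kappa> ^ n * b * h z"
    using exponential_contraction[OF f h_cone b] by (auto simp: L_iterate_h)
  have lim: "(\<lambda>n. (L ^^ n) f z / h z) \<longlonglongrightarrow> c" for z
  proof (rule LIM_zero_cancel, rule Lim_null_comparison)
    show "(\<lambda>n. \<kappa> ^ n * b) \<longlonglongrightarrow> 0"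
      using \<kappa>_pos \<kappa>_less_1 by (intro tendsto_mult_left_zero LIMSEQ_power_zero) auto
    have "\<bar>(L ^^ n) f z / h z - c\<bar> \<le> \<kappa> ^ n * b" for n
    proof -
      have "(L ^^ n) f z / h z - c = ((L ^^ n) f z - c * h z) / h z"
        using h_pos[of z] by (simp add: field_simps)
      then show ?thesis using c[of n z] h_pos[of z] by (simp add: abs_divide divide_le_eq)
    qed
    then show "\<forall>\<^sub>F n in sequentially. norm ((L ^^ n) f z / h z - c) \<le> \<kappa> ^ n * b" by simp
  qed
  have "state f = c" unfolding state_def using limI[OF lim] .
  with lim c show "(\<lambda>n. (L ^^ n) f z / h z) \<longlonglongrightarrow> state f"
    "\<bar>(L ^^ n) f z - state f * h z\<bar> \<le> \<kappa> ^ n * b * h z" by auto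
qed

text \<open>
  The \<open>n\<close>-th iterate of the transfer operator applied to \<open>h\<close> times the indicator of the cylinder
  of a word of length \<open>n\<close>. The indicator is not in the cone, but this iterate is.
\<close>

definition density :: "nat list \<Rightarrow> nat stream \<Rightarrow> real" where
  "density u z = weight u z * h (u @- z)"

lemma density_cone: "density u \<in> cone A"
proof (induction u rule: rev_induct)
  case Nil show ?case using h_cone by (simp add: density_def[abs_def])
next
  case (snoc i u)
  have "density (u @ [i]) = (\<lambda>z. exp (- \<psi> (i ## z)) * density u (i ## z))"
    by (simp add: density_def weight_append fun_eq_iff)
  then show ?case using branch_cone_A'[OF snoc, of i] cone_A'_A by simp
qed

lemma density_Nil: "density [] = h"
  by (simp add: density_def fun_eq_iff)

lemma density_bound: "density u z \<le> (exp (2 * A) * density u z' / h z') * h z"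
proof -
  have "density u z * h z' \<le> (exp A * density u z') * (exp A * h z)"
    using h_pos cone_pos[OF density_cone]
    by (intro mult_mono cone_Harnack density_cone h_cone) (auto intro: less_imp_le)
  also have "\<dots> = exp (2 * A) * density u z' * h z" by (simp add: exp_add[symmetric])
  finally show ?thesis using h_pos[of z'] by (simp add: field_simps)
qed

definition q :: "nat list \<Rightarrow> real" where "q u = state (density u)"

lemma q_LIMSEQ: "(\<lambda>n. (L ^^ n) (density u) z / h z) \<longlonglongrightarrow> q u"
  unfolding q_def by (rule state_bound(1)[OF density_cone density_bound])

lemma q_ge: "(\<And>z. c * h z \<le> density u z) \<Longrightarrow> c \<le> q u"
proof (rule LIMSEQ_le_const[OF q_LIMSEQ[of u "sconst 0"]], intro exI allI impI)
  fix n assume "\<And>z. c * h z \<le> density u z"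
  then show "c \<le> (L ^^ n) (density u) (sconst 0) / h (sconst 0)"
    using L_iterate_mono[of "\<lambda>z. c * h z" "density u" n "sconst 0"] h_pos
    by (simp add: L_iterate_scale L_iterate_h le_divide_eq)
qed

lemma q_le: "(\<And>z. density u z \<le> c * h z) \<Longrightarrow> q u \<le> c"
proof (rule LIMSEQ_le_const2[OF q_LIMSEQ[of u "sconst 0"]], intro exI allI impI)
  fix n assume "\<And>z. density u z \<le> c * h z"
  then show "(L ^^ n) (density u) (sconst 0) / h (sconst 0) \<le> c"
    using L_iterate_mono[of "density u" "\<lambda>z. c * h z" n "sconst 0"] h_pos
    by (simp add: L_iterate_scale L_iterate_h divide_le_eq)
qed

lemma density_le_q: "density u z \<le> (exp (2 * A) * q u) * h z"
proof -
  have "density u z / h z / exp (2 * A) \<le> q u"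
  proof (rule q_ge)
    fix z'
    show "density u z / h z / exp (2 * A) * h z' \<le> density u z'"
      using density_bound[of u z z'] h_pos[of z] h_pos[of z'] by (simp add: field_simps)
  qed
  then show ?thesis using h_pos[of z] by (simp add: field_simps)
qed

lemma density_ge_q: "exp (- 2 * A) * q u * h z \<le> density u z"
proof -
  have "q u \<le> exp (2 * A) * density u z / h z" by (rule q_le) (rule density_bound)
  then show ?thesis using h_pos[of z] by (simp add: field_simps exp_minus)
qed

lemma q_pos: "0 < q u"
proof -
  have "0 < density u (sconst 0)" by (rule cone_pos[OF density_cone])
  also note density_le_q
  finally show ?thesis using h_pos[of "sconst 0"] by (simp add: zero_less_mult_iff)
qed

lemma q_Nil: "q [] = 1"
  using q_ge[of 1 "[]"] q_le[of "[]" 1] by (simp add: density_Nil)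

lemma q_sum_right: "(\<Sum>v\<in>words N m. q (u @ v)) = q u"
proof (rule LIMSEQ_unique)
  let ?o = "sconst 0 :: nat stream"
  show "(\<lambda>n. \<Sum>v\<in>words N m. (L ^^ n) (density (u @ v)) ?o / h ?o) \<longlonglongrightarrow> (\<Sum>v\<in>words N m. q (u @ v))"
    by (intro tendsto_sum q_LIMSEQ)
  have "(\<lambda>z. \<Sum>v\<in>words N m. density (u @ v) z) = (L ^^ m) (density u)"
    by (simp add: fun_eq_iff L_iterate density_def weight_append mult_ac)
  then have "(\<Sum>v\<in>words N m. (L ^^ n) (density (u @ v)) ?o / h ?o) = (L ^^ (n + m)) (density u) ?o / h ?o" for n
    by (simp add: sum_divide_distrib[symmetric] L_iterate_sum[symmetric] funpow_add)
  then show "(\<lambda>n. \<Sum>v\<in>words N m. (L ^^ n) (density (u @ v)) ?o / h ?o) \<longlonglongrightarrow> q u"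
    using LIMSEQ_ignore_initial_segment[OF q_LIMSEQ[of u ?o], of m] by simp
qed

lemma density_append_left:
  "(\<Sum>v\<in>words N m. density (u @ v @ w) z) = weight w z * (L ^^ m) (density u) (w @- z)"
  by (simp add: density_def weight_append L_iterate sum_distrib_left mult_ac)

lemma L_iterate_density_sum:
  "(\<lambda>n. (L ^^ n) (\<lambda>z. \<Sum>v\<in>words N m. density (u @ v @ w) z) z' / h z') \<longlonglongrightarrow> (\<Sum>v\<in>words N m. q (u @ v @ w))"
  unfolding L_iterate_sum sum_divide_distrib by (intro tendsto_sum q_LIMSEQ)

lemma q_sum_left: "(\<Sum>v\<in>words N m. q (v @ w)) = q w"
proof -
  have "(\<Sum>v\<in>words N m. density ([] @ v @ w) z) = density w z" for z
    by (subst density_append_left) (simp add: density_Nil L_iterate_h, simp add: density_def)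
  then show ?thesis
    using LIMSEQ_unique[OF L_iterate_density_sum[where u="[]" and m=m and w=w and z'="sconst 0"] , of "q w"]
      q_LIMSEQ[of w "sconst 0"] by simp
qed

text \<open>
  Summing over the middle word applies \<open>m\<close> iterations to the density of \<open>u\<close>, which is then within a
  factor \<open>1 + O(\<kappa> ^ m)\<close> of \<open>q u * h\<close>; the remaining word \<open>w\<close> is carried along by positivity.
\<close>

lemma q_mixing:
  "\<bar>(\<Sum>v\<in>words N m. q (u @ v @ w)) - q u * q w\<bar> \<le> exp (2 * A) * \<kappa> ^ m * (q u * q w)"
proof -
  let ?o = "sconst 0 :: nat stream"
  define C where "C = exp (2 * A) * \<kappa> ^ m"
  let ?F = "\<lambda>z. \<Sum>v\<in>words N m. density (u @ v @ w) z"
  have b: "\<bar>?F z - q u * density w z\<bar> \<le> C * q u * density w z" for z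
  proof -
    have "?F z - q u * density w z = weight w z * ((L ^^ m) (density u) (w @- z) - q u * h (w @- z))"
      unfolding density_append_left by (simp add: density_def algebra_simps)
    also have "\<bar>\<dots>\<bar> \<le> weight w z * (\<kappa> ^ m * (exp (2 * A) * q u) * h (w @- z))"
      using state_bound(2)[OF density_cone[of u] density_le_q[of u], where n=m and z="w @- z"] weight_pos[of w z]
      by (simp add: abs_mult q_def)
    finally show ?thesis by (simp add: C_def density_def mult_ac)
  qed
  have up: "?F z \<le> ((1 + C) * q u) * density w z" for z
    using b[of z] unfolding abs_le_iff by (simp add: algebra_simps)
  have lo: "((1 - C) * q u) * density w z \<le> ?F z" for z
    using b[of z] unfolding abs_le_iff by (simp add: algebra_simps)
  have lim: "(\<lambda>n. ((L ^^ n) ?F ?o) / h ?o) \<longlonglongrightarrow> (\<Sum>v\<in>words N m. q (u @ v @ w))"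
    by (rule L_iterate_density_sum)
  have lim2: "(\<lambda>n. c * ((L ^^ n) (density w) ?o / h ?o)) \<longlonglongrightarrow> c * q w" for c
    by (intro tendsto_mult_left q_LIMSEQ)
  have "(\<Sum>v\<in>words N m. q (u @ v @ w)) \<le> ((1 + C) * q u) * q w"
  proof (rule LIMSEQ_le[OF lim lim2], intro exI allI impI)
    fix n show "(L ^^ n) ?F ?o / h ?o \<le> (1 + C) * q u * ((L ^^ n) (density w) ?o / h ?o)"
      using L_iterate_mono[OF up, where n=n and z="?o"] h_pos[of ?o] by (simp add: L_iterate_scale divide_right_mono)
  qed
  moreover have "((1 - C) * q u) * q w \<le> (\<Sum>v\<in>words N m. q (u @ v @ w))"
  proof (rule LIMSEQ_le[OF lim2 lim], intro exI allI impI)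
    fix n show "(1 - C) * q u * ((L ^^ n) (density w) ?o / h ?o) \<le> (L ^^ n) ?F ?o / h ?o"
      using L_iterate_mono[OF lo, where n=n and z="?o"] h_pos[of ?o] by (simp add: L_iterate_scale divide_right_mono)
  qed
  ultimately show ?thesis unfolding abs_le_iff C_def[symmetric] by (simp add: algebra_simps)
qed

lemma p_le_q:
  assumes u: "set u \<subseteq> {..<N}"
  shows "p u \<le> exp (2 * A) * K ^ 3 * q u"
proof -
  let ?o = "sconst 0 :: nat stream"
  have "p u \<le> K * weight u ?o" by (rule p_upper[OF u])
  also have "\<dots> \<le> K * (K * density u ?o)"
  proof -
    have "1 \<le> K * h (u @- ?o)" using h_bounds(1)[of "u @- ?o"] K_ge_1 by (simp add: field_simps)
    then have "weight u ?o * 1 \<le> weight u ?o * (K * h (u @- ?o))"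
      using weight_pos[of u ?o] by (intro mult_left_mono) auto
    then show ?thesis using K_ge_1 by (intro mult_left_mono) (auto simp: density_def mult_ac)
  qed
  also have "\<dots> \<le> K * (K * ((exp (2 * A) * q u) * K))"
    using density_le_q[of u ?o] h_bounds(2)[of ?o] q_pos[of u] K_ge_1
    by (intro mult_left_mono order_trans[OF density_le_q mult_left_mono]) auto
  finally show ?thesis by (simp add: power3_eq_cube mult_ac)
qed

lemma q_le_p:
  assumes u: "set u \<subseteq> {..<N}"
  shows "q u \<le> exp (2 * A) * K ^ 3 * p u"
proof -
  let ?o = "sconst 0 :: nat stream"
  have "q u * h ?o \<le> exp (2 * A) * density u ?o"
    using density_ge_q[of u ?o] by (simp add: exp_minus field_simps)
  also have "\<dots> \<le> exp (2 * A) * ((K * p u) * K)"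
    unfolding density_def using h_bounds(2) p_lower[OF u] h_pos p_pos[OF u] K_ge_1
    by (intro mult_left_mono mult_mono) (auto intro: less_imp_le)
  finally have "q u * h ?o \<le> exp (2 * A) * K\<^sup>2 * p u" by (simp add: power2_eq_square mult_ac)
  moreover have "q u \<le> K * (q u * h ?o)"
    using mult_left_mono[OF h_bounds(1)[of ?o], of "q u"] q_pos[of u] K_ge_1 by (simp add: field_simps)
  ultimately have "q u \<le> K * (exp (2 * A) * K\<^sup>2 * p u)"
    using K_ge_1 mult_left_mono[of "q u * h ?o" "exp (2 * A) * K\<^sup>2 * p u" K] by linarith
  then show ?thesis by (simp add: power3_eq_cube power2_eq_square mult_ac)
qed

end

section \<open>Uniqueness of the invariant state and psi-mixing\<close>

context gibbs_shift
begin

text \<open>Inherited from \<open>p\<close>, since the two families are comparable.\<close>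

lemma q_quasi_Bernoulli:
  obtains B where "B > 0" "\<And>u v. set u \<subseteq> {..<N} \<Longrightarrow> set v \<subseteq> {..<N} \<Longrightarrow> q u * q v \<le> B * q (u @ v)"
proof -
  define E where "E = exp (2 * A) * K ^ 3"
  have E: "E > 0" using K_ge_1 by (simp add: E_def)
  have "q u * q v \<le> (E * E * K ^ 3 * E) * q (u @ v)"
    if u: "set u \<subseteq> {..<N}" and v: "set v \<subseteq> {..<N}" for u v
  proof -
    have "q u * q v \<le> (E * p u) * (E * p v)"
      using q_le_p[OF u] q_le_p[OF v] q_pos p_pos[OF u] E
      by (intro mult_mono mult_nonneg_nonneg) (auto simp: E_def intro: less_imp_le)
    also have "\<dots> = (E * E) * (p u * p v)" by simp
    also have "\<dots> \<le> (E * E) * (K ^ 3 * p (u @ v))"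
      using E quasi_Bernoulli_lower[OF u v] by (intro mult_left_mono) auto
    also have "\<dots> \<le> (E * E) * (K ^ 3 * (E * q (u @ v)))"
      using E K_ge_1 p_le_q[of "u @ v"] u v by (intro mult_left_mono) (auto simp: E_def)
    finally show ?thesis by (simp add: mult_ac)
  qed
  then show ?thesis using that[of "E * E * K ^ 3 * E"] E K_ge_1 by simp
qed

text \<open>The density of \<open>p\<close> with respect to \<open>q\<close>, as a martingale along the words.\<close>

definition r where "r u = p u / q u"

lemma q_r: "q u * r u = p u"
  using q_pos[of u] by (simp add: r_def)

text \<open>Orthogonality of increments.\<close>

lemma r_variance:
  assumes "set u \<subseteq> {..<N}"
  shows "(\<Sum>w\<in>words N k. q (u @ w) * (r (u @ w) - r u)\<^sup>2) = (\<Sum>w\<in>words N k. q (u @ w) * (r (u @ w))\<^sup>2) - q u * (r u)\<^sup>2"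
proof -
  have "q (u @ w) * (r (u @ w) - r u)\<^sup>2 = q (u @ w) * (r (u @ w))\<^sup>2 - 2 * r u * p (u @ w) + (r u)\<^sup>2 * q (u @ w)" for w
    by (simp add: q_r[of "u @ w", symmetric] power2_eq_square algebra_simps)
  then have "(\<Sum>w\<in>words N k. q (u @ w) * (r (u @ w) - r u)\<^sup>2) =
      (\<Sum>w\<in>words N k. q (u @ w) * (r (u @ w))\<^sup>2) - 2 * r u * (\<Sum>w\<in>words N k. p (u @ w)) + (r u)\<^sup>2 * (\<Sum>w\<in>words N k. q (u @ w))"
    by (simp add: sum.distrib sum_subtractf sum_distrib_left)
  also have "\<dots> = (\<Sum>w\<in>words N k. q (u @ w) * (r (u @ w))\<^sup>2) - q u * (r u)\<^sup>2"
    by (simp add: p_append_right[OF assms] q_sum_right q_r[symmetric, of u] power2_eq_square algebra_simps)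
  finally show ?thesis .
qed

definition energy where "energy n = (\<Sum>u\<in>words N n. q u * (r u)\<^sup>2)"

lemma energy_increment:
  "energy (n + k) - energy n = (\<Sum>u\<in>words N n. \<Sum>w\<in>words N k. q (u @ w) * (r (u @ w) - r u)\<^sup>2)"
proof -
  have "(\<Sum>u\<in>words N n. \<Sum>w\<in>words N k. q (u @ w) * (r (u @ w) - r u)\<^sup>2)
     = (\<Sum>u\<in>words N n. (\<Sum>w\<in>words N k. q (u @ w) * (r (u @ w))\<^sup>2) - q u * (r u)\<^sup>2)"
    by (intro sum.cong r_variance) (auto simp: words_def)
  then show ?thesis by (simp add: energy_def sum_words_append sum_subtractf)
qed

lemma r_bounds:
  obtains R where "\<And>u. set u \<subseteq> {..<N} \<Longrightarrow> 0 \<le> r u \<and> r u \<le> R"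
proof -
  have "0 \<le> r u \<and> r u \<le> exp (2 * A) * K ^ 3" if "set u \<subseteq> {..<N}" for u
    using p_le_q[OF that] q_pos[of u] p_pos[OF that] by (simp add: r_def divide_le_eq)
  then show ?thesis using that by blast
qed

lemma sum_q: "(\<Sum>u\<in>words N n. q u) = 1"
  using q_sum_right[of "[]" n] by (simp add: q_Nil)

text \<open>
  A bounded martingale is Cauchy in the mean square, so beyond some level refining a word by
  \<open>k\<close> letters hardly changes the density.
\<close>

lemma energy_Cauchy:
  assumes "\<eta> > 0"
  obtains n where "\<And>k. energy (n + k) - energy n < \<eta>"
proof -
  obtain R where R: "\<And>u. set u \<subseteq> {..<N} \<Longrightarrow> 0 \<le> r u \<and> r u \<le> R" using r_bounds by blast
  have mono: "incseq energy"
    using energy_increment[of _ 1] q_pos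
    by (intro incseq_SucI) (smt (verit, best) Suc_eq_plus1 mult_nonneg_nonneg sum_nonneg zero_le_power2)
  have "energy n \<le> R\<^sup>2" for n
  proof -
    have "energy n \<le> (\<Sum>u\<in>words N n. q u * R\<^sup>2)" unfolding energy_def
      using R q_pos by (intro sum_mono mult_left_mono power_mono) (auto simp: words_def less_imp_le)
    then show ?thesis by (simp add: sum_distrib_right[symmetric] sum_q)
  qed
  with mono have "convergent energy"
    by (metis incseq_convergent convergent_def)
  then have "Cauchy energy" by (simp add: Cauchy_convergent_iff)
  then obtain n where "\<And>m. m \<ge> n \<Longrightarrow> dist (energy m) (energy n) < \<eta>"
    using metric_CauchyD[OF _ assms] by blast
  then show ?thesis using that[of n] by (smt (verit) dist_real_def le_add1)
qed

text \<open>
  Choose a word \<open>w\<close> where the density is within \<open>\<delta>\<close> of its supremum \<open>R\<close>. By invariance of \<open>p\<close> and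
  \<open>q\<close>, the density is close to \<open>R\<close> on average over the extensions \<open>u @ w\<close> to the left. For long \<open>u\<close> it
  is about the same at \<open>u\<close> as at \<open>u @ w\<close>, and by the quasi-Bernoulli property the average over
  \<open>u\<close> does not feel \<open>w\<close>. So the density is close to \<open>R\<close> on average, but its average is one.
\<close>

lemma r_le_1:
  assumes w0: "set w0 \<subseteq> {..<N}"
  shows "r w0 \<le> 1"
proof -
  define W where "W = {w. set w \<subseteq> {..<N}}"
  define R where "R = (SUP w\<in>W. r w)"
  obtain R0 where R0: "\<And>u. set u \<subseteq> {..<N} \<Longrightarrow> 0 \<le> r u \<and> r u \<le> R0" using r_bounds by blast
  have bdd: "bdd_above (r ` W)" using R0 by (auto simp: W_def bdd_above_def)
  have le: "r u \<le> R" if "set u \<subseteq> {..<N}" for u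
    unfolding R_def using bdd that by (intro cSUP_upper) (auto simp: W_def)
  obtain B where B: "B > 0" "\<And>u v. set u \<subseteq> {..<N} \<Longrightarrow> set v \<subseteq> {..<N} \<Longrightarrow> q u * q v \<le> B * q (u @ v)"
    using q_quasi_Bernoulli by blast
  have "R - 1 \<le> 2 * B * \<delta>" if \<delta>: "\<delta> > 0" for \<delta>
  proof -
    have "\<exists>w\<in>W. R - \<delta> < r w"
      using \<delta> w0 bdd less_cSUP_iff[of W r "R - \<delta>"] by (auto simp: R_def W_def)
    then obtain w where w: "set w \<subseteq> {..<N}" and rw: "R - \<delta> < r w" by (auto simp: W_def)
    define k where "k = length w"
    have wk: "w \<in> words N k" using w by (simp add: words_def k_def)
    obtain n where n: "energy (n + k) - energy n < \<delta>\<^sup>2 * q w"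
    proof -
      have "0 < \<delta>\<^sup>2 * q w" using \<delta> q_pos[of w] by simp
      then show thesis using energy_Cauchy that by metis
    qed
    have un: "set u \<subseteq> {..<N}" if "u \<in> words N n" for u using that by (simp add: words_def)
    have var: "(\<Sum>u\<in>words N n. q (u @ w) * (r (u @ w) - r u)\<^sup>2) \<le> \<delta>\<^sup>2 * q w"
    proof -
      have "(\<Sum>u\<in>words N n. q (u @ w) * (r (u @ w) - r u)\<^sup>2) \<le> energy (n + k) - energy n"
        unfolding energy_increment using wk q_pos
        by (intro sum_mono member_le_sum) (auto intro!: mult_nonneg_nonneg intro: less_imp_le)
      with n show ?thesis by simp
    qed
    \<comment> \<open>From \<open>2 x \<delta> \<le> x\<^sup>2 + \<delta>\<^sup>2\<close>, the mean of \<open>r (u @ w) - r u\<close> is at most \<open>\<delta>\<close>.\<close>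
    have "(\<Sum>u\<in>words N n. q (u @ w) * (2 * \<delta> * (r (u @ w) - r u)))
        \<le> (\<Sum>u\<in>words N n. q (u @ w) * (r (u @ w) - r u)\<^sup>2 + \<delta>\<^sup>2 * q (u @ w))"
    proof (rule sum_mono)
      fix u
      have "2 * \<delta> * (r (u @ w) - r u) \<le> (r (u @ w) - r u)\<^sup>2 + \<delta>\<^sup>2"
        using sum_squares_bound[of \<delta> "r (u @ w) - r u"] by simp
      from mult_left_mono[OF this, of "q (u @ w)"] q_pos[of "u @ w"]
      show "q (u @ w) * (2 * \<delta> * (r (u @ w) - r u)) \<le> q (u @ w) * (r (u @ w) - r u)\<^sup>2 + \<delta>\<^sup>2 * q (u @ w)"
        by (simp add: algebra_simps)
    qed
    also have "\<dots> \<le> 2 * \<delta> * (\<delta> * q w)"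
      using var by (simp add: sum.distrib sum_distrib_left[symmetric] q_sum_left power2_eq_square)
    also have "(\<Sum>u\<in>words N n. q (u @ w) * (2 * \<delta> * (r (u @ w) - r u)))
        = 2 * \<delta> * (\<Sum>u\<in>words N n. q (u @ w) * (r (u @ w) - r u))"
      unfolding sum_distrib_left by (intro sum.cong) (simp_all add: mult_ac)
    finally have "(\<Sum>u\<in>words N n. q (u @ w) * (r (u @ w) - r u)) \<le> \<delta> * q w"
      using \<delta> by simp
    then have "(\<Sum>u\<in>words N n. p (u @ w)) - (\<Sum>u\<in>words N n. q (u @ w) * r u) \<le> \<delta> * q w"
      by (simp add: right_diff_distrib sum_subtractf q_r)
    then have 1: "p w - \<delta> * q w \<le> (\<Sum>u\<in>words N n. q (u @ w) * r u)"
      by (simp add: p_append_left[OF w])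
    have 2: "(R - \<delta>) * q w \<le> p w" using rw q_pos[of w] by (simp add: r_def less_divide_eq)
    have "q w * (R - 1) = (\<Sum>u\<in>words N n. q u * q w * (R - r u))"
    proof -
      have "(\<Sum>u\<in>words N n. q u * q w * (R - r u)) = q w * (R * (\<Sum>u\<in>words N n. q u) - (\<Sum>u\<in>words N n. q u * r u))"
        by (simp add: sum_distrib_left sum_subtractf[symmetric] algebra_simps)
      then show ?thesis by (simp add: sum_q q_r sum_p)
    qed
    also have "\<dots> \<le> (\<Sum>u\<in>words N n. (B * q (u @ w)) * (R - r u))"
      using B(2)[OF un w] le un by (intro sum_mono mult_right_mono) auto
    also have "\<dots> = B * (R * (\<Sum>u\<in>words N n. q (u @ w)) - (\<Sum>u\<in>words N n. q (u @ w) * r u))"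
      by (simp add: sum_distrib_left sum_subtractf[symmetric] algebra_simps)
    also have "\<dots> \<le> B * (R * q w - (p w - \<delta> * q w))"
      using 1 B(1) by (simp add: q_sum_left)
    also have "\<dots> \<le> B * (2 * \<delta> * q w)"
      using 2 B(1) by (intro mult_left_mono) (auto simp: algebra_simps)
    finally have "q w * (R - 1) \<le> q w * (2 * B * \<delta>)" by (simp add: mult_ac)
    then show ?thesis using q_pos[of w] by simp
  qed
  from this[of "\<epsilon> / (2 * B)" for \<epsilon>] have "R - 1 \<le> 0 + \<epsilon>" if "\<epsilon> > 0" for \<epsilon>
    using B(1) that by simp
  then have "R \<le> 1" using field_le_epsilon[of "R - 1" 0] by simp
  with le[OF w0] show ?thesis by simp
qed

lemma p_eq_q:
  assumes "set u \<subseteq> {..<N}"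
  shows "p u = q u"
proof -
  have le: "p v \<le> q v" if "v \<in> words N (length u)" for v
    using r_le_1[of v] that q_pos[of v] by (simp add: r_def words_def)
  have "(\<Sum>v\<in>words N (length u). q v - p v) = 0"
    by (simp add: sum_subtractf sum_p sum_q)
  then have "\<forall>v\<in>words N (length u). q v - p v = 0"
    using le by (subst (asm) sum_nonneg_eq_0_iff) auto
  then show ?thesis using assms by (auto simp: words_def)
qed

theorem psi_mixing:
  assumes "set u \<subseteq> {..<N}" "set w \<subseteq> {..<N}"
  shows "\<bar>(\<Sum>v\<in>words N m. p (u @ v @ w)) - p u * p w\<bar> \<le> exp (2 * A) * \<kappa> ^ m * (p u * p w)"
proof -
  have "(\<Sum>v\<in>words N m. p (u @ v @ w)) = (\<Sum>v\<in>words N m. q (u @ v @ w))"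
    using assms by (intro sum.cong p_eq_q) (auto simp: words_def)
  with q_mixing[where u=u and m=m and w=w] assms show ?thesis by (simp add: p_eq_q)
qed

text \<open>
  A cylinder has at least two children, and each of them takes a definite fraction of its measure.
\<close>

lemma p_decay:
  assumes N2: "2 \<le> N"
  obtains C \<rho> where "0 < \<rho>" "\<rho> < 1" "\<And>u. set u \<subseteq> {..<N} \<Longrightarrow> p u \<le> C * \<rho> ^ length u"
proof -
  define c where "c = (MIN i\<in>{..<N}. p [i]) / K ^ 3"
  have K3: "0 < K ^ 3" using K_ge_1 by simp
  have "0 < (MIN i\<in>{..<N}. p [i])" 
    using N2 p_pos by (subst Min_gr_iff) (auto simp: lessThan_empty_iff)
  then have c0: "0 < c" using K3 by (simp add: c_def)
  have low: "c * p u \<le> p (u @ [i])" if "set u \<subseteq> {..<N}" "i < N" for u i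
  proof -
    have "(MIN i\<in>{..<N}. p [i]) \<le> p [i]" using that by (intro Min_le) auto
    then have "(MIN i\<in>{..<N}. p [i]) * p u \<le> p [i] * p u"
      using p_pos[OF that(1)] by (intro mult_right_mono) auto
    also have "\<dots> \<le> K ^ 3 * p (u @ [i])" using quasi_Bernoulli_lower[OF that(1), of "[i]"] that by (simp add: mult.commute)
    finally show ?thesis using K3 by (simp add: c_def field_simps)
  qed
  have up: "p (u @ [i]) \<le> (1 - c) * p u" if u: "set u \<subseteq> {..<N}" and i: "i < N" for u i
  proof -
    have "\<exists>j<N. j \<noteq> i" using N2 by (intro exI[of _ "if i = 0 then 1 else 0"]) auto
    then obtain j where j: "j < N" "j \<noteq> i" by blast
    have "p (u @ [i]) + p (u @ [j]) = (\<Sum>k\<in>{i, j}. p (u @ [k]))" using j by simp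
    also have "\<dots> \<le> (\<Sum>k<N. p (u @ [k]))"
      using u i j by (intro sum_mono2 less_imp_le[OF p_pos]) auto
    also have "\<dots> = p u" by (rule p_snoc[OF u])
    finally show ?thesis using low[OF u j(1)] by (simp add: algebra_simps)
  qed
  have c1: "c < 1"
  proof -
    have "0 < p ([] @ [0])" using N_pos p_pos by simp
    also have "\<dots> \<le> (1 - c) * p []" using up[of "[]" 0] N_pos by simp
    finally show ?thesis by (simp add: p_Nil)
  qed
  have "p u \<le> 1 * (1 - c) ^ length u" if "set u \<subseteq> {..<N}" for u
    using that
  proof (induction u rule: rev_induct)
    case Nil show ?case by (simp add: p_Nil)
  next
    case (snoc i u)
    then have "p (u @ [i]) \<le> (1 - c) * p u" by (intro up) auto
    also have "\<dots> \<le> (1 - c) * (1 - c) ^ length u" using snoc c1 by (intro mult_left_mono) auto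
    finally show ?case by simp
  qed
  then show ?thesis using that[of "1 - c" 1] c0 c1 by auto
qed

end

section \<open>Cylinders of a piecewise expanding map\<close>

locale gibbs_map =
  fixes T \<phi> :: "real \<Rightarrow> real" and N :: nat and C :: "nat \<Rightarrow> real set" and \<mu> :: "real measure"
  assumes expanding: "piecewise_expanding T N C"
    and potential: "holder_continuous_on {0..1} \<phi>"
    and gibbs: "gibbs_measure T N C \<phi> \<mu>"
begin

abbreviation Z :: "nat list \<Rightarrow> real set" where "Z \<equiv> cylinder T C"

lemma T_unit: "x \<in> {0..1} \<Longrightarrow> T x \<in> {0..1}"
  using expanding unfolding piecewise_expanding_def by auto

lemma T_iter_unit: "x \<in> {0..1} \<Longrightarrow> (T ^^ n) x \<in> {0..1}"
  by (induction n) (use T_unit in auto)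

lemma branch_interval: "j < N \<Longrightarrow> is_interval (C j)"
  using expanding unfolding piecewise_expanding_def by auto

lemma branches_cover: "(\<Union>j<N. C j) = {0..1}"
  using expanding unfolding piecewise_expanding_def by auto

lemma branch_subset: "j < N \<Longrightarrow> C j \<subseteq> {0..1}"
  using branches_cover by blast

lemma branches_disjoint: "i < N \<Longrightarrow> j < N \<Longrightarrow> x \<in> C i \<Longrightarrow> x \<in> C j \<Longrightarrow> i = j"
proof -
  assume *: "i < N" "j < N" "x \<in> C i" "x \<in> C j"
  have "disjoint_family_on C {..<N}" using expanding unfolding piecewise_expanding_def by auto
  then show "i = j" using * disjoint_family_onD[of C "{..<N}" i j] by auto
qed

lemma branch_onto: "j < N \<Longrightarrow> {0<..<1} \<subseteq> T ` C j"
  using expanding unfolding piecewise_expanding_def by auto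

lemma branch_Lipschitz_aux:
  "\<exists>D\<ge>3. \<forall>j<N. \<forall>x\<in>C j. \<forall>y\<in>C j. 3 * \<bar>x - y\<bar> \<le> \<bar>T x - T y\<bar> \<and> \<bar>T x - T y\<bar> \<le> D * \<bar>x - y\<bar>"
proof -
  obtain D where D: "D \<ge> 3" "\<forall>j<N. \<forall>x\<in>C j. \<exists>d.
        (T has_real_derivative d) (at x within C j) \<and> 3 \<le> \<bar>d\<bar> \<and> \<bar>d\<bar> \<le> D"
    using expanding unfolding piecewise_expanding_def by blast
  have less: "3 * \<bar>x - y\<bar> \<le> \<bar>T x - T y\<bar> \<and> \<bar>T x - T y\<bar> \<le> D * \<bar>x - y\<bar>"
    if j: "j < N" and x: "x \<in> C j" and y: "y \<in> C j" and xy: "x < y" for j x y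
  proof -
    obtain d where d: "\<And>z. z \<in> C j \<Longrightarrow> (T has_real_derivative d z) (at z within C j)"
      "\<And>z. z \<in> C j \<Longrightarrow> 3 \<le> \<bar>d z\<bar> \<and> \<bar>d z\<bar> \<le> D" using D(2) j by metis
    have sub: "{x..y} \<subseteq> C j" using mem_is_interval_1_I[OF branch_interval[OF j] x y] by auto
    have "\<exists>z\<in>{x<..<y}. T y - T x = d z * (y - x)"
    proof (rule mvt_simple[OF xy])
      fix z assume "x \<le> z" "z \<le> y"
      then have "z \<in> C j" using sub by auto
      from d(1)[OF this] show "(T has_derivative (*) (d z)) (at z within {x..y})"
        unfolding has_field_derivative_def using sub by (rule has_derivative_subset)
    qed
    then obtain z where z: "z \<in> {x<..<y}" "T y - T x = d z * (y - x)" by blast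
    have "\<bar>T x - T y\<bar> = \<bar>d z\<bar> * \<bar>x - y\<bar>" using z(2) by (metis abs_minus_commute abs_mult)
    moreover have "3 \<le> \<bar>d z\<bar> \<and> \<bar>d z\<bar> \<le> D" using d(2)[OF subsetD[OF sub, of z]] z(1) by auto
    ultimately show ?thesis by (auto intro: mult_right_mono)
  qed
  have "3 * \<bar>x - y\<bar> \<le> \<bar>T x - T y\<bar> \<and> \<bar>T x - T y\<bar> \<le> D * \<bar>x - y\<bar>"
    if "j < N" "x \<in> C j" "y \<in> C j" for j x y
    using less[of j x y] less[of j y x] that
    by (cases x y rule: linorder_cases) (auto simp: abs_minus_commute)
  with D(1) show ?thesis by blast
qed

definition D where "D = (SOME D. D \<ge> 3 \<and> (\<forall>j<N. \<forall>x\<in>C j. \<forall>y\<in>C j.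
  3 * \<bar>x - y\<bar> \<le> \<bar>T x - T y\<bar> \<and> \<bar>T x - T y\<bar> \<le> D * \<bar>x - y\<bar>))"

lemma D_ge_3: "D \<ge> 3"
  and branch_expanding: "j < N \<Longrightarrow> x \<in> C j \<Longrightarrow> y \<in> C j \<Longrightarrow> 3 * \<bar>x - y\<bar> \<le> \<bar>T x - T y\<bar>"
  and branch_Lipschitz: "j < N \<Longrightarrow> x \<in> C j \<Longrightarrow> y \<in> C j \<Longrightarrow> \<bar>T x - T y\<bar> \<le> D * \<bar>x - y\<bar>"
  using someI_ex[OF branch_Lipschitz_aux, folded D_def] by simp_all

lemma N_ge_2: "2 \<le> N"
proof (rule ccontr)
  assume "\<not> 2 \<le> N"
  then have "N = 0 \<or> N = 1" by auto
  moreover have "N \<noteq> 0"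
  proof
    assume "N = 0"
    then have "{0..1::real} = {}" using branches_cover by simp
    then show False by simp
  qed
  ultimately have "C 0 = {0..1}" "0 < N" using branches_cover by auto
  then have "3 \<le> \<bar>T 0 - T 1\<bar>" using branch_expanding[of 0 0 1] by auto
  moreover have "T 0 \<in> {0..1}" "T 1 \<in> {0..1}" by (rule T_unit, simp)+
  ultimately show False by auto
qed

lemma cylinder_Nil [simp]: "Z [] = {0..1}"
  by (auto simp: cylinder_def)

lemma cylinder_subset: "Z u \<subseteq> {0..1}"
  by (auto simp: cylinder_def)

lemma cylinder_unit: "x \<in> Z u \<Longrightarrow> x \<in> {0..1}"
  by (rule subsetD[OF cylinder_subset])

lemma cylinder_append: "x \<in> Z (u @ v) \<longleftrightarrow> x \<in> Z u \<and> (T ^^ length u) x \<in> Z v"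
proof -
  have "(\<forall>m<length (u @ v). (T ^^ m) x \<in> C ((u @ v) ! m)) \<longleftrightarrow>
     (\<forall>m<length u. (T ^^ m) x \<in> C (u ! m)) \<and> (\<forall>m<length v. (T ^^ m) ((T ^^ length u) x) \<in> C (v ! m))"
    (is "?l = ?r")
  proof
    assume l: ?l
    have "(T ^^ m) ((T ^^ length u) x) \<in> C (v ! m)" if "m < length v" for m
      using l[rule_format, of "length u + m"] that by (simp add: funpow_add add.commute[of "length u"] nth_append)
    moreover have "(T ^^ m) x \<in> C (u ! m)" if "m < length u" for m
      using l[rule_format, of m] that by (simp add: nth_append)
    ultimately show ?r by blast
  next
    assume r: ?r
    show ?l
    proof (intro allI impI)
      fix m assume m: "m < length (u @ v)"
      show "(T ^^ m) x \<in> C ((u @ v) ! m)"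
      proof (cases "m < length u")
        case True then show ?thesis using r by (simp add: nth_append)
      next
        case False
        then have "(T ^^ (m - length u)) ((T ^^ length u) x) \<in> C (v ! (m - length u))" using r m by auto
        moreover have "(T ^^ (m - length u)) ((T ^^ length u) x) = (T ^^ m) x"
          using False by (metis comp_apply funpow_add le_add_diff_inverse2 not_less)
        ultimately show ?thesis using False by (simp add: nth_append)
      qed
    qed
  qed
  then show ?thesis using T_iter_unit[of x "length u"] by (auto simp: cylinder_def)
qed

lemma cylinder_single: "j < N \<Longrightarrow> Z [j] = C j"
  using branch_subset[of j] by (auto simp: cylinder_def)

lemma cylinder_Cons: "j < N \<Longrightarrow> x \<in> Z (j # u) \<longleftrightarrow> x \<in> C j \<and> T x \<in> Z u"
  using cylinder_append[of x "[j]" u] by (simp add: cylinder_single)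

lemma cylinder_snoc: "i < N \<Longrightarrow> x \<in> Z (u @ [i]) \<longleftrightarrow> x \<in> Z u \<and> (T ^^ length u) x \<in> C i"
  by (simp add: cylinder_append cylinder_single)

lemma cylinder_disjoint:
  assumes "u \<in> words N n" "v \<in> words N n" "x \<in> Z u" "x \<in> Z v"
  shows "u = v"
proof (rule nth_equalityI)
  show "length u = length v" using assms by (simp add: words_def)
  fix m assume m: "m < length u"
  then have "u ! m < N" "v ! m < N" using assms by (auto simp: words_def subset_iff)
  moreover have "(T ^^ m) x \<in> C (u ! m)" "(T ^^ m) x \<in> C (v ! m)"
    using assms m by (auto simp: cylinder_def words_def)
  ultimately show "u ! m = v ! m" by (rule branches_disjoint)
qed

lemma cylinder_cover:
  assumes "x \<in> {0..1}"
  obtains u where "u \<in> words N n" "x \<in> Z u"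
proof -
  have "\<exists>u\<in>words N n. x \<in> Z u"
  proof (induction n)
    case 0 then show ?case using assms by simp
  next
    case (Suc n)
    then obtain u where u: "u \<in> words N n" "x \<in> Z u" by blast
    obtain i where i: "i < N" "(T ^^ n) x \<in> C i"
      using T_iter_unit[OF assms, of n] branches_cover by blast
    have "u @ [i] \<in> words N (Suc n)" "x \<in> Z (u @ [i])"
      using u i by (auto simp: words_def cylinder_snoc)
    then show ?case by blast
  qed
  then show ?thesis using that by blast
qed

lemma cylinder_expanding:
  "set u \<subseteq> {..<N} \<Longrightarrow> x \<in> Z u \<Longrightarrow> y \<in> Z u \<Longrightarrow>
    3 ^ length u * \<bar>x - y\<bar> \<le> \<bar>(T ^^ length u) x - (T ^^ length u) y\<bar>"
proof (induction u arbitrary: x y)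
  case (Cons j u)
  then have j: "j < N" and x: "x \<in> C j" "T x \<in> Z u" and y: "y \<in> C j" "T y \<in> Z u"
    by (auto simp: cylinder_Cons)
  have "3 ^ length (j # u) * \<bar>x - y\<bar> \<le> 3 ^ length u * \<bar>T x - T y\<bar>"
    using branch_expanding[OF j x(1) y(1)] by simp
  also have "\<dots> \<le> \<bar>(T ^^ length u) (T x) - (T ^^ length u) (T y)\<bar>"
    using Cons x y by auto
  finally show ?case by (simp add: funpow_swap1)
qed simp

lemma cylinder_Lipschitz:
  "set u \<subseteq> {..<N} \<Longrightarrow> x \<in> Z u \<Longrightarrow> y \<in> Z u \<Longrightarrow>
    \<bar>(T ^^ length u) x - (T ^^ length u) y\<bar> \<le> D ^ length u * \<bar>x - y\<bar>"
proof (induction u arbitrary: x y)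
  case (Cons j u)
  then have j: "j < N" and x: "x \<in> C j" "T x \<in> Z u" and y: "y \<in> C j" "T y \<in> Z u"
    by (auto simp: cylinder_Cons)
  have "\<bar>(T ^^ length u) (T x) - (T ^^ length u) (T y)\<bar> \<le> D ^ length u * \<bar>T x - T y\<bar>"
    using Cons x y by auto
  also have "\<dots> \<le> D ^ length u * (D * \<bar>x - y\<bar>)"
    using branch_Lipschitz[OF j x(1) y(1)] D_ge_3 by (intro mult_left_mono) auto
  finally show ?case by (simp add: funpow_swap1 mult_ac)
qed simp

lemma cylinder_diameter:
  assumes "u \<in> words N n" "x \<in> Z u" "y \<in> Z u"
  shows "\<bar>x - y\<bar> \<le> (1 / 3) ^ n"
proof -
  have "(T ^^ n) x \<in> {0..1}" "(T ^^ n) y \<in> {0..1}"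
    using T_iter_unit[OF cylinder_unit[OF assms(2)]] T_iter_unit[OF cylinder_unit[OF assms(3)]] by blast+
  then have "\<bar>(T ^^ n) x - (T ^^ n) y\<bar> \<le> 1" by auto
  then have "3 ^ n * \<bar>x - y\<bar> \<le> 1" using cylinder_expanding[of u x y] assms by (simp add: words_def)
  then show ?thesis by (simp add: power_divide field_simps)
qed

text \<open>The branches are continuous and injective, hence monotone.\<close>

lemma cylinder_interval: "set u \<subseteq> {..<N} \<Longrightarrow> is_interval (Z u)"
proof (induction u)
  case Nil show ?case by (simp add: is_interval_cc)
next
  case (Cons j u)
  then have j: "j < N" and IH: "is_interval (Z u)" by auto
  show ?case unfolding is_interval_1
  proof (intro ballI allI impI)
    fix x y z assume x: "x \<in> Z (j # u)" and y: "y \<in> Z (j # u)" and z: "x \<le> z \<and> z \<le> y"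
    have sub: "{x..y} \<subseteq> C j"
      using x y mem_is_interval_1_I[OF branch_interval[OF j], of x y] by (auto simp: cylinder_Cons[OF j])
    have Txy: "T x \<in> Z u" "T y \<in> Z u" using x y by (auto simp: cylinder_Cons[OF j])
    have "T z \<in> Z u"
    proof (cases "x < z \<and> z < y")
      case True
      have lip: "\<bar>T v - T w\<bar> \<le> D * \<bar>v - w\<bar>" if "v \<in> {x..y}" "w \<in> {x..y}" for v w
        by (intro branch_Lipschitz[OF j] subsetD[OF sub] that)
      have "D-lipschitz_on {x..y} T"
        using lip D_ge_3 by (auto simp: lipschitz_on_def dist_real_def)
      then have "continuous_on {x..y} T" by (rule lipschitz_on_continuous_on)
      moreover have "inj_on T {x..y}"
      proof (rule inj_onI)
        fix v w assume "v \<in> {x..y}" "w \<in> {x..y}" "T v = T w"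
        then show "v = w" using branch_expanding[OF j, OF subsetD[OF sub, of v] subsetD[OF sub, of w]] by auto
      qed
      ultimately have "(T x < T z \<and> T z < T y) \<or> (T y < T z \<and> T z < T x)"
        using True by (intro continuous_inj_imp_mono) auto
      then show ?thesis using mem_is_interval_1_I[OF IH Txy(1) Txy(2)] mem_is_interval_1_I[OF IH Txy(2) Txy(1)] by auto
    next
      case False then show ?thesis using z Txy by (cases "x = z") auto
    qed
    then show "z \<in> Z (j # u)" using sub z by (auto simp: cylinder_Cons[OF j])
  qed
qed

text \<open>
  The endpoints 0 and 1 need not lie in the image of a branch, and at each step their forward
  images may be lost, so that the full image is only obtained up to finitely many points.
\<close>

lemma cylinder_image: "set u \<subseteq> {..<N} \<Longrightarrow> finite ({0<..<1} - (T ^^ length u) ` Z u)"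
proof (induction u)
  case Nil
  have "{0<..<1} - {0..1::real} = {}" by auto
  then show ?case by (simp only: list.size funpow.simps(1) image_id image_ident id_apply cylinder_Nil finite.emptyI)
next
  case (Cons j u)
  then have j: "j < N" and fin: "finite ({0<..<1} - (T ^^ length u) ` Z u)" by auto
  have "{0<..<1} - (T ^^ length (j # u)) ` Z (j # u)
     \<subseteq> ({0<..<1} - (T ^^ length u) ` Z u) \<union> {(T ^^ length u) 0, (T ^^ length u) 1}"
  proof
    fix x assume x: "x \<in> {0<..<1} - (T ^^ length (j # u)) ` Z (j # u)"
    show "x \<in> ({0<..<1} - (T ^^ length u) ` Z u) \<union> {(T ^^ length u) 0, (T ^^ length u) 1}"
    proof (rule ccontr)
      assume n: "\<not> ?thesis"
      then obtain y where y: "y \<in> Z u" "x = (T ^^ length u) y" using x by auto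
      with n have "y \<noteq> 0" "y \<noteq> 1" by auto
      then have "y \<in> {0<..<1}" using y cylinder_subset[of u] by fastforce
      then obtain z where z: "z \<in> C j" "y = T z" using branch_onto[OF j] by auto
      then have "z \<in> Z (j # u)" using y by (simp add: cylinder_Cons[OF j])
      moreover have "x = (T ^^ length (j # u)) z" using y z by (simp add: funpow_swap1)
      ultimately show False using x by blast
    qed
  qed
  then show ?case by (rule finite_subset) (use fin in simp)
qed

text \<open>
  A cylinder of level \<open>n\<close> has length at least of order \<open>D ^ (- n)\<close>: two of its points are mapped to
  distance at least \<open>1 / 2\<close> by an \<open>n\<close>-fold composition of \<open>D\<close>-Lipschitz branches.
\<close>

lemma cylinder_spread:
  assumes "u \<in> words N n"
  obtains x y where "x \<in> Z u" "y \<in> Z u" "1 / 2 \<le> D ^ n * \<bar>x - y\<bar>"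
proof -
  let ?F = "{0<..<1} - (T ^^ length u) ` Z u"
  have F: "finite ?F" using assms by (intro cylinder_image) (simp add: words_def)
  have "infinite ({0<..<1/4::real} - ?F)" "infinite ({3/4<..<1::real} - ?F)"
    using F by (auto simp: Diff_infinite_finite)
  then have "{0<..<1/4} - ?F \<noteq> {}" "{3/4<..<1} - ?F \<noteq> {}" by (metis finite.emptyI)+
  then obtain v w where v: "v \<in> {0<..<1/4} - ?F" and w: "w \<in> {3/4<..<1} - ?F" by blast
  then have "v \<in> (T ^^ length u) ` Z u" "w \<in> (T ^^ length u) ` Z u" by auto
  then obtain x y where x: "x \<in> Z u" "v = (T ^^ length u) x" and y: "y \<in> Z u" "w = (T ^^ length u) y" by blast
  have "1 / 2 \<le> \<bar>v - w\<bar>" using v w by auto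
  also have "\<dots> \<le> D ^ n * \<bar>x - y\<bar>" using cylinder_Lipschitz[of u x y] x y assms by (simp add: words_def)
  finally show ?thesis using that x y by blast
qed

lemma cylinder_nonempty: "set u \<subseteq> {..<N} \<Longrightarrow> Z u \<noteq> {}"
  using cylinder_spread[of u "length u"] by (auto simp: words_def)

sublocale prob_space \<mu>
  using gibbs by (simp add: gibbs_measure_def)

lemma sets_mu_iff: "S \<in> sets \<mu> \<longleftrightarrow> S \<subseteq> {0..1} \<and> S \<in> sets borel"
proof -
  have "sets \<mu> = sets (restrict_space borel {0..1})" using gibbs by (simp add: gibbs_measure_def)
  then show ?thesis by (simp add: sets_restrict_space_iff)
qed

lemma space_mu: "space \<mu> = {0..1}"
proof -
  have "sets \<mu> = sets (restrict_space borel {0..1})" using gibbs by (simp add: gibbs_measure_def)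
  from sets_eq_imp_space_eq[OF this] show ?thesis by (simp add: space_restrict_space)
qed

lemma interval_measurable: "is_interval S \<Longrightarrow> S \<subseteq> {0..1} \<Longrightarrow> S \<in> sets \<mu>"
  by (simp add: sets_mu_iff real_interval_borel_measurable)

lemma T_measurable: "T \<in> measurable \<mu> \<mu>"
  using gibbs by (simp add: gibbs_measure_def invariant_measure_def)

lemma T_iter_measurable: "(T ^^ n) \<in> measurable \<mu> \<mu>"
  using T_measurable by (rule measurable_compose_n)

lemma T_invariant: "S \<in> sets \<mu> \<Longrightarrow> prob {x\<in>{0..1}. T x \<in> S} = prob S"
proof -
  assume S: "S \<in> sets \<mu>"
  have "prob S = measure (distr \<mu> \<mu> T) S" using gibbs by (simp add: gibbs_measure_def invariant_measure_def)
  also have "\<dots> = prob {x\<in>{0..1}. T x \<in> S}"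
    using measure_distr[OF T_measurable S] by (simp add: space_mu vimage_def Int_def conj_commute)
  finally show ?thesis ..
qed

lemma cylinder_measurable: "set u \<subseteq> {..<N} \<Longrightarrow> Z u \<in> sets \<mu>"
  by (intro interval_measurable cylinder_interval cylinder_subset)

definition p :: "nat list \<Rightarrow> real" where "p u = prob (Z u)"

lemma p_nonneg: "0 \<le> p u" by (simp add: p_def)

lemma measure_split_cylinders:
  assumes S: "S \<in> sets \<mu>"
  shows "prob S = (\<Sum>u\<in>words N n. prob (S \<inter> Z u))"
proof -
  have "S = (\<Union>u\<in>words N n. S \<inter> Z u)"
  proof
    show "S \<subseteq> (\<Union>u\<in>words N n. S \<inter> Z u)"
    proof
      fix x assume x: "x \<in> S"
      then have "x \<in> {0..1}" using S by (auto simp: sets_mu_iff)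
      then show "x \<in> (\<Union>u\<in>words N n. S \<inter> Z u)" using x cylinder_cover[of x n] by blast
    qed
  qed auto
  then have "prob S = prob (\<Union>u\<in>words N n. S \<inter> Z u)" by simp
  also have "\<dots> = (\<Sum>u\<in>words N n. prob (S \<inter> Z u))"
  proof (rule finite_measure_finite_Union)
    show "(\<lambda>u. S \<inter> Z u) ` words N n \<subseteq> events"
      using S by (auto simp: words_def intro!: sets.Int cylinder_measurable)
    show "disjoint_family_on (\<lambda>u. S \<inter> Z u) (words N n)"
      using cylinder_disjoint[where n=n] unfolding disjoint_family_on_def by blast
  qed simp
  finally show ?thesis .
qed

lemma measure_cylinder_union:
  assumes "W \<subseteq> words N n"
  shows "(\<Union>w\<in>W. Z w) \<in> sets \<mu>" "prob (\<Union>w\<in>W. Z w) = (\<Sum>w\<in>W. p w)"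
proof -
  have fin: "finite W" using assms by (rule finite_subset) simp
  have meas: "Z w \<in> sets \<mu>" if "w \<in> W" for w
    using assms that by (intro cylinder_measurable) (auto simp: words_def)
  show "(\<Union>w\<in>W. Z w) \<in> sets \<mu>" using fin meas by auto
  show "prob (\<Union>w\<in>W. Z w) = (\<Sum>w\<in>W. p w)"
    unfolding p_def using fin meas assms cylinder_disjoint
    by (intro finite_measure_finite_Union) (fastforce simp: disjoint_family_on_def)+
qed

lemma p_snoc: "set u \<subseteq> {..<N} \<Longrightarrow> (\<Sum>i<N. p (u @ [i])) = p u"
proof -
  assume u: "set u \<subseteq> {..<N}"
  have "(\<Union>w\<in>(\<lambda>i. u @ [i]) ` {..<N}. Z w) = Z u"
  proof (intro equalityI subsetI)
    fix x assume x: "x \<in> Z u"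
    then have "(T ^^ length u) x \<in> {0..1}" by (intro T_iter_unit subsetD[OF cylinder_subset])
    then obtain i where "i < N" "(T ^^ length u) x \<in> C i" unfolding branches_cover[symmetric] by blast
    then show "x \<in> (\<Union>w\<in>(\<lambda>i. u @ [i]) ` {..<N}. Z w)" using x by (auto simp: cylinder_snoc)
  qed (auto simp: cylinder_snoc)
  moreover have sub: "(\<lambda>i. u @ [i]) ` {..<N} \<subseteq> words N (Suc (length u))" using u by (auto simp: words_def)
  ultimately have "p u = (\<Sum>w\<in>(\<lambda>i. u @ [i]) ` {..<N}. p w)"
    using measure_cylinder_union(2)[OF sub] by (simp only: p_def)
  also have "\<dots> = (\<Sum>i<N. p (u @ [i]))" by (subst sum.reindex) (auto simp: inj_on_def)
  finally show ?thesis ..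
qed

lemma p_Cons: "set u \<subseteq> {..<N} \<Longrightarrow> (\<Sum>i<N. p (i # u)) = p u"
proof -
  assume u: "set u \<subseteq> {..<N}"
  have "(\<Union>w\<in>(\<lambda>i. i # u) ` {..<N}. Z w) = {x\<in>{0..1}. T x \<in> Z u}"
    unfolding branches_cover[symmetric] by (auto simp: cylinder_Cons)
  moreover have sub: "(\<lambda>i. i # u) ` {..<N} \<subseteq> words N (Suc (length u))" using u by (auto simp: words_def)
  ultimately have "p u = (\<Sum>w\<in>(\<lambda>i. i # u) ` {..<N}. p w)"
    using measure_cylinder_union(2)[OF sub] T_invariant[OF cylinder_measurable[OF u]] by (simp only: p_def)
  also have "\<dots> = (\<Sum>i<N. p (i # u))" by (subst sum.reindex) (auto simp: inj_on_def)
  finally show ?thesis ..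
qed

definition pt :: "nat list \<Rightarrow> real" where "pt u = (SOME x. x \<in> Z u)"

lemma pt_in: "set u \<subseteq> {..<N} \<Longrightarrow> pt u \<in> Z u"
  unfolding pt_def using cylinder_nonempty[of u] by (auto intro: someI_ex)

text \<open>Reduction modulo \<open>N\<close> gives every stream of natural numbers a code over the alphabet.\<close>

definition code :: "nat \<Rightarrow> nat stream \<Rightarrow> nat list" where
  "code n z = map (\<lambda>i. i mod N) (stake n z)"

lemma code_words: "code n z \<in> words N n"
  using N_ge_2 by (auto simp: code_def words_def)

lemma code_prefix: "m \<le> n \<Longrightarrow> code n z = code m z @ map (\<lambda>i. i mod N) (stake (n - m) (sdrop m z))"
  unfolding code_def map_append[symmetric] by simp

lemma code_shift: "set u \<subseteq> {..<N} \<Longrightarrow> code (length u) (u @- z) = u"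
  by (auto simp: code_def stake_shift intro!: map_idI)

text \<open>
  The potential on sequences is the limit of its values on the shrinking cylinders. It is defined
  through representatives \<open>pt u\<close>, because the intersection of the cylinders along a sequence may be
  empty.
\<close>

definition \<psi> :: "nat stream \<Rightarrow> real" where "\<psi> z = lim (\<lambda>n. \<phi> (pt (code n z)))"

text \<open>Cylinders shrink like \<open>3 ^ (- n)\<close>, so the Hoelder exponent \<open>\<alpha>\<close> gives the rate \<open>3 ^ (- \<alpha>)\<close>.\<close>

lemma potential_variation:
  obtains H \<theta> where "0 \<le> H" "0 < \<theta>" "\<theta> < 1"
    "\<And>n u x y. u \<in> words N n \<Longrightarrow> x \<in> Z u \<Longrightarrow> y \<in> Z u \<Longrightarrow> \<bar>\<phi> x - \<phi> y\<bar> \<le> H * \<theta> ^ n"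
proof -
  obtain \<alpha> H where H: "0 < \<alpha>" "0 \<le> H" "\<And>x y. x \<in> {0..1} \<Longrightarrow> y \<in> {0..1} \<Longrightarrow> \<bar>\<phi> x - \<phi> y\<bar> \<le> H * \<bar>x - y\<bar> powr \<alpha>"
    using potential unfolding holder_continuous_on_def by metis
  define \<theta> :: real where "\<theta> = (1 / 3) powr \<alpha>"
  have "\<bar>\<phi> x - \<phi> y\<bar> \<le> H * \<theta> ^ n" if "u \<in> words N n" "x \<in> Z u" "y \<in> Z u" for n u x y
  proof -
    have "\<bar>\<phi> x - \<phi> y\<bar> \<le> H * \<bar>x - y\<bar> powr \<alpha>" by (intro H(3) cylinder_unit[OF that(2)] cylinder_unit[OF that(3)])
    also have "\<dots> \<le> H * ((1 / 3) ^ n) powr \<alpha>"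
      using H cylinder_diameter[OF that] by (intro mult_left_mono powr_mono2) auto
    also have "((1 / 3) ^ n) powr \<alpha> = \<theta> ^ n"
      unfolding \<theta>_def by (simp add: powr_realpow[symmetric] powr_powr mult.commute)
    finally show ?thesis .
  qed
  moreover have "0 < \<theta>" "\<theta> < 1" using H(1) powr_less_mono2[of \<alpha> "1 / 3" 1] by (auto simp: \<theta>_def)
  ultimately show ?thesis using that H(2) by blast
qed

end

section \<open>Symbolic coding and regularity of the Gibbs measure\<close>

context gibbs_map
begin

lemma \<psi>_approx:
  assumes \<theta>: "0 < \<theta>" "\<theta> < 1"
    and var: "\<And>n u x y. u \<in> words N n \<Longrightarrow> x \<in> Z u \<Longrightarrow> y \<in> Z u \<Longrightarrow> \<bar>\<phi> x - \<phi> y\<bar> \<le> H * \<theta> ^ n"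
    and x: "x \<in> Z (code m z)"
  shows "\<bar>\<psi> z - \<phi> x\<bar> \<le> H * \<theta> ^ m"
proof -
  let ?f = "\<lambda>n. \<phi> (pt (code n z))"
  have code_set: "set (code n z) \<subseteq> {..<N}" for n using code_words[of n z] by (simp add: words_def)
  have deeper: "pt (code n z) \<in> Z (code k z)" if "k \<le> n" for n k
    using pt_in[OF code_set[of n]] code_prefix[OF that, of z] by (metis cylinder_append)
  have k0: "(\<lambda>n. H * \<theta> ^ n) \<longlonglongrightarrow> 0"
    using \<theta> by (intro tendsto_mult_right_zero LIMSEQ_power_zero) auto
  have near: "\<bar>?f n - ?f k\<bar> \<le> H * \<theta> ^ k" if "k \<le> n" for n k
    by (rule var[OF code_words deeper[OF that] deeper[OF order_refl]])
  have "Cauchy ?f"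
  proof (rule metric_CauchyI)
    fix e :: real assume e: "e > 0"
    obtain n0 where n0: "H * \<theta> ^ n0 < e / 2"
      using order_tendstoD(2)[OF k0, of "e / 2"] e by (auto simp: eventually_sequentially)
    have "dist (?f m) (?f n) < e" if "m \<ge> n0" "n \<ge> n0" for m n
      using near[OF that(1)] near[OF that(2)] n0 unfolding dist_real_def by linarith
    then show "\<exists>M. \<forall>m\<ge>M. \<forall>n\<ge>M. dist (?f m) (?f n) < e" by blast
  qed
  then have lim: "?f \<longlonglongrightarrow> \<psi> z"
    unfolding \<psi>_def by (simp add: Cauchy_convergent convergent_LIMSEQ_iff[symmetric])
  show ?thesis
  proof (rule LIMSEQ_le_const2)
    show "(\<lambda>n. \<bar>?f n - \<phi> x\<bar>) \<longlonglongrightarrow> \<bar>\<psi> z - \<phi> x\<bar>" by (intro tendsto_intros lim)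
    show "\<exists>N. \<forall>n\<ge>N. \<bar>?f n - \<phi> x\<bar> \<le> H * \<theta> ^ m"
      using var[OF code_words deeper x] by blast
  qed
qed

text \<open>
  The cylinder measures satisfy the Gibbs property for the symbolic potential: Birkhoff sums on a
  cylinder and along any sequence with the same code differ by at most a geometric series.
\<close>

lemma mixing_and_decay:
  obtains M \<kappa> where "0 < \<kappa>" "\<kappa> < 1" "0 \<le> M"
    "\<And>u w m. set u \<subseteq> {..<N} \<Longrightarrow> set w \<subseteq> {..<N} \<Longrightarrow>
       \<bar>(\<Sum>v\<in>words N m. p (u @ v @ w)) - p u * p w\<bar> \<le> M * \<kappa> ^ m * (p u * p w)"
    "\<And>u. set u \<subseteq> {..<N} \<Longrightarrow> p u \<le> M * \<kappa> ^ length u"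
proof -
  obtain H \<theta> where H: "0 \<le> H" and \<theta>: "0 < \<theta>" "\<theta> < 1"
    and var: "\<And>n u x y. u \<in> words N n \<Longrightarrow> x \<in> Z u \<Longrightarrow> y \<in> Z u \<Longrightarrow> \<bar>\<phi> x - \<phi> y\<bar> \<le> H * \<theta> ^ n"
    using potential_variation by metis
  have approx: "\<bar>\<psi> z - \<phi> x\<bar> \<le> H * \<theta> ^ m" if "x \<in> Z (code m z)" for x m z
    by (rule \<psi>_approx[OF \<theta> _ that]) (rule var)
  interpret hp: holder_potential N \<psi> "2 * H" \<theta>
  proof
    show "0 < N" using N_ge_2 by simp
    fix n and z z' :: "nat stream" assume eq: "stake n z = stake n z'"
    have cs: "set (code n z) \<subseteq> {..<N}" using code_words[of n z] by (simp add: words_def)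
    have "code n z = code n z'" using eq by (simp add: code_def)
    then have "\<bar>\<psi> z - \<phi> (pt (code n z))\<bar> \<le> H * \<theta> ^ n" "\<bar>\<psi> z' - \<phi> (pt (code n z))\<bar> \<le> H * \<theta> ^ n"
      using approx[of "pt (code n z)" n] pt_in[OF cs] by auto
    then show "\<psi> z \<le> \<psi> z' + 2 * H * \<theta> ^ n" by linarith
  qed (use H \<theta> in auto)
  define G where "G = H / (1 - \<theta>)"
  have birk: "\<bar>birkhoff_sum T \<phi> (length u) x + ln (hp.weight u z)\<bar> \<le> H * (\<Sum>k<length u. \<theta> ^ Suc k)"
    if "set u \<subseteq> {..<N}" "x \<in> Z u" for u x z
    using that
  proof (induction u arbitrary: x)
    case Nil then show ?case by (simp add: birkhoff_sum_def)
  next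
    case (Cons i u)
    then have Tx: "T x \<in> Z u" by (auto simp: cylinder_Cons)
    have "code (length (i # u)) ((i # u) @- z) = i # u" by (rule code_shift[OF Cons.prems(1)])
    then have 1: "\<bar>\<psi> ((i # u) @- z) - \<phi> x\<bar> \<le> H * \<theta> ^ length (i # u)"
      using approx[of x "length (i # u)" "(i # u) @- z"] Cons.prems(2) by simp
    have "birkhoff_sum T \<phi> (length (i # u)) x = \<phi> x + birkhoff_sum T \<phi> (length u) (T x)"
      by (simp add: birkhoff_sum_def sum.lessThan_Suc_shift funpow_swap1 del: sum.lessThan_Suc)
    moreover have "ln (hp.weight (i # u) z) = - \<psi> ((i # u) @- z) + ln (hp.weight u z)"
      using hp.weight_pos[of u z] by (simp add: ln_mult)
    moreover have "\<bar>birkhoff_sum T \<phi> (length u) (T x) + ln (hp.weight u z)\<bar> \<le> H * (\<Sum>k<length u. \<theta> ^ Suc k)"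
      using Cons.prems Tx by (intro Cons.IH) auto
    moreover have "H * (\<Sum>k<length (i # u). \<theta> ^ Suc k) = H * (\<Sum>k<length u. \<theta> ^ Suc k) + H * \<theta> ^ length (i # u)"
      by (simp add: algebra_simps)
    ultimately show ?case using 1 by linarith
  qed
  have "H * (\<Sum>k<n. \<theta> ^ Suc k) \<le> G" for n
  proof -
    have "(\<Sum>k<n. \<theta> ^ Suc k) \<le> (\<Sum>k<n. \<theta> ^ k)" using \<theta> by (intro sum_mono) (simp add: mult_left_le_one_le)
    also have "\<dots> \<le> 1 / (1 - \<theta>)" using \<theta> by (simp add: sum_gp_strict divide_right_mono)
    finally show ?thesis using mult_left_mono[OF _ H] by (fastforce simp: G_def)
  qed
  then have birk': "\<bar>birkhoff_sum T \<phi> (length u) x + ln (hp.weight u z)\<bar> \<le> G"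
    if "set u \<subseteq> {..<N}" "x \<in> Z u" for u x z
    using birk[OF that, of z] order_trans by blast
  have w1: "hp.weight u z \<le> exp G * exp (- birkhoff_sum T \<phi> (length u) x)"
    and w2: "exp (- birkhoff_sum T \<phi> (length u) x) \<le> exp G * hp.weight u z"
    if "set u \<subseteq> {..<N}" "x \<in> Z u" for u x z
  proof -
    have w: "hp.weight u z = exp (ln (hp.weight u z))" using hp.weight_pos[of u z] by simp
    show "hp.weight u z \<le> exp G * exp (- birkhoff_sum T \<phi> (length u) x)"
      by (subst w) (use birk'[OF that, of z] in \<open>simp add: exp_add[symmetric] abs_le_iff\<close>)
    show "exp (- birkhoff_sum T \<phi> (length u) x) \<le> exp G * hp.weight u z"
      by (subst w) (use birk'[OF that, of z] in \<open>simp add: exp_add[symmetric] abs_le_iff\<close>)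
  qed
  obtain K where K: "K > 0" and Kb: "\<And>js x. js \<noteq> [] \<Longrightarrow> set js \<subseteq> {..<N} \<Longrightarrow> x \<in> Z js \<Longrightarrow>
      inverse K \<le> p js / exp (- birkhoff_sum T \<phi> (length js) x) \<and>
      p js / exp (- birkhoff_sum T \<phi> (length js) x) \<le> K"
    using gibbs unfolding gibbs_measure_def p_def by blast
  define K2 where "K2 = max 1 (K * exp G)"
  have pNil: "p [] = 1" using prob_space by (simp add: p_def space_mu)
  have bounds: "hp.weight u z \<le> K2 * p u \<and> p u \<le> K2 * hp.weight u z" if u: "set u \<subseteq> {..<N}" for u z
  proof (cases "u = []")
    case True then show ?thesis by (simp add: pNil K2_def)
  next
    case False
    define E where "E = exp (- birkhoff_sum T \<phi> (length u) (pt u))"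
    have E: "E > 0" by (simp add: E_def)
    have "inverse K \<le> p u / E" "p u / E \<le> K" using Kb[OF False u pt_in[OF u]] by (auto simp: E_def)
    then have k: "E \<le> K * p u" "p u \<le> K * E" using K E by (auto simp: field_simps)
    have "hp.weight u z \<le> exp G * E" using w1[OF u pt_in[OF u]] by (simp add: E_def)
    also have "\<dots> \<le> exp G * (K * p u)" using k by simp
    also have "\<dots> \<le> K2 * p u" using mult_right_mono[of "K * exp G" K2 "p u"] p_nonneg[of u] by (simp add: K2_def mult_ac)
    finally have 1: "hp.weight u z \<le> K2 * p u" .
    have "p u \<le> K * (exp G * hp.weight u z)" using k w2[OF u pt_in[OF u], of z] K
      by (intro order_trans[OF k(2)] mult_left_mono) (auto simp: E_def)
    also have "\<dots> \<le> K2 * hp.weight u z"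
      using mult_right_mono[of "K * exp G" K2 "hp.weight u z"] hp.weight_pos[of u z] by (simp add: K2_def mult_ac)
    finally show ?thesis using 1 by simp
  qed
  interpret gs: gibbs_shift N \<psi> "2 * H" \<theta> p K2
    by unfold_locales (use pNil p_snoc p_Cons bounds in auto)
  obtain c \<rho> where c: "0 < \<rho>" "\<rho> < 1" "\<And>u. set u \<subseteq> {..<N} \<Longrightarrow> p u \<le> c * \<rho> ^ length u"
    by (rule gs.p_decay[OF N_ge_2], rule that)
  define \<kappa> where "\<kappa> = max hp.\<kappa> \<rho>"
  define M where "M = max (exp (2 * hp.A)) \<bar>c\<bar>"
  have k: "0 < \<kappa>" "\<kappa> < 1" "hp.\<kappa> \<le> \<kappa>" "\<rho> \<le> \<kappa>" using c hp.\<kappa>_pos hp.\<kappa>_less_1 by (auto simp: \<kappa>_def)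
  have M: "0 \<le> M" "exp (2 * hp.A) \<le> M" "\<bar>c\<bar> \<le> M" by (auto simp: M_def le_max_iff_disj)
  show ?thesis
  proof (rule that[OF k(1,2) M(1)])
    fix u w :: "nat list" and m assume uw: "set u \<subseteq> {..<N}" "set w \<subseteq> {..<N}"
    note gs.psi_mixing[OF uw, of m]
    also have "exp (2 * hp.A) * hp.\<kappa> ^ m * (p u * p w) \<le> M * \<kappa> ^ m * (p u * p w)"
      using k M hp.\<kappa>_pos p_nonneg by (intro mult_right_mono mult_mono power_mono) auto
    finally show "\<bar>(\<Sum>v\<in>words N m. p (u @ v @ w)) - p u * p w\<bar> \<le> M * \<kappa> ^ m * (p u * p w)" .
  next
    fix u :: "nat list" assume u: "set u \<subseteq> {..<N}"
    note c(3)[OF u]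
    also have "c * \<rho> ^ length u \<le> M * \<kappa> ^ length u"
      using k M c by (intro mult_mono power_mono) auto
    finally show "p u \<le> M * \<kappa> ^ length u" .
  qed
qed

end

locale decaying_map = gibbs_map +
  fixes M \<kappa> :: real
  assumes \<kappa>: "0 < \<kappa>" "\<kappa> < 1" and M_nonneg: "0 \<le> M"
    and decay: "set u \<subseteq> {..<N} \<Longrightarrow> p u \<le> M * \<kappa> ^ length u"
begin

definition J :: "real \<Rightarrow> real \<Rightarrow> real set" where "J a b = {a<..<b} \<inter> {0..1}"

lemma J_measurable: "J a b \<in> sets \<mu>"
  by (auto simp: J_def sets_mu_iff)

text \<open>Cylinders and \<open>J a b\<close> are intervals, so a partial overlap contains an endpoint.\<close>

lemma straddle:
  assumes w: "set w \<subseteq> {..<N}" and meet: "Z w \<inter> J a b \<noteq> {}" and nsub: "\<not> Z w \<subseteq> J a b"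
  shows "a \<in> Z w \<or> b \<in> Z w"
proof -
  obtain x where x: "x \<in> Z w" "a < x" "x < b" using meet by (auto simp: J_def)
  obtain y where y0: "y \<in> Z w" "y \<notin> J a b" using nsub by blast
  then have y: "y \<in> Z w" "\<not> (a < y \<and> y < b)" using cylinder_unit[OF y0(1)] by (auto simp: J_def)
  show ?thesis
    using mem_is_interval_1_I[OF cylinder_interval[OF w] y(1) x(1), of a]
      mem_is_interval_1_I[OF cylinder_interval[OF w] x(1) y(1), of b] x y by linarith
qed

definition outer where "outer n a b = {w\<in>words N n. Z w \<inter> J a b \<noteq> {}}"
definition inner where "inner n a b = {w\<in>words N n. Z w \<subseteq> J a b}"

lemma outer_words: "outer n a b \<subseteq> words N n" and inner_words: "inner n a b \<subseteq> words N n"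
  by (auto simp: outer_def inner_def)

lemma finite_outer: "finite (outer n a b)" and finite_inner: "finite (inner n a b)"
  by (rule finite_subset[OF outer_words finite_words], rule finite_subset[OF inner_words finite_words])

lemma outer_covers: "x \<in> J a b \<Longrightarrow> \<exists>w\<in>outer n a b. x \<in> Z w"
proof -
  assume x: "x \<in> J a b"
  then obtain w where "w \<in> words N n" "x \<in> Z w" using cylinder_cover[of x n] by (auto simp: J_def)
  then show ?thesis using x by (auto simp: outer_def)
qed

lemma sum_containing: "(\<Sum>w\<in>{w\<in>words N n. c \<in> Z w}. p w) \<le> M * \<kappa> ^ n"
proof (cases "{w\<in>words N n. c \<in> Z w} = {}")
  case True
  then show ?thesis unfolding True using M_nonneg \<kappa> by simp
next
  case False
  then obtain w where w: "w \<in> words N n" "c \<in> Z w" by blast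
  then have "{w\<in>words N n. c \<in> Z w} = {w}" using cylinder_disjoint by blast
  then show ?thesis using decay[of w] w by (simp add: words_def)
qed

text \<open>At most two cylinders of each level straddle an endpoint.\<close>

lemma outer_minus_inner: "(\<Sum>w\<in>outer n a b. p w) \<le> (\<Sum>w\<in>inner n a b. p w) + 2 * M * \<kappa> ^ n"
proof -
  have sub: "outer n a b - inner n a b \<subseteq> {w\<in>words N n. a \<in> Z w} \<union> {w\<in>words N n. b \<in> Z w}"
    using straddle by (auto simp: outer_def inner_def words_def)
  have "(\<Sum>w\<in>outer n a b - inner n a b. p w) \<le> (\<Sum>w\<in>{w\<in>words N n. a \<in> Z w} \<union> {w\<in>words N n. b \<in> Z w}. p w)"
    using sub by (intro sum_mono2) (auto simp: p_nonneg)
  also have "\<dots> \<le> (\<Sum>w\<in>{w\<in>words N n. a \<in> Z w}. p w) + (\<Sum>w\<in>{w\<in>words N n. b \<in> Z w}. p w)"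
    by (subst sum.union_inter[symmetric]) (auto intro!: sum_nonneg simp: p_nonneg)
  also have "\<dots> \<le> 2 * M * \<kappa> ^ n" using sum_containing[of n a] sum_containing[of n b] by linarith
  finally have 1: "(\<Sum>w\<in>outer n a b - inner n a b. p w) \<le> 2 * M * \<kappa> ^ n" .
  have "(\<Sum>w\<in>outer n a b. p w) = (\<Sum>w\<in>outer n a b \<inter> inner n a b. p w) + (\<Sum>w\<in>outer n a b - inner n a b. p w)"
    using finite_outer by (subst sum.Int_Diff[of _ _ "inner n a b"]) auto
  also have "(\<Sum>w\<in>outer n a b \<inter> inner n a b. p w) \<le> (\<Sum>w\<in>inner n a b. p w)"
    using finite_inner by (intro sum_mono2) (auto simp: p_nonneg)
  finally show ?thesis using 1 by linarith
qed

lemma inner_le: "(\<Sum>w\<in>inner n a b. p w) \<le> prob (J a b)"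
proof -
  have "(\<Union>w\<in>inner n a b. Z w) \<subseteq> J a b" by (auto simp: inner_def)
  then have "prob (\<Union>w\<in>inner n a b. Z w) \<le> prob (J a b)"
    by (rule finite_measure_mono) (rule J_measurable)
  then show ?thesis by (simp only: measure_cylinder_union(2)[OF inner_words])
qed

lemma outer_ge: "prob (J a b) \<le> (\<Sum>w\<in>outer n a b. p w)"
proof -
  have "J a b \<subseteq> (\<Union>w\<in>outer n a b. Z w)"
  proof
    fix x assume "x \<in> J a b"
    from outer_covers[OF this, of n] show "x \<in> (\<Union>w\<in>outer n a b. Z w)" by simp
  qed
  then have "prob (J a b) \<le> prob (\<Union>w\<in>outer n a b. Z w)"
    by (rule finite_measure_mono) (rule measure_cylinder_union(1)[OF outer_words])
  then show ?thesis by (simp only: measure_cylinder_union(2)[OF outer_words])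
qed

lemma outer_le: "(\<Sum>w\<in>outer n a b. p w) \<le> prob (J a b) + 2 * M * \<kappa> ^ n"
  using outer_minus_inner[of n a b] inner_le[of n a b] by linarith

lemma inner_ge: "prob (J a b) - 2 * M * \<kappa> ^ n \<le> (\<Sum>w\<in>inner n a b. p w)"
  using outer_minus_inner[of n a b] outer_ge[of a b n] by linarith

text \<open>An interval shorter than every cylinder of level \<open>n\<close> meets only straddling ones.\<close>

lemma short_interval:
  assumes "D ^ n * (b - a) \<le> 1 / 2"
  shows "prob (J a b) \<le> 2 * M * \<kappa> ^ n"
proof -
  have "inner n a b = {}"
  proof (rule ccontr)
    assume "inner n a b \<noteq> {}"
    then obtain w where w: "w \<in> words N n" "Z w \<subseteq> J a b" by (auto simp: inner_def)
    obtain x y where xy: "x \<in> Z w" "y \<in> Z w" "1 / 2 \<le> D ^ n * \<bar>x - y\<bar>" by (rule cylinder_spread[OF w(1)])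
    have "x \<in> J a b" "y \<in> J a b" using w xy by auto
    then have "\<bar>x - y\<bar> < b - a" by (auto simp: J_def)
    then have "D ^ n * \<bar>x - y\<bar> < D ^ n * (b - a)" using D_ge_3 by (intro mult_strict_left_mono) auto
    then show False using xy assms by linarith
  qed
  then show ?thesis using inner_ge[of a b n] by simp
qed

text \<open>
  Converts the length scale \<open>D ^ (- m)\<close> of cylinders from below to the scale \<open>3 ^ (- n)\<close> of
  cylinders from above, with \<open>m\<close> about \<open>n / k\<close> where \<open>D < 3 ^ k\<close>.
\<close>

lemma Holder_regularity:
  obtains c \<rho> where "0 < \<rho>" "\<rho> < 1" "0 \<le> c"
    "\<And>n a b. b - a \<le> 4 * (1 / 3) ^ n \<Longrightarrow> prob (J a b) \<le> c * \<rho> ^ n"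
proof -
  obtain k where k: "D < 3 ^ k" using real_arch_pow[of 3 D] by auto
  have k0: "0 < k" using k D_ge_3 by (cases k) auto
  define \<rho> where "\<rho> = root k \<kappa>"
  have \<rho>k: "\<rho> ^ k = \<kappa>" unfolding \<rho>_def using k0 \<kappa> by (intro real_root_pow_pos2) auto
  have \<rho>: "0 < \<rho>" "\<rho> < 1" using k0 \<kappa> by (auto simp: \<rho>_def real_root_gt_zero)
  define c where "c = max 1 (2 * M) / \<rho> ^ (k + 2)"
  have c: "0 \<le> c" using \<rho> by (simp add: c_def)
  have "prob (J a b) \<le> c * \<rho> ^ n" if ab: "b - a \<le> 4 * (1 / 3) ^ n" for n a b
  proof (cases "n < k + 2")
    case True
    have "prob (J a b) \<le> 1" by simp
    also have "\<dots> \<le> \<rho> ^ n / \<rho> ^ (k + 2)"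
      using True \<rho> power_decreasing[of n "k + 2" \<rho>] by (simp add: le_divide_eq)
    also have "\<dots> = 1 / \<rho> ^ (k + 2) * \<rho> ^ n" by simp
    also have "\<dots> \<le> c * \<rho> ^ n" unfolding c_def using \<rho> by (intro mult_right_mono divide_right_mono) auto
    finally show ?thesis .
  next
    case False
    define m where "m = (n - 2) div k"
    have mk: "k * m \<le> n - 2" "n - 2 < k * m + k"
      using mult_div_mod_eq[of k "n - 2"] mod_less_divisor[OF k0, of "n - 2"] unfolding m_def by linarith+
    have "D ^ m * (b - a) \<le> D ^ m * (4 * (1 / 3) ^ n)" using ab D_ge_3 by (intro mult_left_mono) auto
    also have "\<dots> \<le> (3 ^ k) ^ m * (4 * (1 / 3) ^ n)" using k D_ge_3 by (intro mult_right_mono power_mono) auto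
    also have "\<dots> \<le> 3 ^ (n - 2) * (4 * (1 / 3) ^ n)"
      unfolding power_mult[symmetric] using mk by (intro mult_right_mono power_increasing) auto
    also have "\<dots> = 4 / 9"
    proof -
      have "n = (n - 2) + 2" using False by linarith
      then have "(3::real) ^ n = 3 ^ (n - 2) * 3 ^ 2" by (metis power_add)
      then show ?thesis by (simp add: power_divide)
    qed
    also have "\<dots> \<le> 1 / 2" by simp
    finally have "prob (J a b) \<le> 2 * M * \<kappa> ^ m" by (rule short_interval)
    also have "\<dots> = 2 * M * \<rho> ^ (k * m)" by (simp add: \<rho>k power_mult)
    also have "\<dots> \<le> max 1 (2 * M) * (\<rho> ^ n / \<rho> ^ (k + 2))"
    proof (intro mult_mono)
      have "\<rho> ^ (k * m) * \<rho> ^ (k + 2) \<le> \<rho> ^ n"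
        unfolding power_add[symmetric] using mk False \<rho> by (intro power_decreasing) auto
      then show "\<rho> ^ (k * m) \<le> \<rho> ^ n / \<rho> ^ (k + 2)" using \<rho> by (simp add: le_divide_eq)
    qed (use \<rho> in auto)
    also have "\<dots> = c * \<rho> ^ n" by (simp add: c_def)
    finally show ?thesis .
  qed
  then show ?thesis using that \<rho> c by blast
qed

end

section \<open>Return sets and their correlations\<close>

text \<open>
  All the exponential estimates with a common constant and a common rate.
\<close>

locale regular_map = decaying_map +
  fixes c \<rho> :: real
  assumes \<rho>: "0 < \<rho>" "\<rho> < 1" and c_nonneg: "0 \<le> c"
    and mixing: "set u \<subseteq> {..<N} \<Longrightarrow> set w \<subseteq> {..<N} \<Longrightarrow>
       \<bar>(\<Sum>v\<in>words N m. p (u @ v @ w)) - p u * p w\<bar> \<le> c * \<rho> ^ m * (p u * p w)"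
    and outer_\<rho>: "(\<Sum>w\<in>outer n a b. p w) \<le> prob (J a b) + c * \<rho> ^ n"
    and inner_\<rho>: "prob (J a b) - c * \<rho> ^ n \<le> (\<Sum>w\<in>inner n a b. p w)"
    and short_\<rho>: "b - a \<le> 4 * (1 / 3) ^ n \<Longrightarrow> prob (J a b) \<le> c * \<rho> ^ n"
begin

lemma \<rho>_power: "0 < \<rho> ^ n" "\<rho> ^ n \<le> 1"
  using \<rho> by (auto simp: power_le_one)

lemma unit_ball_J: "unit_ball x r = J (x - r) (x + r)"
  by (auto simp: unit_ball_def J_def dist_real_def)

lemma mem_unit_ball: "z \<in> unit_ball x r \<longleftrightarrow> \<bar>z - x\<bar> < r \<and> z \<in> {0..1}"
  by (auto simp: unit_ball_def dist_real_def)

lemma unit_ball_measurable: "unit_ball x r \<in> sets \<mu>"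
  by (simp add: unit_ball_J J_measurable)

definition F :: "real \<Rightarrow> real \<Rightarrow> real" where "F x r = prob (unit_ball x r)"

lemma F_mono: "r \<le> s \<Longrightarrow> F x r \<le> F x s"
  unfolding F_def by (intro finite_measure_mono unit_ball_measurable) (auto simp: mem_unit_ball)

text \<open>
  The two annulus pieces are half-open, so each is covered by an open interval of twice its length;
  hence the factor 4 in \<open>short_\<rho>\<close>.
\<close>

lemma F_modulus:
  assumes "s \<le> r + 2 * (1 / 3) ^ n"
  shows "F x s \<le> F x r + 2 * c * \<rho> ^ n"
proof -
  let ?d = "4 * (1 / 3) ^ n :: real"
  have d: "0 < (1 / 3 :: real) ^ n" by simp
  have "unit_ball x s \<subseteq> (unit_ball x r \<union> J (x - s) (x - s + ?d)) \<union> J (x + s - ?d) (x + s)"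
  proof
    fix y assume y: "y \<in> unit_ball x s"
    then have *: "\<bar>y - x\<bar> < s" "y \<in> {0..1}" by (auto simp: mem_unit_ball)
    show "y \<in> (unit_ball x r \<union> J (x - s) (x - s + ?d)) \<union> J (x + s - ?d) (x + s)"
    proof (cases "\<bar>y - x\<bar> < r")
      case True then show ?thesis using * by (simp add: mem_unit_ball)
    next
      case False
      then have "x - s < y \<and> y < x - s + ?d \<or> x + s - ?d < y \<and> y < x + s"
        using * assms d by linarith
      then show ?thesis using *(2) by (auto simp: J_def simp del: atLeastAtMost_iff)
    qed
  qed
  then have "F x s \<le> prob ((unit_ball x r \<union> J (x - s) (x - s + ?d)) \<union> J (x + s - ?d) (x + s))"
    unfolding F_def by (intro finite_measure_mono sets.Un unit_ball_measurable J_measurable)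
  also have "\<dots> \<le> prob (unit_ball x r \<union> J (x - s) (x - s + ?d)) + prob (J (x + s - ?d) (x + s))"
    by (intro measure_Un_le sets.Un unit_ball_measurable J_measurable)
  also have "prob (unit_ball x r \<union> J (x - s) (x - s + ?d)) \<le> F x r + prob (J (x - s) (x - s + ?d))"
    unfolding F_def by (intro measure_Un_le unit_ball_measurable J_measurable)
  finally show ?thesis
    using short_\<rho>[of "x - s + ?d" "x - s" n] short_\<rho>[of "x + s" "x + s - ?d" n] by simp
qed

lemma F_continuous: "continuous_on UNIV (F x)"
  unfolding continuous_on_iff
proof (intro ballI allI impI)
  fix r e :: real assume e: "e > 0"
  have "(\<lambda>n. 2 * c * \<rho> ^ n) \<longlonglongrightarrow> 0"
    using \<rho> by (intro tendsto_mult_right_zero LIMSEQ_power_zero) auto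
  then obtain n where n: "2 * c * \<rho> ^ n < e"
    using order_tendstoD(2)[of _ 0 sequentially e] e by (auto simp: eventually_sequentially)
  have "dist (F x s) (F x r) < e" if "dist s r < 2 * (1 / 3) ^ n" for s
  proof -
    have "s \<le> r + 2 * (1 / 3) ^ n" "r \<le> s + 2 * (1 / 3) ^ n" using that by (auto simp: dist_real_def)
    from F_modulus[OF this(1), of x] F_modulus[OF this(2), of x] n show ?thesis
      unfolding dist_real_def by linarith
  qed
  then show "\<exists>d>0. \<forall>s\<in>UNIV. dist s r < d \<longrightarrow> dist (F x s) (F x r) < e"
    by (intro exI[of _ "2 * (1 / 3) ^ n"]) auto
qed

lemma radius_le: "0 \<le> r \<Longrightarrow> a \<le> F x r \<Longrightarrow> radius \<mu> a x \<le> r"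
  unfolding radius_def F_def by (intro cInf_lower) (auto intro!: bdd_belowI[of _ 0])

lemma F_2: "x \<in> {0..1} \<Longrightarrow> F x 2 = 1"
proof -
  assume "x \<in> {0..1}"
  then have "unit_ball x 2 = space \<mu>" by (auto simp: mem_unit_ball space_mu)
  then show ?thesis by (simp add: F_def prob_space)
qed

lemma F_0: "F x 0 = 0"
  by (simp add: F_def unit_ball_def)

text \<open>
  There are no atoms, so the measure of a ball depends continuously on its radius and the infimum
  in the definition of the radius is attained with equality.
\<close>

lemma radius_attained:
  assumes x: "x \<in> {0..1}" and a: "a \<in> {0..1}"
  shows "0 \<le> radius \<mu> a x" "F x (radius \<mu> a x) = a"
proof -
  let ?S = "{r. 0 \<le> r \<and> a \<le> F x r}"
  have "\<exists>r\<ge>0. r \<le> 2 \<and> F x r = a"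
    using a F_0 F_2[OF x] continuous_on_subset[OF F_continuous] by (intro IVT') auto
  then obtain r where r: "0 \<le> r" "F x r = a" by blast
  have "closed ?S"
    by (intro closed_Collect_conj closed_Collect_le continuous_intros F_continuous)
  moreover have "?S \<noteq> {}" using r by auto
  moreover have "bdd_below ?S" by (auto intro!: bdd_belowI[of _ 0])
  ultimately have "Inf ?S \<in> ?S" by (intro closed_contains_Inf)
  then have R: "0 \<le> radius \<mu> a x" "a \<le> F x (radius \<mu> a x)"
    by (simp_all add: radius_def F_def)
  have "F x (radius \<mu> a x) \<le> F x r" using r by (intro F_mono radius_le) auto
  with R r show "0 \<le> radius \<mu> a x" "F x (radius \<mu> a x) = a" by auto
qed

text \<open>The ball around \<open>x\<close> is contained in the ball around \<open>y\<close> enlarged by the distance.\<close>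

lemma radius_Lipschitz:
  assumes x: "x \<in> {0..1}" and y: "y \<in> {0..1}" and a: "a \<in> {0..1}"
  shows "radius \<mu> a y \<le> radius \<mu> a x + \<bar>x - y\<bar>"
proof (rule radius_le)
  have "F x (radius \<mu> a x) \<le> F y (radius \<mu> a x + \<bar>x - y\<bar>)"
    unfolding F_def by (intro finite_measure_mono unit_ball_measurable) (auto simp: mem_unit_ball)
  then show "a \<le> F y (radius \<mu> a x + \<bar>x - y\<bar>)" using radius_attained[OF x a] by simp
qed (use radius_attained[OF x a] in simp)

definition ret :: "real \<Rightarrow> nat \<Rightarrow> real set" where
  "ret a k = {x\<in>{0..1}. (T ^^ k) x \<in> unit_ball x (radius \<mu> a x)}"

lemma ret_measurable:
  assumes a: "a \<in> {0..1}"
  shows "ret a k \<in> sets \<mu>"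
proof -
  have "1-lipschitz_on {0..1} (radius \<mu> a)"
  proof (rule lipschitz_onI)
    fix x y :: real assume x: "x \<in> {0..1}" and y: "y \<in> {0..1}"
    show "dist (radius \<mu> a x) (radius \<mu> a y) \<le> 1 * dist x y"
      using radius_Lipschitz[OF x y a] radius_Lipschitz[OF y x a]
      unfolding dist_real_def mult_1_left abs_le_iff abs_minus_commute[of y x] by linarith
  qed simp
  then have "continuous_on {0..1} (radius \<mu> a)" by (rule lipschitz_on_continuous_on)
  then have "radius \<mu> a \<in> borel_measurable (restrict_space borel {0..1})"
    by (rule borel_measurable_continuous_on_restrict)
  moreover have sets: "sets \<mu> = sets (restrict_space borel {0..1})" using gibbs by (simp add: gibbs_measure_def)
  ultimately have [measurable]: "radius \<mu> a \<in> borel_measurable \<mu>" by (simp cong: measurable_cong_sets)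
  have id[measurable]: "(\<lambda>x. x) \<in> borel_measurable \<mu>"
  proof -
    have "(\<lambda>x::real. x) \<in> borel_measurable (restrict_space borel {0..1})" by (rule measurable_restrict_space1) simp
    then show ?thesis using sets by (simp cong: measurable_cong_sets)
  qed
  have [measurable]: "(T ^^ k) \<in> borel_measurable \<mu>"
    using measurable_compose[OF T_iter_measurable[of k] id] by (simp add: comp_def)
  have "ret a k = {x\<in>space \<mu>. \<bar>(T ^^ k) x - x\<bar> < radius \<mu> a x}"
    using T_iter_unit[of _ k] by (auto simp: ret_def mem_unit_ball space_mu)
  also have "\<dots> \<in> sets \<mu>" by measurable
  finally show ?thesis .
qed

text \<open>
  Mixing for the visit at time \<open>k\<close> of a union of cylinders, summed over the words that fill the gap
  between \<open>n\<close> and \<open>k\<close>.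
\<close>

lemma pullback:
  assumes u: "u \<in> words N n" and W: "W \<subseteq> words N q" and nk: "n \<le> k"
  shows "{x\<in>Z u. (T ^^ k) x \<in> (\<Union>w\<in>W. Z w)} \<in> sets \<mu>"
    "\<bar>prob {x\<in>Z u. (T ^^ k) x \<in> (\<Union>w\<in>W. Z w)} - p u * (\<Sum>w\<in>W. p w)\<bar>
       \<le> c * \<rho> ^ (k - n) * (p u * (\<Sum>w\<in>W. p w))"
proof -
  define V where "V = (\<lambda>(v, w). u @ v @ w) ` (words N (k - n) \<times> W)"
  have V: "V \<subseteq> words N (k + q)"
  proof (clarsimp simp: V_def)
    fix v w assume "v \<in> words N (k - n)" "w \<in> W"
    then have "u @ v @ w \<in> words N (n + ((k - n) + q))" using u W by (intro words_append) auto
    then show "u @ v @ w \<in> words N (k + q)" using nk by simp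
  qed
  have Tk: "(T ^^ (k - n)) ((T ^^ n) x) = (T ^^ k) x" for x
    using nk by (metis comp_apply funpow_add le_add_diff_inverse2)
  have mem: "x \<in> Z (u @ v @ w) \<longleftrightarrow> x \<in> Z u \<and> (T ^^ n) x \<in> Z v \<and> (T ^^ k) x \<in> Z w"
    if "v \<in> words N (k - n)" for x v w
    using u that by (simp add: cylinder_append words_def Tk)
  have eq: "{x\<in>Z u. (T ^^ k) x \<in> (\<Union>w\<in>W. Z w)} = (\<Union>w\<in>V. Z w)"
  proof (intro equalityI subsetI)
    fix x assume "x \<in> {x\<in>Z u. (T ^^ k) x \<in> (\<Union>w\<in>W. Z w)}"
    then obtain w where w: "x \<in> Z u" "w \<in> W" "(T ^^ k) x \<in> Z w" by auto
    obtain v where v: "v \<in> words N (k - n)" "(T ^^ n) x \<in> Z v"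
      using cylinder_cover[OF T_iter_unit[OF cylinder_unit[OF w(1)]]] by blast
    then have "x \<in> Z (u @ v @ w)" using mem w by blast
    then show "x \<in> (\<Union>w\<in>V. Z w)" using v w unfolding V_def by blast
  next
    fix x assume "x \<in> (\<Union>w\<in>V. Z w)"
    then obtain v w where "v \<in> words N (k - n)" "w \<in> W" "x \<in> Z (u @ v @ w)" by (auto simp: V_def)
    then show "x \<in> {x\<in>Z u. (T ^^ k) x \<in> (\<Union>w\<in>W. Z w)}" using mem by blast
  qed
  show "{x\<in>Z u. (T ^^ k) x \<in> (\<Union>w\<in>W. Z w)} \<in> sets \<mu>"
    unfolding eq by (rule measure_cylinder_union(1)[OF V])
  have inj: "inj_on (\<lambda>(v, w). u @ v @ w) (words N (k - n) \<times> W)"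
    by (auto simp: inj_on_def words_def)
  have us: "set u \<subseteq> {..<N}" using u by (simp add: words_def)
  have Ws: "set w \<subseteq> {..<N}" if "w \<in> W" for w using W that by (auto simp: words_def)
  have "prob {x\<in>Z u. (T ^^ k) x \<in> (\<Union>w\<in>W. Z w)} = (\<Sum>w\<in>V. p w)"
    unfolding eq by (rule measure_cylinder_union(2)[OF V])
  also have "\<dots> = (\<Sum>(v, w)\<in>words N (k - n) \<times> W. p (u @ v @ w))"
    unfolding V_def by (subst sum.reindex[OF inj]) (simp add: case_prod_beta' comp_def)
  also have "\<dots> = (\<Sum>w\<in>W. \<Sum>v\<in>words N (k - n). p (u @ v @ w))"
    by (subst sum.swap) (simp add: sum.cartesian_product)
  finally have m: "prob {x\<in>Z u. (T ^^ k) x \<in> (\<Union>w\<in>W. Z w)} - p u * (\<Sum>w\<in>W. p w) =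
     (\<Sum>w\<in>W. (\<Sum>v\<in>words N (k - n). p (u @ v @ w)) - p u * p w)"
    by (simp add: sum_subtractf sum_distrib_left)
  show "\<bar>prob {x\<in>Z u. (T ^^ k) x \<in> (\<Union>w\<in>W. Z w)} - p u * (\<Sum>w\<in>W. p w)\<bar>
       \<le> c * \<rho> ^ (k - n) * (p u * (\<Sum>w\<in>W. p w))"
  proof -
    have "\<bar>\<Sum>w\<in>W. (\<Sum>v\<in>words N (k - n). p (u @ v @ w)) - p u * p w\<bar> \<le> (\<Sum>w\<in>W. c * \<rho> ^ (k - n) * (p u * p w))"
      by (rule order_trans[OF sum_abs]) (intro sum_mono mixing us Ws)
    also have "\<dots> = c * \<rho> ^ (k - n) * (p u * (\<Sum>w\<in>W. p w))" by (simp add: sum_distrib_left)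
    finally show ?thesis by (simp only: m)
  qed
qed

text \<open>
  The centre moves by at most the diameter \<open>3 ^ (- n)\<close> of the cylinder, and so does the radius.
\<close>

lemma ball_between:
  assumes u: "u \<in> words N n" and x: "x \<in> Z u" and y: "y \<in> Z u" and a: "a \<in> {0..1}"
  shows "unit_ball y (radius \<mu> a y) \<subseteq> unit_ball x (radius \<mu> a x + 2 * (1 / 3) ^ n)"
    "unit_ball x (radius \<mu> a x - 2 * (1 / 3) ^ n) \<subseteq> unit_ball y (radius \<mu> a y)"
proof -
  note d = cylinder_diameter[OF u x y]
  note l1 = radius_Lipschitz[OF cylinder_unit[OF x] cylinder_unit[OF y] a]
  note l2 = radius_Lipschitz[OF cylinder_unit[OF y] cylinder_unit[OF x] a]
  have "\<bar>z - x\<bar> < radius \<mu> a x + 2 * (1 / 3) ^ n" if "\<bar>z - y\<bar> < radius \<mu> a y" for z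
    using that d l1 by linarith
  then show "unit_ball y (radius \<mu> a y) \<subseteq> unit_ball x (radius \<mu> a x + 2 * (1 / 3) ^ n)"
    by (auto simp: mem_unit_ball)
  have "\<bar>z - y\<bar> < radius \<mu> a y" if "\<bar>z - x\<bar> < radius \<mu> a x - 2 * (1 / 3) ^ n" for z
    using that d l2 by linarith
  then show "unit_ball x (radius \<mu> a x - 2 * (1 / 3) ^ n) \<subseteq> unit_ball y (radius \<mu> a y)"
    by (auto simp: mem_unit_ball)
qed

text \<open>
  Cylinders of level \<open>q\<close> that cover every ball centred in the cylinder of level \<open>n\<close> around \<open>x\<close>, and
  cylinders of level \<open>q\<close> contained in every such ball.
\<close>

definition upper_words where
  "upper_words a n q x = outer q (x - (radius \<mu> a x + 2 * (1 / 3) ^ n)) (x + (radius \<mu> a x + 2 * (1 / 3) ^ n))"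
definition lower_words where
  "lower_words a n q x = inner q (x - (radius \<mu> a x - 2 * (1 / 3) ^ n)) (x + (radius \<mu> a x - 2 * (1 / 3) ^ n))"

lemma upper_words: "upper_words a n q x \<subseteq> words N q" and lower_words: "lower_words a n q x \<subseteq> words N q"
  by (simp_all add: upper_words_def lower_words_def outer_words inner_words)

lemma upper_words_cover:
  assumes "u \<in> words N n" "x \<in> Z u" "y \<in> Z u" "a \<in> {0..1}" "z \<in> unit_ball y (radius \<mu> a y)"
  shows "\<exists>w\<in>upper_words a n q x. z \<in> Z w"
  unfolding upper_words_def
  by (rule outer_covers) (use ball_between(1)[OF assms(1-4)] assms(5) in \<open>auto simp: unit_ball_J[symmetric]\<close>)

lemma lower_words_inside:
  assumes "u \<in> words N n" "x \<in> Z u" "y \<in> Z u" "a \<in> {0..1}" "w \<in> lower_words a n q x" "z \<in> Z w"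
  shows "z \<in> unit_ball y (radius \<mu> a y)"
  using ball_between(2)[OF assms(1-4)] assms(5,6)
  by (auto simp: lower_words_def inner_def unit_ball_J[symmetric])

lemma upper_words_measure:
  assumes "x \<in> {0..1}" "a \<in> {0..1}"
  shows "(\<Sum>w\<in>upper_words a n q x. p w) \<le> a + 2 * c * \<rho> ^ n + c * \<rho> ^ q"
proof -
  let ?r = "radius \<mu> a x"
  have "(\<Sum>w\<in>upper_words a n q x. p w) \<le> F x (?r + 2 * (1 / 3) ^ n) + c * \<rho> ^ q"
    unfolding upper_words_def F_def unit_ball_J by (rule outer_\<rho>)
  also have "F x (?r + 2 * (1 / 3) ^ n) \<le> F x ?r + 2 * c * \<rho> ^ n" by (rule F_modulus) simp
  finally show ?thesis using radius_attained(2)[OF assms] by simp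
qed

lemma lower_words_measure:
  assumes "x \<in> {0..1}" "a \<in> {0..1}"
  shows "a - 2 * c * \<rho> ^ n - c * \<rho> ^ q \<le> (\<Sum>w\<in>lower_words a n q x. p w)"
proof -
  let ?r = "radius \<mu> a x"
  have "F x ?r \<le> F x (?r - 2 * (1 / 3) ^ n) + 2 * c * \<rho> ^ n" by (rule F_modulus) simp
  moreover have "F x (?r - 2 * (1 / 3) ^ n) - c * \<rho> ^ q \<le> (\<Sum>w\<in>lower_words a n q x. p w)"
    unfolding lower_words_def F_def unit_ball_J by (rule inner_\<rho>)
  ultimately show ?thesis using radius_attained(2)[OF assms] by linarith
qed

lemma word_sum_le_1: "W \<subseteq> words N q \<Longrightarrow> (\<Sum>w\<in>W. p w) \<le> 1"
  using measure_cylinder_union(2)[of W q] by (metis prob_le_1)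

lemma sum_p_words: "(\<Sum>u\<in>words N n. p u) = 1"
  using measure_split_cylinders[of "{0..1}" n] prob_space cylinder_subset
  by (simp add: p_def space_mu sets_mu_iff Int_absorb1)

text \<open>
  Cylinders of level \<open>k div 2\<close> leave a gap of length \<open>k / 2\<close> for mixing and fix the ball up to
  \<open>O(\<rho> ^ (k / 2))\<close>.
\<close>

lemma ret_probability:
  assumes a: "a \<in> {0..1}"
  shows "\<bar>prob (ret a k) - a\<bar> \<le> (4 * c + 3 * c\<^sup>2) * \<rho> ^ (k div 2)"
proof -
  define n where "n = k div 2"
  define X where "X = \<rho> ^ n"
  have X: "0 < X" "X \<le> 1" using \<rho>_power by (auto simp: X_def)
  have nk: "n \<le> k" by (simp add: n_def)
  have Xk: "\<rho> ^ (k - n) \<le> X" unfolding X_def n_def using \<rho> by (intro power_decreasing) auto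
  have a01: "0 \<le> a" "a \<le> 1" using a by auto
  have bounds: "p u * (a - (4 * c + 3 * c\<^sup>2) * X) \<le> prob (ret a k \<inter> Z u) \<and>
      prob (ret a k \<inter> Z u) \<le> p u * (a + (4 * c + 3 * c\<^sup>2) * X)" if u: "u \<in> words N n" for u
  proof -
    have us: "set u \<subseteq> {..<N}" using u by (simp add: words_def)
    define x where "x = pt u"
    have x: "x \<in> Z u" using pt_in[OF us] by (simp add: x_def)
    have x01: "x \<in> {0..1}" using cylinder_unit[OF x] .
    let ?U = "upper_words a n n x" and ?V = "lower_words a n n x"
    note pbU = pullback[OF u upper_words[of a n n x] nk] and pbV = pullback[OF u lower_words[of a n n x] nk]
    have "ret a k \<inter> Z u \<subseteq> {y\<in>Z u. (T ^^ k) y \<in> (\<Union>w\<in>?U. Z w)}"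
      using upper_words_cover[OF u x _ a, where q=n] by (auto simp: ret_def)
    then have "prob (ret a k \<inter> Z u) \<le> prob {y\<in>Z u. (T ^^ k) y \<in> (\<Union>w\<in>?U. Z w)}"
      by (rule finite_measure_mono) (rule pbU(1))
    also have "\<dots> \<le> (1 + c * \<rho> ^ (k - n)) * (p u * (\<Sum>w\<in>?U. p w))"
      using pbU(2) by (simp add: abs_le_iff algebra_simps)
    also have "\<dots> \<le> (1 + c * X) * (p u * (a + 3 * c * X))"
      using Xk c_nonneg p_nonneg upper_words_measure[OF x01 a, of n n] X less_imp_le[OF \<rho>_power(1)[of "k - n"]]
      by (intro mult_mono add_mono mult_nonneg_nonneg sum_nonneg) (auto simp: X_def)
    also have "\<dots> = p u * (a + (3 * c + c * a) * X + 3 * c\<^sup>2 * (X * X))"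
      by (simp add: algebra_simps power2_eq_square)
    also have "\<dots> \<le> p u * (a + (3 * c + c * 1) * X + 3 * c\<^sup>2 * (X * 1))"
      using X a01 c_nonneg p_nonneg by (intro mult_left_mono add_mono mult_right_mono) auto
    finally have up: "prob (ret a k \<inter> Z u) \<le> p u * (a + (4 * c + 3 * c\<^sup>2) * X)"
      by (simp add: algebra_simps)
    have "p u * (a - (4 * c + 3 * c\<^sup>2) * X) \<le> p u * (a - 3 * c * X - c * X)"
      using X c_nonneg p_nonneg by (intro mult_left_mono) (auto simp: algebra_simps)
    also have "\<dots> \<le> p u * ((\<Sum>w\<in>?V. p w) - c * X * 1)"
      using lower_words_measure[OF x01 a, of n n] p_nonneg by (intro mult_left_mono) (auto simp: X_def)
    also have "\<dots> \<le> p u * ((\<Sum>w\<in>?V. p w) - c * \<rho> ^ (k - n) * (\<Sum>w\<in>?V. p w))"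
      using word_sum_le_1[OF lower_words[of a n n x]] p_nonneg c_nonneg Xk X \<rho>_power[of "k - n"]
      by (intro mult_left_mono diff_mono order_refl mult_mono sum_nonneg mult_nonneg_nonneg) (auto intro: less_imp_le)
    also have "\<dots> \<le> prob {y\<in>Z u. (T ^^ k) y \<in> (\<Union>w\<in>?V. Z w)}"
      using pbV(2) by (simp add: abs_le_iff algebra_simps)
    also have "\<dots> \<le> prob (ret a k \<inter> Z u)"
    proof (rule finite_measure_mono)
      show "{y\<in>Z u. (T ^^ k) y \<in> (\<Union>w\<in>?V. Z w)} \<subseteq> ret a k \<inter> Z u"
        using lower_words_inside[OF u x _ a] cylinder_unit by (auto simp: ret_def)
      show "ret a k \<inter> Z u \<in> sets \<mu>" by (intro sets.Int ret_measurable a cylinder_measurable us)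
    qed
    finally show ?thesis using up by simp
  qed
  have tot: "prob (ret a k) = (\<Sum>u\<in>words N n. prob (ret a k \<inter> Z u))"
    by (rule measure_split_cylinders[OF ret_measurable[OF a]])
  have "prob (ret a k) \<le> (\<Sum>u\<in>words N n. p u * (a + (4 * c + 3 * c\<^sup>2) * X))"
    unfolding tot using bounds by (intro sum_mono) auto
  moreover have "(\<Sum>u\<in>words N n. p u * (a - (4 * c + 3 * c\<^sup>2) * X)) \<le> prob (ret a k)"
    unfolding tot using bounds by (intro sum_mono) auto
  ultimately show ?thesis
    by (simp add: sum_distrib_right[symmetric] sum_p_words abs_le_iff X_def n_def)
qed

text \<open>
  A word of length \<open>m = j + (k - j) div 2\<close> is split as \<open>u @ v @ w\<close>, where \<open>u\<close> has length \<open>j div 2\<close> and \<open>w\<close>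
  codes the orbit from time \<open>j\<close> on. The return at time \<open>j\<close> forces \<open>w\<close> into a set that depends on
  \<open>u\<close> only; the return at time \<open>k\<close> is a visit that is nearly independent of the whole word. Refining
  up to level \<open>m\<close> matters: it makes the error for the second ball exponentially small in \<open>k\<close>
  rather than in \<open>j\<close>, so that it stays summable over all pairs.
\<close>

lemma double_ret_probability:
  assumes a: "a \<in> {0..1}" and b: "b \<in> {0..1}" and jk: "j < k"
  shows "prob (ret a j \<inter> ret b k) \<le>
    (1 + c * \<rho> ^ (j div 2)) * (a + 2 * c * \<rho> ^ (j div 2) + c * \<rho> ^ ((k - j) div 2)) *
    ((1 + c * \<rho> ^ ((k - j) div 2)) * (b + 3 * c * \<rho> ^ (k div 2)))"
proof -
  define n where "n = j div 2"
  define e where "e = (k - j) div 2"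
  define m where "m = n + ((j - n) + e)"
  have nj: "n \<le> j" and mj: "m = j + e" and mk: "m \<le> k" "e \<le> k - m" "k div 2 \<le> m"
    using jk by (auto simp: n_def e_def m_def)
  have a01: "0 \<le> a" "a \<le> 1" and b01: "0 \<le> b" "b \<le> 1" using a b by auto
  define Q where "Q = (1 + c * \<rho> ^ e) * (b + 3 * c * \<rho> ^ (k div 2))"
  have Q: "0 \<le> Q" unfolding Q_def using c_nonneg b01 \<rho> by auto
  define O' where "O' u = upper_words a n e (pt u)" for u
  have fin: "finite (O' u)" for u unfolding O'_def by (rule finite_subset[OF upper_words]) simp
  have piece: "prob ((ret a j \<inter> ret b k) \<inter> Z (u @ (v @ w))) \<le> (if w \<in> O' u then Q * p (u @ v @ w) else 0)"
    if u: "u \<in> words N n" and v: "v \<in> words N (j - n)" and w: "w \<in> words N e" for u v w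
  proof -
    let ?y = "u @ (v @ w)"
    have us: "set u \<subseteq> {..<N}" using u by (simp add: words_def)
    have y: "?y \<in> words N m" unfolding m_def by (intro words_append u v w)
    have ys: "set ?y \<subseteq> {..<N}" using y by (simp add: words_def)
    have Tj: "(T ^^ (j - n)) ((T ^^ n) x) = (T ^^ j) x" for x
      using nj by (metis comp_apply funpow_add le_add_diff_inverse2)
    show ?thesis
    proof (cases "w \<in> O' u")
      case False
      have "(ret a j \<inter> ret b k) \<inter> Z ?y = {}"
      proof (rule ccontr)
        assume "(ret a j \<inter> ret b k) \<inter> Z ?y \<noteq> {}"
        then obtain x where x: "x \<in> ret a j" "x \<in> Z ?y" by blast
        have xu: "x \<in> Z u" and xw: "(T ^^ j) x \<in> Z w"
          using x(2) u v by (simp_all add: cylinder_append words_def Tj)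
        have "(T ^^ j) x \<in> unit_ball x (radius \<mu> a x)" using x(1) by (simp add: ret_def)
        then obtain w' where w': "w' \<in> O' u" "(T ^^ j) x \<in> Z w'"
          using upper_words_cover[OF u pt_in[OF us] xu a] unfolding O'_def by blast
        have "w' \<in> words N e" using w'(1) upper_words unfolding O'_def by blast
        from cylinder_disjoint[OF this w w'(2) xw] w' False show False by simp
      qed
      then show ?thesis using False by simp
    next
      case True
      define x where "x = pt ?y"
      have x: "x \<in> Z ?y" using pt_in[OF ys] by (simp add: x_def)
      let ?U = "upper_words b m m x"
      note pb = pullback[OF y upper_words[of b m m x] mk(1)]
      have "(ret a j \<inter> ret b k) \<inter> Z ?y \<subseteq> {z\<in>Z ?y. (T ^^ k) z \<in> (\<Union>w\<in>?U. Z w)}"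
        using upper_words_cover[OF y x _ b, where q=m] by (auto simp: ret_def)
      then have "prob ((ret a j \<inter> ret b k) \<inter> Z ?y) \<le> prob {z\<in>Z ?y. (T ^^ k) z \<in> (\<Union>w\<in>?U. Z w)}"
        by (rule finite_measure_mono) (rule pb(1))
      also have "\<dots> \<le> (1 + c * \<rho> ^ (k - m)) * (p ?y * (\<Sum>w\<in>?U. p w))"
        using pb(2) by (simp add: abs_le_iff algebra_simps)
      also have "\<dots> \<le> (1 + c * \<rho> ^ e) * (p ?y * (b + 3 * c * \<rho> ^ (k div 2)))"
      proof (intro mult_mono add_mono order_refl)
        show "\<rho> ^ (k - m) \<le> \<rho> ^ e" using mk \<rho> by (intro power_decreasing) auto
        have "(\<Sum>w\<in>?U. p w) \<le> b + 3 * c * \<rho> ^ m"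
          using upper_words_measure[OF cylinder_unit[OF x] b, of m m] by simp
        also have "\<dots> \<le> b + 3 * c * \<rho> ^ (k div 2)"
          using mk \<rho> c_nonneg by (intro add_left_mono mult_left_mono power_decreasing) auto
        finally show "(\<Sum>w\<in>?U. p w) \<le> b + 3 * c * \<rho> ^ (k div 2)" .
      qed (use c_nonneg p_nonneg \<rho> in \<open>auto intro!: sum_nonneg mult_nonneg_nonneg\<close>)
      also have "\<dots> = Q * p ?y" by (simp add: Q_def)
      finally show ?thesis using True by simp
    qed
  qed
  have inner_sum: "(\<Sum>v\<in>words N (j - n). \<Sum>w\<in>words N e. if w \<in> O' u then Q * p (u @ v @ w) else 0)
      \<le> Q * ((1 + c * \<rho> ^ n) * (a + 2 * c * \<rho> ^ n + c * \<rho> ^ e)) * p u" if u: "u \<in> words N n" for u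
  proof -
    have us: "set u \<subseteq> {..<N}" using u by (simp add: words_def)
    have O'w: "O' u \<subseteq> words N e" unfolding O'_def by (rule upper_words)
    have "(\<Sum>v\<in>words N (j - n). \<Sum>w\<in>words N e. if w \<in> O' u then Q * p (u @ v @ w) else 0)
       = (\<Sum>v\<in>words N (j - n). \<Sum>w\<in>O' u. Q * p (u @ v @ w))"
    proof -
      have "(\<Sum>w\<in>words N e. if w \<in> O' u then f w else 0) = (\<Sum>w\<in>O' u. f w)" for f :: "nat list \<Rightarrow> real"
        by (simp add: sum.inter_restrict[symmetric] Int_absorb1[OF O'w])
      then show ?thesis by simp
    qed
    also have "\<dots> = Q * (\<Sum>w\<in>O' u. \<Sum>v\<in>words N (j - n). p (u @ v @ w))"
      by (subst sum.swap) (simp add: sum_distrib_left)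
    also have "\<dots> \<le> Q * (\<Sum>w\<in>O' u. (1 + c * \<rho> ^ n) * (p u * p w))"
    proof (intro mult_left_mono sum_mono Q)
      fix w assume "w \<in> O' u"
      then have ws: "set w \<subseteq> {..<N}" using O'w by (auto simp: words_def)
      have "(\<Sum>v\<in>words N (j - n). p (u @ v @ w)) \<le> (1 + c * \<rho> ^ (j - n)) * (p u * p w)"
        using mixing[OF us ws, of "j - n"] by (simp add: abs_le_iff algebra_simps)
      also have "\<dots> \<le> (1 + c * \<rho> ^ n) * (p u * p w)"
        using p_nonneg c_nonneg \<rho>
        by (intro mult_right_mono add_left_mono mult_left_mono power_decreasing) (auto simp: n_def)
      finally show "(\<Sum>v\<in>words N (j - n). p (u @ v @ w)) \<le> (1 + c * \<rho> ^ n) * (p u * p w)" .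
    qed
    also have "\<dots> = Q * ((1 + c * \<rho> ^ n) * (\<Sum>w\<in>O' u. p w)) * p u"
      by (simp add: sum_distrib_left sum_distrib_right mult_ac)
    also have "\<dots> \<le> Q * ((1 + c * \<rho> ^ n) * (a + 2 * c * \<rho> ^ n + c * \<rho> ^ e)) * p u"
      unfolding O'_def
      using upper_words_measure[OF cylinder_unit[OF pt_in[OF us]] a, of n e] Q c_nonneg \<rho> p_nonneg
      by (intro mult_right_mono mult_left_mono) auto
    finally show ?thesis .
  qed
  have "prob (ret a j \<inter> ret b k) = (\<Sum>y\<in>words N m. prob ((ret a j \<inter> ret b k) \<inter> Z y))"
    by (intro measure_split_cylinders sets.Int ret_measurable a b)
  also have "\<dots> = (\<Sum>u\<in>words N n. \<Sum>v\<in>words N (j - n). \<Sum>w\<in>words N e. prob ((ret a j \<inter> ret b k) \<inter> Z (u @ (v @ w))))"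
    unfolding m_def by (simp only: sum_words_append)
  also have "\<dots> \<le> (\<Sum>u\<in>words N n. \<Sum>v\<in>words N (j - n). \<Sum>w\<in>words N e. if w \<in> O' u then Q * p (u @ v @ w) else 0)"
    by (intro sum_mono piece)
  also have "\<dots> \<le> (\<Sum>u\<in>words N n. Q * ((1 + c * \<rho> ^ n) * (a + 2 * c * \<rho> ^ n + c * \<rho> ^ e)) * p u)"
    by (intro sum_mono inner_sum)
  also have "\<dots> = (1 + c * \<rho> ^ n) * (a + 2 * c * \<rho> ^ n + c * \<rho> ^ e) * Q"
    by (simp add: sum_distrib_left[symmetric] sum_p_words)
  finally show ?thesis by (simp add: Q_def n_def e_def)
qed

lemma ret_correlations:
  obtains B \<sigma> where "0 < \<sigma>" "\<sigma> < 1" "0 \<le> B"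
    "\<And>a k. a \<in> {0..1} \<Longrightarrow> \<bar>prob (ret a k) - a\<bar> \<le> B * \<sigma> ^ k"
    "\<And>a b j k. a \<in> {0..1} \<Longrightarrow> b \<in> {0..1} \<Longrightarrow> j < k \<Longrightarrow>
       prob (ret a j \<inter> ret b k) \<le> a * b + B * (\<sigma> ^ j + \<sigma> ^ (k - j)) * b + B * \<sigma> ^ k"
proof -
  define \<sigma> where "\<sigma> = sqrt \<rho>"
  have \<sigma>: "0 < \<sigma>" "\<sigma> < 1" "\<sigma>\<^sup>2 = \<rho>" using \<rho> by (auto simp: \<sigma>_def)
  have half: "\<rho> ^ (i div 2) \<le> \<sigma> ^ i / \<sigma>" for i
  proof -
    have "\<rho> ^ (i div 2) * \<sigma> = \<sigma> ^ (2 * (i div 2) + 1)" by (simp add: \<sigma>(3)[symmetric] power_mult[symmetric] mult.commute)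
    also have "\<dots> \<le> \<sigma> ^ i" using \<sigma> by (intro power_decreasing) auto
    finally show ?thesis using \<sigma> by (simp add: le_divide_eq)
  qed
  \<comment> \<open>Collects the coefficients in the expansion of the product of the first three factors below.\<close>
  define E where "E = 5 * c + 8 * c\<^sup>2 + 3 * c ^ 3"
  define B where "B = max (4 * c + 3 * c\<^sup>2) (max E ((1 + 2 * E) * (3 * c))) / \<sigma>"
  have E: "0 \<le> E" using c_nonneg by (simp add: E_def)
  have B1: "4 * c + 3 * c\<^sup>2 \<le> B * \<sigma>" "E \<le> B * \<sigma>" "(1 + 2 * E) * (3 * c) \<le> B * \<sigma>"
    using \<sigma> by (auto simp: B_def)
  then have B: "0 \<le> B" using E \<sigma> by (metis order_trans zero_le_mult_iff not_less order_less_le)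
  have scale: "C' * \<rho> ^ (i div 2) \<le> B * \<sigma> ^ i" if "C' \<le> B * \<sigma>" "0 \<le> C'" for C' i
  proof -
    have "C' * \<rho> ^ (i div 2) \<le> (B * \<sigma>) * (\<sigma> ^ i / \<sigma>)"
      using that half[of i] \<rho> by (intro mult_mono) auto
    then show ?thesis using \<sigma> by simp
  qed
  show ?thesis
  proof (rule that[OF \<sigma>(1,2) B])
    fix a :: real and k assume "a \<in> {0..1}"
    from ret_probability[OF this, of k] scale[OF B1(1), of k] c_nonneg
    show "\<bar>prob (ret a k) - a\<bar> \<le> B * \<sigma> ^ k" by simp
  next
    fix a b :: real and j k :: nat assume a: "a \<in> {0..1}" and b: "b \<in> {0..1}" and jk: "j < k"
    define X Y H where "X = \<rho> ^ (j div 2)" and "Y = \<rho> ^ ((k - j) div 2)" and "H = \<rho> ^ (k div 2)"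
    have X: "0 \<le> X" "X \<le> 1" and Y: "0 \<le> Y" "Y \<le> 1" and H: "0 \<le> H"
      using \<rho>_power by (auto simp: X_def Y_def H_def intro: less_imp_le)
    have a01: "0 \<le> a" "a \<le> 1" and b01: "0 \<le> b" "b \<le> 1" using a b by auto
    have XY: "X * Y \<le> X" "X * X \<le> X" "Y * Y \<le> Y" "X * Y \<le> Y" "X * (X * Y) \<le> X" "X * (Y * Y) \<le> X"
      using X Y by (auto intro!: mult_left_le mult_le_one mult_left_le_one_le)
    have "(1 + c * X) * (a + 2 * c * X + c * Y) * (1 + c * Y) \<le> a + E * (X + Y)"
    proof -
      have "(1 + c * X) * (a + 2 * c * X + c * Y) * (1 + c * Y) =
        a + a * (c * (X + Y)) + a * (c\<^sup>2 * (X * Y)) + 2 * c * X + c * Y + 2 * c\<^sup>2 * (X * Y) + c\<^sup>2 * (Y * Y)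
        + 2 * c\<^sup>2 * (X * X) + c\<^sup>2 * (X * Y) + 2 * c ^ 3 * (X * (X * Y)) + c ^ 3 * (X * (Y * Y))"
        by (simp add: algebra_simps power2_eq_square power3_eq_cube)
      also have "\<dots> \<le> a + 1 * (c * (X + Y)) + 1 * (c\<^sup>2 * X) + 2 * c * X + c * Y + 2 * c\<^sup>2 * X + c\<^sup>2 * Y
        + 2 * c\<^sup>2 * X + c\<^sup>2 * X + 2 * c ^ 3 * X + c ^ 3 * X"
        using XY X Y a01 c_nonneg by (intro add_mono mult_mono) auto
      also have "\<dots> \<le> a + E * (X + Y)"
        using c_nonneg X Y by (simp add: E_def algebra_simps add_mono)
      finally show ?thesis .
    qed
    then have "(1 + c * X) * (a + 2 * c * X + c * Y) * (1 + c * Y) * (b + 3 * c * H) \<le> (a + E * (X + Y)) * (b + 3 * c * H)"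
      using b01 c_nonneg H by (intro mult_right_mono) auto
    also have "\<dots> = a * b + E * X * b + E * Y * b + (a + E * (X + Y)) * (3 * c * H)" by (simp add: algebra_simps)
    also have "\<dots> \<le> a * b + (B * \<sigma> ^ j) * b + (B * \<sigma> ^ (k - j)) * b + B * \<sigma> ^ k"
    proof (intro add_mono mult_right_mono b01 order_refl)
      show "E * X \<le> B * \<sigma> ^ j" "E * Y \<le> B * \<sigma> ^ (k - j)"
        unfolding X_def Y_def by (intro scale B1 E)+
      have "(a + E * (X + Y)) * (3 * c * H) \<le> (1 + E * (1 + 1)) * (3 * c * H)"
        using a01 E X Y c_nonneg H by (intro mult_right_mono add_mono mult_left_mono) auto
      also have "\<dots> = ((1 + 2 * E) * (3 * c)) * H" by (simp add: algebra_simps)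
      also have "\<dots> \<le> B * \<sigma> ^ k" unfolding H_def using E c_nonneg by (intro scale B1) auto
      finally show "(a + E * (X + Y)) * (3 * c * H) \<le> B * \<sigma> ^ k" .
    qed
    finally show "prob (ret a j \<inter> ret b k) \<le> a * b + B * (\<sigma> ^ j + \<sigma> ^ (k - j)) * b + B * \<sigma> ^ k"
      using double_ret_probability[OF a b jk] by (simp add: X_def Y_def H_def algebra_simps)
  qed
qed

end

section \<open>A strong law from dyadic second moments\<close>

text \<open>
  The squared increments over the dyadic subintervals of \<open>{a..a + 2 ^ r}\<close> that are used when a point is
  located by bisection from the left.
\<close>

primrec dyadic_energy :: "(nat \<Rightarrow> real) \<Rightarrow> nat \<Rightarrow> nat \<Rightarrow> real" where
  "dyadic_energy S 0 a = (S (a + 1) - S a)\<^sup>2"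
| "dyadic_energy S (Suc r) a =
     dyadic_energy S r a + dyadic_energy S r (a + 2 ^ r) + (S (a + 2 ^ r) - S a)\<^sup>2"

lemma dyadic_energy_nonneg: "0 \<le> dyadic_energy S r a"
  by (induction r arbitrary: a) auto

text \<open>
  A point is reached from \<open>a\<close> by at most \<open>r + 1\<close> dyadic increments, so the bound is an instance of
  the Cauchy-Schwarz inequality.
\<close>

lemma increment_le_dyadic_energy:
  "j \<le> 2 ^ r \<Longrightarrow> (S (a + j) - S a)\<^sup>2 \<le> (real r + 1) * dyadic_energy S r a"
proof (induction r arbitrary: a j)
  case 0
  then have "j = 0 \<or> j = 1" by auto
  then show ?case by auto
next
  case (Suc r)
  let ?G = "dyadic_energy S r"
  let ?y = "S (a + 2 ^ r) - S a"
  show ?case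
  proof (cases "j \<le> 2 ^ r")
    case True
    have "(S (a + j) - S a)\<^sup>2 \<le> (real r + 1) * ?G a" by (rule Suc.IH[OF True])
    also have "\<dots> \<le> (real (Suc r) + 1) * dyadic_energy S (Suc r) a"
      using dyadic_energy_nonneg[of S r] by (intro mult_mono) (auto intro: add_nonneg_nonneg)
    finally show ?thesis .
  next
    case False
    define i where "i = j - 2 ^ r"
    have j: "j = 2 ^ r + i" "i \<le> 2 ^ r" using False Suc.prems by (auto simp: i_def)
    let ?x = "S (a + 2 ^ r + i) - S (a + 2 ^ r)"
    have IH: "?x\<^sup>2 \<le> (real r + 1) * ?G (a + 2 ^ r)" by (rule Suc.IH[OF j(2)])
    \<comment> \<open>Weighted square inequality \<open>(x + y)\<^sup>2 \<le> (1 + 1 / (r + 1)) x\<^sup>2 + (r + 2) y\<^sup>2\<close>.\<close>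
    have "0 \<le> (?x / (real r + 1) - ?y)\<^sup>2 * (real r + 1)" by simp
    also have "\<dots> = ?x\<^sup>2 / (real r + 1) + ?y\<^sup>2 * (real r + 1) - 2 * ?x * ?y"
    proof -
      have *: "(x / c - y)\<^sup>2 * c = x\<^sup>2 / c + y\<^sup>2 * c - 2 * x * y" if "c > 0" for x y c :: real
        using that by (simp add: power2_eq_square field_simps)
      show ?thesis by (rule *) simp
    qed
    finally have 1: "2 * ?x * ?y \<le> ?x\<^sup>2 / (real r + 1) + ?y\<^sup>2 * (real r + 1)" by simp
    have 2: "?x\<^sup>2 / (real r + 1) \<le> ?G (a + 2 ^ r)" using IH by (simp add: divide_le_eq mult.commute)
    have "(S (a + j) - S a)\<^sup>2 = (?x + ?y)\<^sup>2" by (simp add: j(1) add.assoc)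
    also have "\<dots> = ?x\<^sup>2 + ?y\<^sup>2 + 2 * ?x * ?y" by (rule power2_sum)
    also have "\<dots> \<le> (real r + 1) * ?G (a + 2 ^ r) + ?y\<^sup>2 + (?G (a + 2 ^ r) + ?y\<^sup>2 * (real r + 1))"
      using 1 2 IH by linarith
    also have "\<dots> = (real (Suc r) + 1) * (?G (a + 2 ^ r) + ?y\<^sup>2)" by (simp add: algebra_simps)
    also have "\<dots> \<le> (real (Suc r) + 1) * dyadic_energy S (Suc r) a"
      using dyadic_energy_nonneg[of S r a] by (intro mult_left_mono) auto
    finally show ?thesis .
  qed
qed

lemma (in prob_space) expectation_dyadic_energy:
  fixes S :: "nat \<Rightarrow> 'a \<Rightarrow> real"
  assumes int: "\<And>a b. integrable M (\<lambda>x. (S b x - S a x)\<^sup>2)"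
    and bound: "\<And>a b. a < b \<Longrightarrow> expectation (\<lambda>x. (S b x - S a x)\<^sup>2) \<le> K * real (b - a)"
  shows "integrable M (\<lambda>x. dyadic_energy (\<lambda>i. S i x) r a)"
    "expectation (\<lambda>x. dyadic_energy (\<lambda>i. S i x) r a) \<le> K * (real r + 1) * 2 ^ r"
proof -
  have "integrable M (\<lambda>x. dyadic_energy (\<lambda>i. S i x) r a) \<and>
    expectation (\<lambda>x. dyadic_energy (\<lambda>i. S i x) r a) \<le> K * (real r + 1) * 2 ^ r"
  proof (induction r arbitrary: a)
    case 0 show ?case using int bound[of a "a + 1"] by simp
  next
    case (Suc r)
    have "expectation (\<lambda>x. dyadic_energy (\<lambda>i. S i x) (Suc r) a) =
      expectation (\<lambda>x. dyadic_energy (\<lambda>i. S i x) r a) + expectation (\<lambda>x. dyadic_energy (\<lambda>i. S i x) r (a + 2 ^ r))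
      + expectation (\<lambda>x. (S (a + 2 ^ r) x - S a x)\<^sup>2)"
      using Suc int by simp
    also have "\<dots> \<le> K * (real r + 1) * 2 ^ r + K * (real r + 1) * 2 ^ r + K * real ((a + 2 ^ r) - a)"
      using Suc bound[of a "a + 2 ^ r"] by (intro add_mono) auto
    also have "\<dots> = K * (real r + 1) * 2 ^ Suc r + K * 2 ^ r" by simp
    also have "K * 2 ^ r \<le> K * 2 ^ Suc r"
    proof -
      have "0 \<le> expectation (\<lambda>x. (S 1 x - S 0 x)\<^sup>2)" by simp
      also have "\<dots> \<le> K" using bound[of 0 1] by simp
      finally show ?thesis by simp
    qed
    finally show ?case using Suc int by (simp add: algebra_simps)
  qed
  then show "integrable M (\<lambda>x. dyadic_energy (\<lambda>i. S i x) r a)"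
    "expectation (\<lambda>x. dyadic_energy (\<lambda>i. S i x) r a) \<le> K * (real r + 1) * 2 ^ r" by auto
qed

text \<open>
  Markov's inequality and the first Borel-Cantelli lemma; the bounds \<open>r powr (- 1 - 2 * \<epsilon>)\<close> are
  summable.
\<close>

lemma (in prob_space) dyadic_energy_AE:
  fixes S :: "nat \<Rightarrow> 'a \<Rightarrow> real"
  assumes int: "\<And>a b. integrable M (\<lambda>x. (S b x - S a x)\<^sup>2)"
    and bound: "\<And>a b. a < b \<Longrightarrow> expectation (\<lambda>x. (S b x - S a x)\<^sup>2) \<le> K * real (b - a)"
    and \<epsilon>: "0 < \<epsilon>"
  shows "AE x in M. eventually (\<lambda>r. dyadic_energy (\<lambda>i. S i x) r 0 \<le> real r powr (2 + 2 * \<epsilon>) * 2 ^ r) sequentially"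
proof -
  let ?G = "\<lambda>r x. dyadic_energy (\<lambda>i. S i x) r 0"
  note G = expectation_dyadic_energy[of S K, OF int bound, where a=0]
  define A where "A r = {x\<in>space M. real (Suc r) powr (2 + 2 * \<epsilon>) * 2 ^ Suc r \<le> ?G (Suc r) x}" for r
  have K: "0 \<le> K"
  proof -
    have "0 \<le> expectation (\<lambda>x. (S 1 x - S 0 x)\<^sup>2)" by simp
    also have "\<dots> \<le> K" using bound[of 0 1] by simp
    finally show ?thesis .
  qed
  have meas: "A r \<in> sets M" for r
    unfolding A_def using borel_measurable_integrable[OF G(1)[of "Suc r"]] by measurable
  have prob: "measure M (A r) \<le> 2 * K * real (Suc r) powr (- 1 - 2 * \<epsilon>)" for r
  proof -
    let ?c = "real (Suc r) powr (2 + 2 * \<epsilon>) * 2 ^ Suc r"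
    have c: "0 < ?c" by simp
    have "measure M (A r) \<le> expectation (?G (Suc r)) / ?c"
      unfolding A_def
      by (rule integral_Markov_inequality_measure[OF G(1) sets.empty_sets])
        (use dyadic_energy_nonneg c in auto)
    also have "\<dots> \<le> (K * (real (Suc r) + 1) * 2 ^ Suc r) / ?c"
      using G(2)[of "Suc r"] c by (intro divide_right_mono) auto
    also have "\<dots> = K * (real (Suc r) + 1) / real (Suc r) powr (2 + 2 * \<epsilon>)" by simp
    also have "\<dots> \<le> K * (2 * real (Suc r)) / real (Suc r) powr (2 + 2 * \<epsilon>)"
      using K by (intro divide_right_mono mult_left_mono) auto
    also have "\<dots> = 2 * K * (real (Suc r) powr 1 / real (Suc r) powr (2 + 2 * \<epsilon>))" by simp
    also have "real (Suc r) powr 1 / real (Suc r) powr (2 + 2 * \<epsilon>) = real (Suc r) powr (- 1 - 2 * \<epsilon>)"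
      by (simp only: powr_diff[symmetric]) (simp add: algebra_simps)
    finally show ?thesis .
  qed
  have "summable (\<lambda>r. real r powr (- 1 - 2 * \<epsilon>))" using \<epsilon> by (simp add: summable_real_powr_iff)
  then have "summable (\<lambda>r. real (Suc r) powr (- 1 - 2 * \<epsilon>))"
    by (subst summable_Suc_iff)
  then have "summable (\<lambda>r. 2 * K * real (Suc r) powr (- 1 - 2 * \<epsilon>))" by (rule summable_mult)
  then have "summable (\<lambda>r. measure M (A r))"
    by (rule summable_comparison_test[rotated]) (use prob in auto)
  then have "AE x in M. eventually (\<lambda>r. x \<in> space M - A r) sequentially"
    using meas by (intro borel_cantelli_AE1) (auto simp: emeasure_eq_measure)
  then show ?thesis
  proof (rule AE_mp, intro AE_I2 impI)
    fix x assume "x \<in> space M" and "eventually (\<lambda>r. x \<in> space M - A r) sequentially"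
    then have "eventually (\<lambda>r. ?G (Suc r) x \<le> real (Suc r) powr (2 + 2 * \<epsilon>) * 2 ^ Suc r) sequentially"
      by (elim eventually_mono) (auto simp: A_def)
    then show "eventually (\<lambda>r. ?G r x \<le> real r powr (2 + 2 * \<epsilon>) * 2 ^ r) sequentially"
      by (subst (asm) eventually_sequentially_Suc)
  qed
qed

text \<open>
  The dyadic decomposition is applied to the time scale \<open>\<Psi>\<close> given by the partial sums of the
  weights, since this is the scale in which variances grow linearly. Positivity of the weights
  makes \<open>\<Psi>\<close> injective, and their boundedness limits the overshoot at integer levels.
\<close>

locale increasing_clock =
  fixes w :: "nat \<Rightarrow> real" and b :: real
  assumes w_pos: "\<And>k. 1 \<le> k \<Longrightarrow> 0 < w k" and w_le: "\<And>k. 1 \<le> k \<Longrightarrow> w k \<le> b"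
    and clock_unbounded: "filterlim (\<lambda>n. \<Sum>k=1..n. w k) at_top sequentially"
begin

definition \<Psi> where "\<Psi> n = (\<Sum>k=1..n. w k)"

lemma \<Psi>_0: "\<Psi> 0 = 0" and \<Psi>_Suc: "\<Psi> (Suc n) = \<Psi> n + w (Suc n)"
  by (simp_all add: \<Psi>_def)

lemma \<Psi>_strict_mono: "strict_mono \<Psi>"
  by (intro strict_monoI_Suc) (simp add: \<Psi>_Suc w_pos)

lemma \<Psi>_le_iff: "\<Psi> m \<le> \<Psi> n \<longleftrightarrow> m \<le> n"
  using \<Psi>_strict_mono by (simp add: strict_mono_less_eq)

definition last_before :: "nat \<Rightarrow> nat" where "last_before j = Max {n. \<Psi> n \<le> real j}"

lemma finite_levels: "finite {n. \<Psi> n \<le> real j}"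
proof -
  have "eventually (\<lambda>n. real j + 1 \<le> \<Psi> n) sequentially"
    using clock_unbounded unfolding filterlim_at_top \<Psi>_def by blast
  then obtain n0 where "\<And>n. n \<ge> n0 \<Longrightarrow> real j + 1 \<le> \<Psi> n" by (auto simp: eventually_sequentially)
  then have "{n. \<Psi> n \<le> real j} \<subseteq> {..<n0}" by (force simp: not_less[symmetric])
  then show ?thesis by (rule finite_subset) simp
qed

lemma last_before: "\<Psi> n \<le> real j \<longleftrightarrow> n \<le> last_before j"
proof -
  have ne: "{n. \<Psi> n \<le> real j} \<noteq> {}" using \<Psi>_0 by (auto intro!: exI[of _ 0])
  have "last_before j \<in> {n. \<Psi> n \<le> real j}"
    unfolding last_before_def by (rule Max_in[OF finite_levels ne])
  then show ?thesis
    using Max_ge[OF finite_levels, of n j] \<Psi>_le_iff[of n "last_before j"]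
    by (auto simp: last_before_def intro: order_trans)
qed

lemma \<Psi>_last_before: "\<Psi> (last_before j) \<le> real j" "real j - b < \<Psi> (last_before j)"
proof -
  show "\<Psi> (last_before j) \<le> real j" by (simp add: last_before)
  have "real j < \<Psi> (Suc (last_before j))" using last_before[of "Suc (last_before j)" j] by linarith
  then show "real j - b < \<Psi> (last_before j)" using w_le[of "Suc (last_before j)"] by (simp add: \<Psi>_Suc)
qed

lemma last_before_mono: "i \<le> j \<Longrightarrow> last_before i \<le> last_before j"
  using \<Psi>_last_before(1)[of i] by (subst last_before[symmetric]) auto

lemma last_before_0: "last_before 0 = 0"
  using \<Psi>_last_before(1)[of 0] \<Psi>_le_iff[of "last_before 0" 0] by (simp add: \<Psi>_0)

end

text \<open>
  With \<open>2 ^ r\<close> of order \<open>x\<close>, the power \<open>r ^ (3 + 2 \<epsilon>)\<close> collects \<open>r\<close> from the Cauchy-Schwarz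
  inequality, and \<open>r ^ (2 + 2 \<epsilon>)\<close> from the energy.
\<close>

lemma polylog_bound:
  fixes x :: real
  assumes x: "4 \<le> x" and r: "2 ^ r \<le> 4 * x" and \<epsilon>: "0 < \<epsilon>"
    and s: "s\<^sup>2 \<le> (real r + 1) * (real r powr (2 + 2 * \<epsilon>) * 2 ^ r)"
  shows "\<bar>s\<bar> \<le> sqrt 8 * 3 powr (3 / 2 + \<epsilon>) * (x powr (1 / 2) * ln x powr (3 / 2 + \<epsilon>))"
proof (cases "r = 0")
  case True
  then have "s = 0" using s \<epsilon> by simp
  then show ?thesis by simp
next
  case False
  have lnx: "ln 4 \<le> ln x" "0 < ln x" using x by auto
  have ln2: "2 / 3 \<le> ln (2::real)" by (rule ln2_ge_two_thirds)
  have "real r * ln 2 = ln (2 ^ r)" by (simp add: ln_realpow)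
  also have "\<dots> \<le> ln (4 * x)" using r x by simp
  also have "\<dots> = ln 4 + ln x" using x by (simp add: ln_mult)
  also have "\<dots> \<le> 2 * ln x" using lnx by simp
  finally have "real r * (2 / 3) \<le> 2 * ln x" using ln2 mult_left_mono[of "2 / 3" "ln 2" "real r"] by linarith
  then have r3: "real r \<le> 3 * ln x" by linarith
  have "s\<^sup>2 \<le> (2 * real r) * (real r powr (2 + 2 * \<epsilon>) * 2 ^ r)"
    using False by (intro order_trans[OF s] mult_right_mono) auto
  also have "\<dots> = 2 * real r powr (3 + 2 * \<epsilon>) * 2 ^ r"
  proof -
    have "real r * real r powr (2 + 2 * \<epsilon>) = real r powr (3 + 2 * \<epsilon>)"
      using powr_mult_base[of "real r" "2 + 2 * \<epsilon>"] by simp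
    then show ?thesis by (simp only: mult.assoc[symmetric]) (simp add: mult_ac)
  qed
  also have "\<dots> \<le> 2 * (3 * ln x) powr (3 + 2 * \<epsilon>) * (4 * x)"
    using r3 r \<epsilon> x by (intro mult_mono powr_mono2) auto
  also have "\<dots> = (sqrt 8 * 3 powr (3 / 2 + \<epsilon>) * (x powr (1 / 2) * ln x powr (3 / 2 + \<epsilon>)))\<^sup>2"
  proof -
    have sq: "(y powr e)\<^sup>2 = y powr (2 * e)" if "0 < y" for y e :: real
      using that by (simp add: power2_eq_square powr_add[symmetric])
    have "3 + 2 * \<epsilon> = 2 * (3 / 2 + \<epsilon>)" by simp
    then have "2 * (3 * ln x) powr (3 + 2 * \<epsilon>) * (4 * x) = 8 * (3 powr (2 * (3 / 2 + \<epsilon>)) * ln x powr (2 * (3 / 2 + \<epsilon>))) * x powr (2 * (1 / 2))"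
      using lnx x by (simp add: powr_mult)
    also have "\<dots> = (sqrt 8)\<^sup>2 * ((3 powr (3 / 2 + \<epsilon>))\<^sup>2 * (ln x powr (3 / 2 + \<epsilon>))\<^sup>2) * (x powr (1 / 2))\<^sup>2"
      using lnx x by (simp only: sq) simp
    also have "\<dots> = (sqrt 8 * 3 powr (3 / 2 + \<epsilon>) * (x powr (1 / 2) * ln x powr (3 / 2 + \<epsilon>)))\<^sup>2"
      by (simp only: power_mult_distrib mult_ac)
    finally show ?thesis .
  qed
  finally have "\<bar>s\<bar> \<le> \<bar>sqrt 8 * 3 powr (3 / 2 + \<epsilon>) * (x powr (1 / 2) * ln x powr (3 / 2 + \<epsilon>))\<bar>"
    by (simp only: abs_le_square_iff)
  also have "\<dots> = sqrt 8 * 3 powr (3 / 2 + \<epsilon>) * (x powr (1 / 2) * ln x powr (3 / 2 + \<epsilon>))"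
    by (intro abs_of_nonneg mult_nonneg_nonneg) auto
  finally show ?thesis .
qed

text \<open>
  At integer levels of the clock the deviation is controlled by the dyadic energy. Between two
  consecutive levels both sums are monotone and the sum of the means grows by a bounded amount, so
  the deviation at any time is at most that at a neighbouring level plus a constant.
\<close>

theorem (in prob_space) Gal_Koksma:
  fixes X :: "nat \<Rightarrow> 'a \<Rightarrow> real" and m w :: "nat \<Rightarrow> real"
  assumes X: "\<And>k. X k \<in> borel_measurable M" "\<And>k x. 0 \<le> X k x" "\<And>k x. X k x \<le> 1"
    and m: "\<And>k. 1 \<le> k \<Longrightarrow> 0 \<le> m k" "\<And>k. 1 \<le> k \<Longrightarrow> m k \<le> w k"
    and clock: "increasing_clock w b"
    and variance: "\<And>s t. s < t \<Longrightarrow>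
      expectation (\<lambda>x. (\<Sum>k\<in>{s<..t}. X k x - m k)\<^sup>2) \<le> K * (\<Sum>k\<in>{s<..t}. w k)"
    and \<epsilon>: "0 < \<epsilon>"
  shows "AE x in M. \<exists>c. eventually (\<lambda>n. \<bar>(\<Sum>k=1..n. X k x) - (\<Sum>k=1..n. m k)\<bar>
      \<le> c * ((\<Sum>k=1..n. w k) powr (1 / 2) * ln (\<Sum>k=1..n. w k) powr (3 / 2 + \<epsilon>))) sequentially"
proof -
  interpret increasing_clock w b by (rule clock)
  define S where "S j x = (\<Sum>k=1..last_before j. X k x - m k)" for j x
  have b: "0 < b" using w_pos[of 1] w_le[of 1] by linarith
  have K: "0 \<le> K"
  proof -
    have "0 \<le> expectation (\<lambda>x. (\<Sum>k\<in>{0<..1}. X k x - m k)\<^sup>2)" by simp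
    also have "\<dots> \<le> K * (\<Sum>k\<in>{0<..1}. w k)" by (rule variance) simp
    also have "{0<..1::nat} = {1}" by auto
    also have "K * sum w {1} = K * w 1" by simp
    finally show ?thesis using w_pos[of 1] by (simp add: zero_le_mult_iff)
  qed
  have split: "(\<Sum>k=1..t. f k) - (\<Sum>k=1..s. f k) = (\<Sum>k\<in>{s<..t}. f k)" if "s \<le> t" for s t and f :: "nat \<Rightarrow> real"
  proof -
    have "{1..t} = {1..s} \<union> {s<..t}" using that by auto
    then have "sum f {1..t} = sum f ({1..s} \<union> {s<..t})" by (rule arg_cong)
    also have "\<dots> = sum f {1..s} + sum f {s<..t}" by (rule sum.union_disjoint) auto
    finally show ?thesis by simp
  qed
  have sum_bound: "\<bar>\<Sum>k\<in>I. X k x - m k\<bar> \<le> (\<Sum>k\<in>I. 1 + \<bar>m k\<bar>)" for I x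
  proof (rule order_trans[OF sum_abs], rule sum_mono)
    fix k show "\<bar>X k x - m k\<bar> \<le> 1 + \<bar>m k\<bar>" using X(2)[of k x] X(3)[of k x] by linarith
  qed
  have int: "integrable M (\<lambda>x. (S j x - S i x)\<^sup>2)" for i j
  proof (rule integrable_const_bound)
    show "AE x in M. norm ((S j x - S i x)\<^sup>2) \<le>
      ((\<Sum>k=1..last_before j. 1 + \<bar>m k\<bar>) + (\<Sum>k=1..last_before i. 1 + \<bar>m k\<bar>))\<^sup>2"
    proof (rule AE_I2)
      fix x
      have "\<bar>S j x - S i x\<bar> \<le> (\<Sum>k=1..last_before j. 1 + \<bar>m k\<bar>) + (\<Sum>k=1..last_before i. 1 + \<bar>m k\<bar>)"
        using sum_bound[of x "{1..last_before j}"] sum_bound[of x "{1..last_before i}"]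
        unfolding S_def by linarith
      then have "\<bar>S j x - S i x\<bar>\<^sup>2 \<le> ((\<Sum>k=1..last_before j. 1 + \<bar>m k\<bar>) + (\<Sum>k=1..last_before i. 1 + \<bar>m k\<bar>))\<^sup>2"
        by (intro power_mono) auto
      then show "norm ((S j x - S i x)\<^sup>2) \<le>
        ((\<Sum>k=1..last_before j. 1 + \<bar>m k\<bar>) + (\<Sum>k=1..last_before i. 1 + \<bar>m k\<bar>))\<^sup>2" by simp
    qed
    show "(\<lambda>x. (S j x - S i x)\<^sup>2) \<in> borel_measurable M" unfolding S_def using X(1) by measurable
  qed
  have second: "expectation (\<lambda>x. (S j x - S i x)\<^sup>2) \<le> (K * (1 + b)) * real (j - i)" if ij: "i < j" for i j
  proof -
    let ?s = "last_before i" and ?t = "last_before j"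
    have st: "?s \<le> ?t" using ij by (intro last_before_mono) simp
    have "expectation (\<lambda>x. (S j x - S i x)\<^sup>2) = expectation (\<lambda>x. (\<Sum>k\<in>{?s<..?t}. X k x - m k)\<^sup>2)"
      unfolding S_def by (simp only: split[OF st])
    also have "\<dots> \<le> K * (\<Sum>k\<in>{?s<..?t}. w k)"
    proof (cases "?s = ?t")
      case True then show ?thesis by simp
    next
      case False then show ?thesis using st by (intro variance) simp
    qed
    also have "(\<Sum>k\<in>{?s<..?t}. w k) = \<Psi> ?t - \<Psi> ?s" unfolding \<Psi>_def by (simp only: split[OF st])
    also have "K * (\<Psi> ?t - \<Psi> ?s) \<le> K * (real j - (real i - b))"
      using \<Psi>_last_before(1)[of j] \<Psi>_last_before(2)[of i] K by (intro mult_left_mono diff_mono) auto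
    also have "\<dots> \<le> K * ((1 + b) * real (j - i))"
    proof (rule mult_left_mono[OF _ K])
      show "real j - (real i - b) \<le> (1 + b) * real (j - i)"
        using ij b mult_left_mono[of 1 "real (j - i)" b] by (simp add: distrib_right)
    qed
    finally show ?thesis by (simp add: mult_ac)
  qed
  have S0: "S 0 x = 0" for x by (simp add: S_def last_before_0)
  have "AE x in M. eventually (\<lambda>r. dyadic_energy (\<lambda>i. S i x) r 0 \<le> real r powr (2 + 2 * \<epsilon>) * 2 ^ r) sequentially"
    by (rule dyadic_energy_AE[OF int second \<epsilon>])
  then show ?thesis
  proof (rule AE_mp, intro AE_I2 impI)
    fix x assume "eventually (\<lambda>r. dyadic_energy (\<lambda>i. S i x) r 0 \<le> real r powr (2 + 2 * \<epsilon>) * 2 ^ r) sequentially"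
    then obtain r0 where r0: "\<And>r. r \<ge> r0 \<Longrightarrow> dyadic_energy (\<lambda>i. S i x) r 0 \<le> real r powr (2 + 2 * \<epsilon>) * 2 ^ r"
      by (auto simp: eventually_sequentially)
    define c where "c = sqrt 8 * 3 powr (3 / 2 + \<epsilon>)"
    let ?g = "\<lambda>n. \<Psi> n powr (1 / 2) * ln (\<Psi> n) powr (3 / 2 + \<epsilon>)"
    have main: "\<bar>(\<Sum>k=1..n. X k x) - (\<Sum>k=1..n. m k)\<bar> \<le> (c + (1 + b)) * ?g n"
      if big: "4 \<le> \<Psi> n" "2 ^ r0 \<le> \<Psi> n" for n
    proof -
      define j where "j = nat \<lfloor>\<Psi> n\<rfloor>"
      have j: "real j \<le> \<Psi> n" "\<Psi> n < real j + 1" "4 \<le> j"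
        using big(1) by (auto simp: j_def le_nat_floor)
      \<comment> \<open>The smallest dyadic block containing the levels \<open>j\<close> and \<open>j + 1\<close> on either side of \<open>\<Psi> n\<close>.\<close>
      define r where "r = (LEAST r. j + 1 \<le> 2 ^ r)"
      have ex: "j + 1 \<le> 2 ^ (j + 1)" by (metis less_exp less_imp_le)
      have r1: "j + 1 \<le> 2 ^ r" unfolding r_def using ex by (rule LeastI)
      have rpos: "0 < r" using r1 j by (cases r) auto
      have "\<not> j + 1 \<le> 2 ^ (r - 1)" unfolding r_def using rpos by (intro not_less_Least) (simp add: r_def)
      then have "(2::nat) ^ r \<le> 2 * (j + 1)" using rpos by (cases r) auto
      then have "real (2 ^ r) \<le> real (2 * (j + 1))" by (simp only: of_nat_le_iff)
      then have r2: "2 ^ r \<le> 4 * \<Psi> n" using j by simp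
      have "r0 \<le> r"
      proof (rule ccontr)
        assume "\<not> r0 \<le> r"
        then have "(2::real) ^ r \<le> 2 ^ r0" by (intro power_increasing) auto
        moreover have "real (j + 1) \<le> 2 ^ r" using r1 by (metis of_nat_le_iff of_nat_numeral of_nat_power)
        ultimately have "real (j + 1) \<le> \<Psi> n" using big(2) by linarith
        then show False using j by simp
      qed
      then have en: "dyadic_energy (\<lambda>i. S i x) r 0 \<le> real r powr (2 + 2 * \<epsilon>) * 2 ^ r" by (rule r0)
      have S_le: "\<bar>S i x\<bar> \<le> c * ?g n" if "i \<le> j + 1" for i
        unfolding c_def
      proof (rule polylog_bound[OF big(1) r2 \<epsilon>])
        have "(S (0 + i) x - S 0 x)\<^sup>2 \<le> (real r + 1) * dyadic_energy (\<lambda>i. S i x) r 0"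
          by (rule increment_le_dyadic_energy) (use that r1 in simp)
        also have "\<dots> \<le> (real r + 1) * (real r powr (2 + 2 * \<epsilon>) * 2 ^ r)"
          using en by (intro mult_left_mono) auto
        finally show "(S i x)\<^sup>2 \<le> (real r + 1) * (real r powr (2 + 2 * \<epsilon>) * 2 ^ r)" by (simp add: S0)
      qed
      have n1: "n \<le> last_before (j + 1)" using j by (subst last_before[symmetric]) simp
      have "\<Psi> (last_before j) \<le> \<Psi> n" using \<Psi>_last_before(1)[of j] j by linarith
      then have n2: "last_before j \<le> n" by (simp add: \<Psi>_le_iff)
      have gap: "0 \<le> (\<Sum>k\<in>{s<..t}. X k x)" "0 \<le> (\<Sum>k\<in>{s<..t}. m k)" "(\<Sum>k\<in>{s<..t}. m k) \<le> (\<Sum>k\<in>{s<..t}. w k)" for s t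
        using X m by (auto intro!: sum_nonneg sum_mono)
      have Sdef: "S i x = (\<Sum>k=1..last_before i. X k x) - (\<Sum>k=1..last_before i. m k)" for i
        by (simp add: S_def sum_subtractf)
      have up: "(\<Sum>k=1..n. X k x) - (\<Sum>k=1..n. m k) \<le> S (j + 1) x + 1"
        using split[OF n1, of "\<lambda>k. X k x"] split[OF n1, of m] split[OF n1, of w]
          gap[of n "last_before (j + 1)"] \<Psi>_last_before(1)[of "j + 1"] j Sdef[of "j + 1"]
        unfolding \<Psi>_def by simp
      have lo: "S j x - (1 + b) \<le> (\<Sum>k=1..n. X k x) - (\<Sum>k=1..n. m k)"
        using split[OF n2, of "\<lambda>k. X k x"] split[OF n2, of m] split[OF n2, of w]
          gap[of "last_before j" n] \<Psi>_last_before(2)[of j] j Sdef[of j]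
        unfolding \<Psi>_def by simp
      have "1 \<le> ?g n"
      proof -
        have "1 \<le> ln (4::real)" using ln2_ge_two_thirds ln_realpow[of 2 2] by simp
        also have "\<dots> \<le> ln (\<Psi> n)" using big by simp
        finally have "1 \<le> ln (\<Psi> n) powr (3 / 2 + \<epsilon>)" using \<epsilon> by (intro ge_one_powr_ge_zero) auto
        moreover have "1 \<le> \<Psi> n powr (1 / 2)" using big by (intro ge_one_powr_ge_zero) auto
        ultimately show ?thesis using mult_mono[of 1 "\<Psi> n powr (1 / 2)" 1 "ln (\<Psi> n) powr (3 / 2 + \<epsilon>)"] by simp
      qed
      then have "1 + b \<le> (1 + b) * ?g n" using b mult_left_mono[of 1 "?g n" "1 + b"] by simp
      then show ?thesis
        using up lo S_le[of j] S_le[of "j + 1"] b unfolding abs_le_iff by (simp add: distrib_right) 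
    qed
    have "eventually (\<lambda>n. max 4 (2 ^ r0) \<le> \<Psi> n) sequentially"
      using clock_unbounded unfolding filterlim_at_top \<Psi>_def by blast
    then have "eventually (\<lambda>n. \<bar>(\<Sum>k=1..n. X k x) - (\<Sum>k=1..n. m k)\<bar> \<le> (c + (1 + b)) * ?g n) sequentially"
    proof (rule eventually_mono)
      fix n assume "max 4 (2 ^ r0) \<le> \<Psi> n"
      then have "4 \<le> \<Psi> n" "2 ^ r0 \<le> \<Psi> n" by simp_all
      then show "\<bar>(\<Sum>k=1..n. X k x) - (\<Sum>k=1..n. m k)\<bar> \<le> (c + (1 + b)) * ?g n" by (rule main)
    qed
    then show "\<exists>c. eventually (\<lambda>n. \<bar>(\<Sum>k=1..n. X k x) - (\<Sum>k=1..n. m k)\<bar>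
      \<le> c * ((\<Sum>k=1..n. w k) powr (1 / 2) * ln (\<Sum>k=1..n. w k) powr (3 / 2 + \<epsilon>))) sequentially"
      unfolding \<Psi>_def by blast
  qed
qed

section \<open>The strong Borel-Cantelli property of the return sets\<close>

lemma sum_weighted_geometric_le:
  fixes \<sigma> :: real
  assumes "0 < \<sigma>" "\<sigma> < 1"
  shows "(\<Sum>k=1..n. real k * \<sigma> ^ k) \<le> 1 / (1 - \<sigma>)\<^sup>2"
proof -
  have s: "(\<lambda>i. real (Suc i) * \<sigma> ^ i) sums (1 / (1 - \<sigma>)\<^sup>2)"
    using geometric_deriv_sums[of \<sigma>] assms by simp
  have "(\<Sum>k=1..n. real k * \<sigma> ^ k) = (\<Sum>i<n. real (Suc i) * \<sigma> ^ Suc i)"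
    by (simp only: One_nat_def sum.atLeast_Suc_atMost_Suc_shift sum.atLeast1_atMost_eq)
  also have "\<dots> \<le> (\<Sum>i<n. real (Suc i) * \<sigma> ^ i)"
    using assms by (intro sum_mono mult_left_mono) (auto simp: mult_left_le_one_le)
  also have "\<dots> \<le> (\<Sum>i. real (Suc i) * \<sigma> ^ i)"
    using assms by (intro sum_le_suminf sums_summable[OF s]) auto
  also have "\<dots> = 1 / (1 - \<sigma>)\<^sup>2" using sums_unique[OF s] by simp
  finally show ?thesis .
qed

lemma sum_geometric_le:
  fixes \<sigma> :: real
  assumes "0 < \<sigma>" "\<sigma> < 1"
  shows "(\<Sum>j=1..n. \<sigma> ^ j) \<le> 1 / (1 - \<sigma>)" "(\<Sum>j=1..n. \<sigma> ^ (Suc n - j)) \<le> 1 / (1 - \<sigma>)"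
proof -
  have "(\<Sum>j=1..n. \<sigma> ^ j) \<le> (\<Sum>j<Suc n. \<sigma> ^ j)"
    using assms by (intro sum_mono2) auto
  also have "\<dots> \<le> 1 / (1 - \<sigma>)" using assms by (simp only: sum_gp_strict) (simp add: divide_right_mono)
  finally show 1: "(\<Sum>j=1..n. \<sigma> ^ j) \<le> 1 / (1 - \<sigma>)" .
  have "(\<Sum>j=1..n. \<sigma> ^ (Suc n - j)) = (\<Sum>j=1..n. \<sigma> ^ j)"
    by (rule sum.reindex_bij_witness[where i = "\<lambda>j. Suc n - j" and j = "\<lambda>j. Suc n - j"]) auto
  with 1 show "(\<Sum>j=1..n. \<sigma> ^ (Suc n - j)) \<le> 1 / (1 - \<sigma>)" by simp
qed

lemma (in prob_space) expectation_centred_indicators: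
  assumes A: "A \<in> events" and B: "B \<in> events"
  shows "integrable M (\<lambda>x. (indicator A x - a) * (indicator B x - b :: real))"
    "expectation (\<lambda>x. (indicator A x - a) * (indicator B x - b)) = prob (A \<inter> B) - a * prob B - b * prob A + a * b"
proof -
  have eq: "(\<lambda>x. (indicator A x - a) * (indicator B x - b :: real)) =
    (\<lambda>x. indicator (A \<inter> B) x - a * indicator B x - b * indicator A x + a * b)"
    by (simp add: fun_eq_iff indicator_inter_arith algebra_simps)
  have int: "integrable M (indicator S :: 'a \<Rightarrow> real)" if "S \<in> events" for S
    using that by (simp add: integrable_indicator_iff emeasure_eq_measure)
  note ints = int[OF A] int[OF B] int[OF sets.Int[OF A B]]
  show "integrable M (\<lambda>x. (indicator A x - a) * (indicator B x - b :: real))"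
    unfolding eq using ints by simp
  show "expectation (\<lambda>x. (indicator A x - a) * (indicator B x - b)) = prob (A \<inter> B) - a * prob B - b * prob A + a * b"
    unfolding eq using ints
    by (simp add: sets.Int_space_eq2[OF A] sets.Int_space_eq2[OF B] sets.Int_space_eq2[OF sets.Int[OF A B]] prob_space)
qed

text \<open>
  Off the diagonal the covariances are at most \<open>O((\<sigma> ^ j + \<sigma> ^ (k - j)) m k + \<sigma> ^ k)\<close>. Summation over
  \<open>j < k\<close> turns the first part into \<open>O(m k)\<close> and the second into \<open>O(k \<sigma> ^ k)\<close>.
\<close>

lemma (in prob_space) quasi_independent_variance:
  fixes A :: "nat \<Rightarrow> 'a set" and m :: "nat \<Rightarrow> real"
  assumes A: "\<And>k. A k \<in> events" and m: "\<And>k. m k \<in> {0..1}" and \<sigma>: "0 < \<sigma>" "\<sigma> < 1" and B: "0 \<le> B"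
    and one: "\<And>k. \<bar>prob (A k) - m k\<bar> \<le> B * \<sigma> ^ k"
    and two: "\<And>j k. j < k \<Longrightarrow> prob (A j \<inter> A k) \<le> m j * m k + B * (\<sigma> ^ j + \<sigma> ^ (k - j)) * m k + B * \<sigma> ^ k"
  shows "expectation (\<lambda>x. (\<Sum>k\<in>{s<..t}. indicator (A k) x - m k)\<^sup>2)
    \<le> (1 + 6 * B / (1 - \<sigma>) + 7 * B) * (\<Sum>k\<in>{s<..t}. m k + real k * \<sigma> ^ k)"
proof -
  define v where "v j k = expectation (\<lambda>x. (indicator (A j) x - m j) * (indicator (A k) x - m k))" for j k
  define K where "K = 1 + 6 * B / (1 - \<sigma>) + 7 * B"
  have v: "v j k = prob (A j \<inter> A k) - m j * prob (A k) - m k * prob (A j) + m j * m k" for j k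
    unfolding v_def by (rule expectation_centred_indicators(2)[OF A A])
  have m01: "0 \<le> m k" "m k \<le> 1" for k using m[of k] by auto
  have v_sym: "v j k = v k j" for j k by (simp add: v_def mult.commute)
  have v_diag: "v k k \<le> m k + 3 * B * \<sigma> ^ k" for k
  proof -
    have "v k k = prob (A k) - 2 * m k * prob (A k) + m k * m k" using v[of k k] by simp
    also have "\<dots> = m k - m k * m k + (1 - 2 * m k) * (prob (A k) - m k)" by (simp add: algebra_simps)
    also have "\<dots> \<le> m k + 1 * (B * \<sigma> ^ k)"
    proof -
      have "(1 - 2 * m k) * (prob (A k) - m k) \<le> \<bar>1 - 2 * m k\<bar> * \<bar>prob (A k) - m k\<bar>"
        by (simp add: abs_mult[symmetric])
      also have "\<dots> \<le> 1 * (B * \<sigma> ^ k)" using m01[of k] one[of k] by (intro mult_mono) auto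
      finally show ?thesis using m01[of k] by (simp add: add_mono)
    qed
    also have "\<dots> \<le> m k + 3 * B * \<sigma> ^ k" using B \<sigma> by simp
    finally show ?thesis .
  qed
  have v_off: "v j k \<le> B * (2 * \<sigma> ^ j + \<sigma> ^ (k - j)) * m k + 2 * B * \<sigma> ^ k" if "j < k" for j k
  proof -
    have "v j k = prob (A j \<inter> A k) - m j * prob (A k) - m k * prob (A j) + m j * m k" by (rule v)
    also have "\<dots> \<le> (m j * m k + B * (\<sigma> ^ j + \<sigma> ^ (k - j)) * m k + B * \<sigma> ^ k)
        - m j * (m k - B * \<sigma> ^ k) - m k * (m j - B * \<sigma> ^ j) + m j * m k"
      using one[of j] one[of k] m01 by (intro add_mono diff_mono two that mult_left_mono order_refl) (auto simp: abs_le_iff)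
    also have "\<dots> = B * (2 * \<sigma> ^ j + \<sigma> ^ (k - j)) * m k + B * \<sigma> ^ k + m j * (B * \<sigma> ^ k)"
      by (simp add: algebra_simps)
    also have "m j * (B * \<sigma> ^ k) \<le> 1 * (B * \<sigma> ^ k)" using m01 B \<sigma> by (intro mult_right_mono) auto
    finally show ?thesis by simp
  qed
  have step: "v (Suc t) (Suc t) + 2 * (\<Sum>j\<in>{s<..t}. v j (Suc t)) \<le> K * (m (Suc t) + real (Suc t) * \<sigma> ^ Suc t)" for t
  proof -
    let ?k = "Suc t"
    have "(\<Sum>j\<in>{s<..t}. v j ?k) \<le> (\<Sum>j\<in>{s<..t}. B * (2 * \<sigma> ^ j + \<sigma> ^ (?k - j)) * m ?k + 2 * B * \<sigma> ^ ?k)"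
      by (intro sum_mono v_off) auto
    also have "\<dots> \<le> (\<Sum>j=1..t. B * (2 * \<sigma> ^ j + \<sigma> ^ (?k - j)) * m ?k + 2 * B * \<sigma> ^ ?k)"
      using B \<sigma> m01 by (intro sum_mono2) (auto intro!: add_nonneg_nonneg mult_nonneg_nonneg)
    also have "\<dots> = B * m ?k * (2 * (\<Sum>j=1..t. \<sigma> ^ j) + (\<Sum>j=1..t. \<sigma> ^ (?k - j))) + 2 * B * real t * \<sigma> ^ ?k"
      by (simp add: sum.distrib sum_distrib_left algebra_simps)
    also have "\<dots> \<le> B * m ?k * (2 * (1 / (1 - \<sigma>)) + 1 / (1 - \<sigma>)) + 2 * B * real ?k * \<sigma> ^ ?k"
      using B m01 \<sigma> sum_geometric_le[OF \<sigma>, of t]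
      by (intro add_mono mult_left_mono mult_right_mono mult_nonneg_nonneg) auto
    finally have 1: "(\<Sum>j\<in>{s<..t}. v j ?k) \<le> 3 * B / (1 - \<sigma>) * m ?k + 2 * B * (real ?k * \<sigma> ^ ?k)"
      by (simp add: algebra_simps)
    have 2: "v ?k ?k \<le> m ?k + 3 * B * (real ?k * \<sigma> ^ ?k)"
    proof -
      have "1 * \<sigma> ^ ?k \<le> real ?k * \<sigma> ^ ?k" using \<sigma> by (intro mult_right_mono) auto
      then have "3 * B * \<sigma> ^ ?k \<le> 3 * B * (real ?k * \<sigma> ^ ?k)" using B by (intro mult_left_mono) auto
      then show ?thesis using v_diag[of ?k] by linarith
    qed
    have "v ?k ?k + 2 * (\<Sum>j\<in>{s<..t}. v j ?k) \<le> (1 + 6 * B / (1 - \<sigma>)) * m ?k + 7 * B * (real ?k * \<sigma> ^ ?k)"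
    proof -
      have *: "6 * B / (1 - \<sigma>) = 2 * (3 * B / (1 - \<sigma>))" by simp
      show ?thesis using 1 2 unfolding * distrib_right by linarith
    qed
    also have "\<dots> \<le> K * m ?k + K * (real ?k * \<sigma> ^ ?k)"
      using B m01 \<sigma> by (intro add_mono mult_right_mono) (auto simp: K_def)
    finally show ?thesis by (simp only: distrib_left)
  qed
  have "(\<Sum>j\<in>{s<..t}. \<Sum>k\<in>{s<..t}. v j k) \<le> K * (\<Sum>k\<in>{s<..t}. m k + real k * \<sigma> ^ k)"
  proof (induction t)
    case (Suc t)
    show ?case
    proof (cases "s \<le> t")
      case True
      then have I: "{s<..Suc t} = insert (Suc t) {s<..t}" by auto
      have "(\<Sum>j\<in>{s<..Suc t}. \<Sum>k\<in>{s<..Suc t}. v j k) =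
        (\<Sum>j\<in>{s<..t}. \<Sum>k\<in>{s<..t}. v j k) + (v (Suc t) (Suc t) + 2 * (\<Sum>j\<in>{s<..t}. v j (Suc t)))"
      proof -
        have "(\<Sum>k\<in>{s<..t}. v (Suc t) k) = (\<Sum>j\<in>{s<..t}. v j (Suc t))" by (intro sum.cong refl v_sym)
        then show ?thesis unfolding I by (simp add: sum.distrib)
      qed
      also have "\<dots> \<le> K * (\<Sum>k\<in>{s<..t}. m k + real k * \<sigma> ^ k) + K * (m (Suc t) + real (Suc t) * \<sigma> ^ Suc t)"
        by (intro add_mono Suc.IH step)
      also have "\<dots> = K * (\<Sum>k\<in>{s<..Suc t}. m k + real k * \<sigma> ^ k)"
        unfolding I by (simp add: distrib_left)
      finally show ?thesis .
    qed simp
  qed simp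
  moreover have "expectation (\<lambda>x. (\<Sum>k\<in>{s<..t}. indicator (A k) x - m k)\<^sup>2) = (\<Sum>j\<in>{s<..t}. \<Sum>k\<in>{s<..t}. v j k)"
    unfolding power2_eq_square sum_product v_def
    using expectation_centred_indicators(1)[OF A A] by (simp add: Bochner_Integration.integral_sum Bochner_Integration.integrable_sum)
  ultimately show ?thesis by (simp add: K_def)
qed

lemma bigo_polylog_shift:
  fixes \<Phi> \<Psi> f :: "nat \<Rightarrow> real"
  assumes lim: "filterlim \<Phi> at_top sequentially" and \<Psi>: "\<And>n. \<Phi> n \<le> \<Psi> n" "\<And>n. \<Psi> n \<le> \<Phi> n + E"
    and f: "eventually (\<lambda>n. \<bar>f n\<bar> \<le> c * (\<Psi> n powr (1 / 2) * ln (\<Psi> n) powr q)) sequentially"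
    and q: "0 \<le> q"
  shows "f \<in> O(\<lambda>n. \<Phi> n powr (1 / 2) * ln (\<Phi> n) powr q)"
proof (rule bigoI)
  have "eventually (\<lambda>n. max 2 E \<le> \<Phi> n) sequentially" using lim unfolding filterlim_at_top by blast
  with f show "eventually (\<lambda>n. norm (f n) \<le> (\<bar>c\<bar> * (2 powr (1 / 2) * 2 powr q)) * norm (\<Phi> n powr (1 / 2) * ln (\<Phi> n) powr q)) sequentially"
  proof eventually_elim
    case (elim n)
    then have P: "2 \<le> \<Phi> n" "\<Psi> n \<le> 2 * \<Phi> n" "\<Phi> n \<le> \<Psi> n" using \<Psi>(1)[of n] \<Psi>(2)[of n] by auto
    have "ln (\<Psi> n) \<le> ln (2 * \<Phi> n)" using P by simp
    also have "\<dots> = ln 2 + ln (\<Phi> n)" using P by (simp add: ln_mult)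
    also have "\<dots> \<le> 2 * ln (\<Phi> n)" using P by simp
    finally have l: "ln (\<Psi> n) \<le> 2 * ln (\<Phi> n)" "0 \<le> ln (\<Psi> n)" using P by auto
    have "\<bar>f n\<bar> \<le> c * (\<Psi> n powr (1 / 2) * ln (\<Psi> n) powr q)" using elim by simp
    also have "\<dots> \<le> \<bar>c\<bar> * (\<Psi> n powr (1 / 2) * ln (\<Psi> n) powr q)" by (intro mult_right_mono) auto
    also have "\<dots> \<le> \<bar>c\<bar> * ((2 * \<Phi> n) powr (1 / 2) * (2 * ln (\<Phi> n)) powr q)"
      using P l q by (intro mult_left_mono mult_mono powr_mono2) auto
    also have "\<dots> = (\<bar>c\<bar> * (2 powr (1 / 2) * 2 powr q)) * (\<Phi> n powr (1 / 2) * ln (\<Phi> n) powr q)"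
      using P by (simp add: powr_mult mult_ac)
    finally show ?case using P by (simp add: abs_mult)
  qed
qed

context regular_map
begin

text \<open>
  If the measures are summable, almost every point returns only finitely often by the first
  Borel-Cantelli lemma. Otherwise the weights \<open>m k + k * \<sigma> ^ k\<close> drive the clock of \<open>Gal_Koksma\<close>, and
  differ from \<open>m k\<close> by a summable amount. The correction also makes the weights positive where \<open>m k = 0\<close>.
\<close>

lemma recurrence_Borel_Cantelli:
  fixes m :: "nat \<Rightarrow> real"
  assumes m: "\<And>k. m k \<in> {0..1}" and m0: "m 0 = 0" and \<epsilon>: "0 < \<epsilon>"
  defines "\<Phi> \<equiv> \<lambda>n. \<Sum>k=1..n. m k"
  defines "R \<equiv> \<lambda>x n. (\<Sum>k=1..n. indicator (ret (m k) k) x) - \<Phi> n"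
  shows "AE x in \<mu>. if bounded (range \<Phi>) then bounded (range (R x))
       else R x \<in> O(\<lambda>n. \<Phi> n powr (1/2) * ln (\<Phi> n) powr (3/2 + \<epsilon>))"
proof -
  obtain B \<sigma> where \<sigma>: "0 < \<sigma>" "\<sigma> < 1" and B: "0 \<le> B"
    and one: "\<And>a k. a \<in> {0..1} \<Longrightarrow> \<bar>prob (ret a k) - a\<bar> \<le> B * \<sigma> ^ k"
    and two: "\<And>a b j k. a \<in> {0..1} \<Longrightarrow> b \<in> {0..1} \<Longrightarrow> j < k \<Longrightarrow>
       prob (ret a j \<inter> ret b k) \<le> a * b + B * (\<sigma> ^ j + \<sigma> ^ (k - j)) * b + B * \<sigma> ^ k"
    by (rule ret_correlations, rule that)
  define A where "A k = ret (m k) k" for k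
  have A: "A k \<in> events" for k unfolding A_def by (rule ret_measurable[OF m])
  have m01: "0 \<le> m k" "m k \<le> 1" for k using m[of k] by auto
  have mono: "incseq \<Phi>" unfolding \<Phi>_def by (intro incseq_SucI) (simp add: m01)
  have \<Phi>0: "0 \<le> \<Phi> n" for n unfolding \<Phi>_def by (intro sum_nonneg m01)
  show ?thesis
  proof (cases "bounded (range \<Phi>)")
    case True
    then obtain b where b: "\<And>n. \<Phi> n \<le> b" unfolding bounded_iff by (auto simp: abs_le_iff)
    have "summable m"
    proof (rule summableI_nonneg_bounded)
      fix n
      have "sum m {..<n} \<le> sum m (insert 0 {1..n})" using m01 by (intro sum_mono2) auto
      also have "\<dots> = \<Phi> n" by (simp add: m0 \<Phi>_def)
      finally show "sum m {..<n} \<le> b" using b[of n] by simp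
    qed (rule m01)
    moreover have "summable (\<lambda>k. B * \<sigma> ^ k)" using \<sigma> by (intro summable_mult summable_geometric) auto
    ultimately have "summable (\<lambda>k. m k + B * \<sigma> ^ k)" by (rule summable_add)
    then have "summable (\<lambda>k. prob (A k))"
    proof (rule summable_comparison_test[rotated], intro exI allI impI)
      fix k show "norm (prob (A k)) \<le> m k + B * \<sigma> ^ k"
        using one[OF m[of k], of k] by (simp add: A_def abs_le_iff)
    qed
    then have "AE x in \<mu>. eventually (\<lambda>k. x \<in> space \<mu> - A k) sequentially"
      using A by (intro borel_cantelli_AE1) (auto simp: emeasure_eq_measure)
    then have "AE x in \<mu>. bounded (range (R x))"
    proof (rule AE_mp, intro AE_I2 impI)
      fix x assume "eventually (\<lambda>k. x \<in> space \<mu> - A k) sequentially"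
      then obtain k0 where k0: "\<And>k. k \<ge> k0 \<Longrightarrow> x \<notin> A k" by (auto simp: eventually_sequentially)
      have "norm (R x n) \<le> real k0 + b" for n
      proof -
        have "(\<Sum>k=1..n. indicator (A k) x :: real) \<le> (\<Sum>k\<in>{1..n}. if k < k0 then 1 else 0)"
          using k0 by (intro sum_mono) (auto simp: indicator_def not_less)
        also have "\<dots> = real (card {k\<in>{1..n}. k < k0})" by (simp add: sum.If_cases Int_def)
        also have "card {k\<in>{1..n}. k < k0} \<le> card {..<k0}" by (intro card_mono) auto
        finally have "(\<Sum>k=1..n. indicator (A k) x :: real) \<le> real k0" by simp
        moreover have "0 \<le> (\<Sum>k=1..n. indicator (A k) x :: real)" by (intro sum_nonneg) auto
        ultimately show ?thesis using b[of n] \<Phi>0[of n] unfolding R_def A_def by simp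
      qed
      then show "bounded (range (R x))" unfolding bounded_iff by auto
    qed
    with True show ?thesis by simp
  next
    case False
    define w where "w k = m k + real k * \<sigma> ^ k" for k
    define E where "E = 1 / (1 - \<sigma>)\<^sup>2"
    have lim: "filterlim \<Phi> at_top sequentially"
    proof (rule filterlim_at_top[THEN iffD2], intro allI)
      fix z
      have "\<exists>n. z \<le> \<Phi> n"
      proof (rule ccontr)
        assume "\<not> ?thesis"
        then have "norm (\<Phi> n) \<le> z" for n using \<Phi>0[of n] by (auto simp: not_le less_imp_le)
        then have "bounded (range \<Phi>)" unfolding bounded_iff by auto
        with False show False ..
      qed
      then obtain n where "z \<le> \<Phi> n" ..
      then have "z \<le> \<Phi> k" if "n \<le> k" for k using incseqD[OF mono that] by linarith
      then show "eventually (\<lambda>n. z \<le> \<Phi> n) sequentially" unfolding eventually_sequentially by blast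
    qed
    have Wle: "(\<Sum>k=1..n. w k) \<le> \<Phi> n + E" and Wge: "\<Phi> n \<le> (\<Sum>k=1..n. w k)" for n
      using sum_weighted_geometric_le[OF \<sigma>, of n] \<sigma>
      by (auto simp: w_def \<Phi>_def E_def sum.distrib intro!: sum_nonneg)
    interpret clock: increasing_clock w "1 + E"
    proof
      fix k :: nat assume k: "1 \<le> k"
      then show "0 < w k" using m01(1)[of k] \<sigma> by (auto simp: w_def intro!: add_nonneg_pos)
      have "real k * \<sigma> ^ k \<le> (\<Sum>i=1..k. real i * \<sigma> ^ i)"
        using k \<sigma> by (intro member_le_sum) auto
      then show "w k \<le> 1 + E"
        using sum_weighted_geometric_le[OF \<sigma>, of k] m01(2)[of k] by (simp add: w_def E_def)
    next
      show "filterlim (\<lambda>n. \<Sum>k=1..n. w k) at_top sequentially"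
        by (rule filterlim_at_top_mono[OF lim]) (intro always_eventually allI Wge)
    qed
    have "AE x in \<mu>. \<exists>c. eventually (\<lambda>n. \<bar>(\<Sum>k=1..n. indicator (A k) x) - (\<Sum>k=1..n. m k)\<bar>
      \<le> c * ((\<Sum>k=1..n. w k) powr (1 / 2) * ln (\<Sum>k=1..n. w k) powr (3 / 2 + \<epsilon>))) sequentially"
    proof (rule Gal_Koksma)
      show "increasing_clock w (1 + E)" by unfold_locales
      show "(indicator (A k) :: real \<Rightarrow> real) \<in> borel_measurable \<mu>" for k using A by simp
      show "m k \<le> w k" for k using \<sigma> by (simp add: w_def)
      show "expectation (\<lambda>x. (\<Sum>k\<in>{s<..t}. indicator (A k) x - m k)\<^sup>2)
        \<le> (1 + 6 * B / (1 - \<sigma>) + 7 * B) * (\<Sum>k\<in>{s<..t}. w k)" for s t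
        unfolding w_def
        by (rule quasi_independent_variance[OF A m \<sigma> B]) (auto simp: A_def intro: one two m)
    qed (use m01 \<epsilon> in auto)
    then have "AE x in \<mu>. R x \<in> O(\<lambda>n. \<Phi> n powr (1/2) * ln (\<Phi> n) powr (3/2 + \<epsilon>))"
    proof (rule AE_mp, intro AE_I2 impI)
      fix x assume "\<exists>c. eventually (\<lambda>n. \<bar>(\<Sum>k=1..n. indicator (A k) x) - (\<Sum>k=1..n. m k)\<bar>
        \<le> c * ((\<Sum>k=1..n. w k) powr (1 / 2) * ln (\<Sum>k=1..n. w k) powr (3 / 2 + \<epsilon>))) sequentially"
      then obtain c where "eventually (\<lambda>n. \<bar>R x n\<bar>
        \<le> c * ((\<Sum>k=1..n. w k) powr (1 / 2) * ln (\<Sum>k=1..n. w k) powr (3 / 2 + \<epsilon>))) sequentially"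
        unfolding R_def A_def \<Phi>_def by blast
      then show "R x \<in> O(\<lambda>n. \<Phi> n powr (1/2) * ln (\<Phi> n) powr (3/2 + \<epsilon>))"
        by (rule bigo_polylog_shift[OF lim Wge Wle]) (use \<epsilon> in auto)
    qed
    with False show ?thesis by simp
  qed
qed

end

context gibbs_map
begin

lemma regular_constants:
  obtains M \<kappa> c \<rho> where "regular_map T \<phi> N C \<mu> M \<kappa> c \<rho>"
proof -
  obtain M \<kappa> where \<kappa>: "0 < \<kappa>" "\<kappa> < 1" "0 \<le> M"
    and mix: "\<And>u w m. set u \<subseteq> {..<N} \<Longrightarrow> set w \<subseteq> {..<N} \<Longrightarrow>
       \<bar>(\<Sum>v\<in>words N m. p (u @ v @ w)) - p u * p w\<bar> \<le> M * \<kappa> ^ m * (p u * p w)"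
    and dec: "\<And>u. set u \<subseteq> {..<N} \<Longrightarrow> p u \<le> M * \<kappa> ^ length u"
    by (rule mixing_and_decay, rule that)
  interpret dm: decaying_map T \<phi> N C \<mu> M \<kappa>
    by unfold_locales (use \<kappa> dec in auto)
  obtain c \<rho> where \<rho>: "0 < \<rho>" "\<rho> < 1" "0 \<le> c"
    and short: "\<And>n a b. b - a \<le> 4 * (1 / 3) ^ n \<Longrightarrow> prob (dm.J a b) \<le> c * \<rho> ^ n"
    by (rule dm.Holder_regularity, rule that)
  define s where "s = max \<kappa> \<rho>"
  define d where "d = max c (2 * M)"
  have s: "0 < s" "s < 1" "\<kappa> \<le> s" "\<rho> \<le> s" using \<kappa> \<rho> by (auto simp: s_def)
  have d: "0 \<le> d" "c \<le> d" "2 * M \<le> d" "M \<le> d" using \<rho> \<kappa> by (auto simp: d_def)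
  have up1: "M * \<kappa> ^ n \<le> d * s ^ n" and up2: "2 * M * \<kappa> ^ n \<le> d * s ^ n" and up3: "c * \<rho> ^ n \<le> d * s ^ n" for n
    using s d \<kappa> \<rho> by (auto intro!: mult_mono power_mono)
  have "regular_map T \<phi> N C \<mu> M \<kappa> d s"
  proof unfold_locales
    fix u w :: "nat list" and m assume uw: "set u \<subseteq> {..<N}" "set w \<subseteq> {..<N}"
    show "\<bar>(\<Sum>v\<in>words N m. p (u @ v @ w)) - p u * p w\<bar> \<le> d * s ^ m * (p u * p w)"
      by (rule order_trans[OF mix[OF uw]]) (intro mult_right_mono up1 mult_nonneg_nonneg p_nonneg)
  next
    fix a b n show "(\<Sum>w\<in>dm.outer n a b. p w) \<le> prob (dm.J a b) + d * s ^ n"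
      using dm.outer_le[of n a b] up2[of n] by linarith
  next
    fix a b n show "prob (dm.J a b) - d * s ^ n \<le> (\<Sum>w\<in>dm.inner n a b. p w)"
      using dm.inner_ge[of a b n] up2[of n] by linarith
  next
    fix a b :: real and n assume "b - a \<le> 4 * (1 / 3) ^ n"
    then show "prob (dm.J a b) \<le> d * s ^ n" using short up3[of n] by (meson order_trans)
  qed (use s d in auto)
  then show ?thesis by (rule that)
qed

end

theorem proposition1:
  fixes T \<phi> :: "real \<Rightarrow> real" and N :: nat and C :: "nat \<Rightarrow> real set"
    and \<mu> :: "real measure" and M :: "nat \<Rightarrow> real"
  assumes "piecewise_expanding T N C"
    and "holder_continuous_on {0..1} \<phi>"
    and "gibbs_measure T N C \<phi> \<mu>"
    and "\<forall>k\<ge>1. M k \<in> {0..1}"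
    and "\<forall>k\<ge>1. M (Suc k) \<le> M k"
    and "\<exists>K>0. \<forall>k\<ge>2. M k \<le> K / (ln (real k))\<^sup>2"
  defines "B \<equiv> \<lambda>k x. unit_ball x (radius \<mu> (M k) x)"
    and "\<Phi> \<equiv> \<lambda>n. \<Sum>k=1..n. M k"
  defines "R \<equiv> \<lambda>x n. (\<Sum>k=1..n. indicator (B k x) ((T ^^ k) x)) - \<Phi> n"
  shows "(\<forall>x\<in>{0..1}. \<forall>k\<ge>1. measure \<mu> (B k x) = M k) \<and>
    (\<forall>\<epsilon>>0. AE x in \<mu>.
       if bounded (range \<Phi>) then bounded (range (R x))
       else R x \<in> O(\<lambda>n. \<Phi> n powr (1/2) * ln (\<Phi> n) powr (3/2 + \<epsilon>)))"
proof -
  interpret gibbs_map T \<phi> N C \<mu> by unfold_locales (use assms in auto)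
  obtain M' \<kappa> c \<rho> where "regular_map T \<phi> N C \<mu> M' \<kappa> c \<rho>" by (rule regular_constants)
  then interpret rm: regular_map T \<phi> N C \<mu> M' \<kappa> c \<rho> .
  have M01: "M k \<in> {0..1}" if "1 \<le> k" for k using assms(4) that by blast
  have "measure \<mu> (B k x) = M k" if "x \<in> {0..1}" "1 \<le> k" for x k
    using rm.radius_attained(2)[OF that(1) M01[OF that(2)]] by (simp add: B_def rm.F_def)
  moreover have "AE x in \<mu>. if bounded (range \<Phi>) then bounded (range (R x))
       else R x \<in> O(\<lambda>n. \<Phi> n powr (1/2) * ln (\<Phi> n) powr (3/2 + \<epsilon>))" if \<epsilon>: "\<epsilon> > 0" for \<epsilon>
  proof -
    \<comment> \<open>The value \<open>M 0\<close> is unconstrained and never enters the sums.\<close>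
    define m where "m k = (if k = 0 then 0 else M k)" for k
    have m: "m k \<in> {0..1}" "m 0 = 0" for k using M01[of k] by (auto simp: m_def)
    have \<Phi>m: "(\<Sum>k=1..n. m k) = \<Phi> n" for n by (auto simp: \<Phi>_def m_def intro!: sum.cong)
    have Rm: "(\<lambda>n. (\<Sum>k=1..n. indicator (rm.ret (m k) k) x) - \<Phi> n) = R x" if "x \<in> space \<mu>" for x
      using that by (auto simp: R_def B_def rm.ret_def m_def fun_eq_iff space_mu indicator_def intro!: sum.cong)
    from rm.recurrence_Borel_Cantelli[of m, OF m \<epsilon>, unfolded \<Phi>m] show ?thesis
    proof (rule AE_mp, intro AE_I2 impI)
      fix x assume "x \<in> space \<mu>"
        and "if bounded (range \<Phi>) then bounded (range (\<lambda>n. (\<Sum>k=1..n. indicator (rm.ret (m k) k) x) - \<Phi> n))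
          else (\<lambda>n. (\<Sum>k=1..n. indicator (rm.ret (m k) k) x) - \<Phi> n) \<in> O(\<lambda>n. \<Phi> n powr (1/2) * ln (\<Phi> n) powr (3/2 + \<epsilon>))"
      then show "if bounded (range \<Phi>) then bounded (range (R x))
          else R x \<in> O(\<lambda>n. \<Phi> n powr (1/2) * ln (\<Phi> n) powr (3/2 + \<epsilon>))"
        by (simp only: Rm)
    qed
  qed
  ultimately show ?thesis by blast
qed

end
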